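(* Let $n\ge 2$, let $M$ be a connected $n$-dimensional manifold, let $\Psi\colon M\to(\widetilde M^{n+2},\widetilde g)$ be a spacelike immersion into an $(n+2)$-dimensional Lorentzian manifold, with induced Riemannian metric $g=\Psi^*\widetilde g$, and let $\xi\in\mathfrak X^{\perp}(M)$ be a lightlike normal vector field along $\Psi$. Consider $(\mathcal T,\mathcal T^1,\widetilde g,\widetilde\nabla)$, where $\mathcal T=\Psi^*(T\widetilde M)$ has bundle metric $\widetilde g$, $\mathcal T^1=\mathrm{Span}(\xi)$, and $\widetilde\nabla$ is the induced connection on $\mathcal T$. Then $\widetilde\nabla$ is a tractor connection on the tractor conformal bundle $(\mathcal T,\mathcal T^1,\widetilde g)$ if and only if the Weingarten endomorphism $A_\xi$ is non-singular at every point $x\in M$. In this case, the induced metric $g$ belongs to the conformal structure on $M$ deduced from $(\mathcal T,\mathcal T^1,\widetilde g,\widetilde\nabla)$ if and only if there is a smooth function $\lambda\in C^\infty(M)$ such that $A_\xi^2=\lambda^2\cdot\mathrm{Id}$ (where $\lambda$ is a non-vanishing function on $M$).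
   Context: An immersion $\Psi\colon M^n\to(\widetilde M^{n+2},\widetilde g)$ into a Lorentzian manifold is spacelike if $g=\Psi^*\widetilde g$ is Riemannian. $\mathfrak X^\perp(M)$ denotes the normal vector fields along $\Psi$; $\xi\in\mathfrak X^\perp(M)$ is lightlike if it is nowhere zero and $\widetilde g(\xi,\xi)=0$. $\widetilde\nabla$ denotes the Levi-Civita connection of $\widetilde g$ and also the induced (pull-back) connection on $\mathcal T=\Psi^*(T\widetilde M)$. With $\nabla$ the Levi-Civita connection of $g$ and $\nabla^\perp$ the normal connection, the Gauss and Weingarten formulas are $\widetilde\nabla_XY=\nabla_XY+\mathrm{II}(X,Y)$ and $\widetilde\nabla_X\xi=-A_\xi X+\nabla^\perp_X\xi$ for $X,Y\in\mathfrak X(M)$; $A_\xi$ is the Weingarten endomorphism, and $g(A_\xi X,Y)=\widetilde g(\mathrm{II}(X,Y),\xi)$. A tractor conformal bundle on $M$ with $\dim M=n\ge 2$ is a rank $n+2$ real vector bundle $\mathcal T\to M$ with a bundle metric $h$ of Lorentzian signature $(n+1,1)$ and a distinguished lightlike line subbundle $\mathcal T^1\subset\mathcal T$. A tractor connection on it is a linear connection $\nabla^{\mathcal T}$ such that $\nabla^{\mathcal T}h=0$ and the map $\beta\colon TM\to\mathrm{Hom}(\mathcal T^1,(\mathcal T^1)^\perp/\mathcal T^1)$, $\beta(X_x)(v)=\nabla^{\mathcal T}_{X_x}\sigma+\mathcal T^1_x$ (with $x\in M$, $X_x\in T_xM$, $v\in\mathcal T^1_x$, and $\sigma\in\Gamma(\mathcal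 T^1)$ any section with $\sigma(x)=v$), is an isomorphism of vector bundles. For a tractor connection and a nonvanishing section $\sigma$ of $\mathcal T^1$, put $\beta_\sigma(X)=\nabla^{\mathcal T}_X\sigma+\mathcal T^1$ and define the Riemannian metric $h^\sigma(X,Y)=h(\beta_\sigma(X),\beta_\sigma(Y))$ on $M$. Different choices of $\sigma$ give conformally related metrics; the conformal structure deduced from $(\mathcal T,\mathcal T^1,h,\nabla^{\mathcal T})$ is the conformal class of these metrics ($g'$ and $g$ are conformally equivalent if $g'=e^{2u}g$ for some smooth function $u$). *)

theory Defs
  imports "HOL-Analysis.Analysis"
begin

section \<open>Smooth maps between Euclidean spaces\<close>

text \<open>
  \<open>Ck_on k S f\<close>: \<open>f\<close> is k times continuously differentiable on the open set \<open>S\<close>.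
\<close>

primrec Ck_on :: "nat \<Rightarrow> 'a::euclidean_space set \<Rightarrow> ('a \<Rightarrow> 'b::euclidean_space) \<Rightarrow> bool" where
  "Ck_on 0 S f \<longleftrightarrow> continuous_on S f"
| "Ck_on (Suc k) S f \<longleftrightarrow>
     (\<forall>x\<in>S. f differentiable (at x)) \<and> (\<forall>v. Ck_on k S (\<lambda>x. frechet_derivative f (at x) v))"

definition smooth_on :: "'a::euclidean_space set \<Rightarrow> ('a \<Rightarrow> 'b::euclidean_space) \<Rightarrow> bool" where
  "smooth_on S f \<longleftrightarrow> (\<forall>k. Ck_on k S f)"

section \<open>Smooth manifolds\<close>

text \<open>
  A manifold modelled on the Euclidean space \<open>'e\<close> is a Hausdorff, second countable type \<open>'m\<close>
  together with a smooth atlas; a chart is a pair (domain, coordinate map), and the values of the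
  coordinate map outside the domain are irrelevant.
\<close>

type_synonym ('m, 'e) chart = "'m set \<times> ('m \<Rightarrow> 'e)"

definition smooth_manifold ::
    "('m::{t2_space,second_countable_topology}, 'e::euclidean_space) chart set \<Rightarrow> bool" where
  "smooth_manifold A \<longleftrightarrow>
     (\<forall>(U, \<phi>)\<in>A. open U \<and> open (\<phi> ` U) \<and> homeomorphism U (\<phi> ` U) \<phi> (inv_into U \<phi>)) \<and>
     (\<Union>(U, \<phi>)\<in>A. U) = UNIV \<and>
     (\<forall>(U, \<phi>)\<in>A. \<forall>(V, \<psi>)\<in>A. smooth_on (\<phi> ` (U \<inter> V)) (\<psi> \<circ> inv_into U \<phi>))"

text \<open>Smoothness on an open set \<open>W\<close> of a function with values in a Euclidean space.\<close>

definition smooth_fun ::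
    "('m::topological_space, 'e::euclidean_space) chart set \<Rightarrow> 'm set \<Rightarrow> ('m \<Rightarrow> 'b::euclidean_space) \<Rightarrow> bool" where
  "smooth_fun A W f \<longleftrightarrow> (\<forall>(U, \<phi>)\<in>A. smooth_on (\<phi> ` (U \<inter> W)) (f \<circ> inv_into U \<phi>))"

definition smooth_map ::
    "('m::topological_space, 'e::euclidean_space) chart set \<Rightarrow>
     ('p::topological_space, 'f::euclidean_space) chart set \<Rightarrow> ('m \<Rightarrow> 'p) \<Rightarrow> bool" where
  "smooth_map A B \<Psi> \<longleftrightarrow>
     continuous_on UNIV \<Psi> \<and> (\<forall>(V, \<psi>)\<in>B. smooth_fun A (\<Psi> -` V) (\<psi> \<circ> \<Psi>))"

text \<open>
  The tangent space at \<open>x\<close> is represented by the model space \<open>'e\<close>: a tangent vector is given by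
  its coordinates with respect to one arbitrarily chosen chart around \<open>x\<close>. The choice may jump
  from point to point, so smoothness of vector fields is never tested on these representatives
  but always with respect to the charts of the atlas (see \<open>tangent_bundle\<close>).
\<close>

definition chart_at ::
    "('m, 'e) chart set \<Rightarrow> 'm \<Rightarrow> ('m, 'e) chart" where
  "chart_at A x = (SOME c. c \<in> A \<and> x \<in> fst c)"

definition coord_inv :: "('m, 'e) chart \<Rightarrow> 'e \<Rightarrow> 'm" where
  "coord_inv c = inv_into (fst c) (snd c)"

text \<open>
  \<open>dfun A f x v\<close> is the derivative of \<open>f\<close> in direction of the tangent vector \<open>v\<close> at \<open>x\<close>;
  \<open>dmap A B \<Psi> x\<close> is the differential of \<open>\<Psi>\<close> from the tangent space at \<open>x\<close> to the one at \<open>\<Psi> x\<close>.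
\<close>

definition dfun ::
    "('m, 'e::euclidean_space) chart set \<Rightarrow> ('m \<Rightarrow> 'b::euclidean_space) \<Rightarrow> 'm \<Rightarrow> 'e \<Rightarrow> 'b" where
  "dfun A f x =
     frechet_derivative (f \<circ> coord_inv (chart_at A x)) (at (snd (chart_at A x) x))"

definition dmap ::
    "('m, 'e::euclidean_space) chart set \<Rightarrow> ('p, 'f::euclidean_space) chart set \<Rightarrow>
     ('m \<Rightarrow> 'p) \<Rightarrow> 'm \<Rightarrow> 'e \<Rightarrow> 'f" where
  "dmap A B \<Psi> x = dfun A (snd (chart_at B (\<Psi> x)) \<circ> \<Psi>) x"

section \<open>Vector bundles\<close>

text \<open>
  A vector bundle of rank \<open>DIM('v)\<close> is given by a bundle atlas: every fibre is set-theoretically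
  identified with \<open>'v\<close> in an arbitrary way, and a local trivialization over the open set \<open>U\<close> is a
  family of linear isomorphisms from the fibres over \<open>U\<close> to \<open>'v\<close>. The smooth structure is carried
  by the trivializations only, whose transition functions are smooth.
\<close>

type_synonym ('m, 'v) triv = "'m set \<times> ('m \<Rightarrow> 'v \<Rightarrow> 'v)"

definition vector_bundle ::
    "('m::topological_space, 'e::euclidean_space) chart set \<Rightarrow> ('m, 'v::euclidean_space) triv set \<Rightarrow> bool" where
  "vector_bundle A E \<longleftrightarrow>
     (\<forall>(U, \<tau>)\<in>E. open U \<and> (\<forall>x\<in>U. linear (\<tau> x) \<and> bij (\<tau> x))) \<and>
     (\<Union>(U, \<tau>)\<in>E. U) = UNIV \<and>
     (\<forall>(U, \<tau>)\<in>E. \<forall>(V, \<rho>)\<in>E. \<forall>w. smooth_fun A (U \<inter> V) (\<lambda>x. \<rho> x (inv (\<tau> x) w)))"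

definition smooth_section ::
    "('m::topological_space, 'e::euclidean_space) chart set \<Rightarrow> ('m, 'v::euclidean_space) triv set \<Rightarrow>
     'm set \<Rightarrow> ('m \<Rightarrow> 'v) \<Rightarrow> bool" where
  "smooth_section A E W s \<longleftrightarrow> (\<forall>(U, \<tau>)\<in>E. smooth_fun A (U \<inter> W) (\<lambda>x. \<tau> x (s x)))"

text \<open>The chart \<open>(U, \<phi>)\<close> trivializes the tangent bundle over \<open>U\<close> by the differential of \<open>\<phi>\<close>.\<close>

definition tangent_bundle ::
    "('m, 'e::euclidean_space) chart set \<Rightarrow> ('m, 'e) triv set" where
  "tangent_bundle A = (\<lambda>(U, \<phi>). (U, \<lambda>x. dfun A \<phi> x)) ` A"

text \<open>The fibre over \<open>x\<close> of the pull-back bundle is the fibre over \<open>\<Psi> x\<close>.\<close>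

definition pullback_bundle ::
    "('m \<Rightarrow> 'p) \<Rightarrow> ('p, 'v) triv set \<Rightarrow> ('m, 'v) triv set" where
  "pullback_bundle \<Psi> E = (\<lambda>(V, \<tau>). (\<Psi> -` V, \<lambda>x. \<tau> (\<Psi> x))) ` E"

section \<open>Bundle metrics\<close>

type_synonym ('m, 'v) form_field = "'m \<Rightarrow> 'v \<Rightarrow> 'v \<Rightarrow> real"

definition bundle_metric ::
    "('m::topological_space, 'e::euclidean_space) chart set \<Rightarrow> ('m, 'v::euclidean_space) triv set \<Rightarrow>
     ('m, 'v) form_field \<Rightarrow> bool" where
  "bundle_metric A E h \<longleftrightarrow>
     (\<forall>x. bilinear (h x) \<and> (\<forall>u v. h x u v = h x v u) \<and>
          (\<forall>u. (\<forall>v. h x u v = 0) \<longrightarrow> u = 0)) \<and>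
     (\<forall>W s t. open W \<and> smooth_section A E W s \<and> smooth_section A E W t \<longrightarrow>
          smooth_fun A W (\<lambda>x. h x (s x) (t x)))"

text \<open>\<open>p\<close> is the number of positive and \<open>q\<close> the number of negative squares.\<close>

definition has_signature :: "nat \<Rightarrow> nat \<Rightarrow> ('v::euclidean_space \<Rightarrow> 'v \<Rightarrow> real) \<Rightarrow> bool" where
  "has_signature p q b \<longleftrightarrow>
     (\<exists>P N. finite P \<and> finite N \<and> P \<inter> N = {} \<and> card P = p \<and> card N = q \<and>
        independent (P \<union> N) \<and> span (P \<union> N) = UNIV \<and>
        (\<forall>e\<in>P. b e e = 1) \<and> (\<forall>e\<in>N. b e e = -1) \<and>
        (\<forall>e\<in>P \<union> N. \<forall>f\<in>P \<union> N. e \<noteq> f \<longrightarrow> b e f = 0))"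

definition riemannian_metric ::
    "('m::topological_space, 'e::euclidean_space) chart set \<Rightarrow> ('m, 'e) form_field \<Rightarrow> bool" where
  "riemannian_metric A g \<longleftrightarrow>
     bundle_metric A (tangent_bundle A) g \<and> (\<forall>x v. v \<noteq> 0 \<longrightarrow> g x v v > 0)"

definition lorentzian_metric ::
    "('m::topological_space, 'e::euclidean_space) chart set \<Rightarrow> ('m, 'e) form_field \<Rightarrow> bool" where
  "lorentzian_metric A g \<longleftrightarrow>
     bundle_metric A (tangent_bundle A) g \<and> (\<forall>x. has_signature (DIM('e) - 1) 1 (g x))"

definition conformally_equivalent ::
    "('m::topological_space, 'e::euclidean_space) chart set \<Rightarrow>
     ('m, 'e) form_field \<Rightarrow> ('m, 'e) form_field \<Rightarrow> bool" where
  "conformally_equivalent A g g' \<longleftrightarrow>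
     (\<exists>u. smooth_fun A UNIV u \<and> g' = (\<lambda>x v w. exp (2 * u x) * g x v w))"

section \<open>Linear connections\<close>

text \<open>
  \<open>D x v s\<close> is the covariant derivative at \<open>x\<close>, in direction of the tangent vector \<open>v\<close> at \<open>x\<close>, of a
  section \<open>s\<close> that is smooth on some open neighbourhood of \<open>x\<close> (the value is unspecified for other
  \<open>s\<close>). Covariant derivatives are local operators, so a connection acts on local sections; this
  action is part of the data here, constrained by the locality clause.
\<close>

type_synonym ('m, 'e, 'v) connection = "'m \<Rightarrow> 'e \<Rightarrow> ('m \<Rightarrow> 'v) \<Rightarrow> 'v"

definition linear_connection ::
    "('m::topological_space, 'e::euclidean_space) chart set \<Rightarrow> ('m, 'v::euclidean_space) triv set \<Rightarrow>
     ('m, 'e, 'v) connection \<Rightarrow> bool" where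
  "linear_connection A E D \<longleftrightarrow>
     (\<forall>W s. open W \<and> smooth_section A E W s \<longrightarrow>
        (\<forall>x\<in>W. linear (\<lambda>v. D x v s)) \<and>
        (\<forall>t. smooth_section A E W t \<longrightarrow>
           (\<forall>x\<in>W. \<forall>v. D x v (\<lambda>y. s y + t y) = D x v s + D x v t)) \<and>
        (\<forall>f. smooth_fun A W f \<longrightarrow>
           (\<forall>x\<in>W. \<forall>v. D x v (\<lambda>y. f y *\<^sub>R s y) = dfun A f x v *\<^sub>R s x + f x *\<^sub>R D x v s)) \<and>
        (\<forall>t. (\<forall>y\<in>W. t y = s y) \<longrightarrow> (\<forall>x\<in>W. \<forall>v. D x v t = D x v s)) \<and>
        (\<forall>X. smooth_section A (tangent_bundle A) W X \<longrightarrow>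
           smooth_section A E W (\<lambda>x. D x (X x) s)))"

definition metric_connection ::
    "('m::topological_space, 'e::euclidean_space) chart set \<Rightarrow> ('m, 'v::euclidean_space) triv set \<Rightarrow>
     ('m, 'v) form_field \<Rightarrow> ('m, 'e, 'v) connection \<Rightarrow> bool" where
  "metric_connection A E h D \<longleftrightarrow>
     (\<forall>W s t. open W \<and> smooth_section A E W s \<and> smooth_section A E W t \<longrightarrow>
        (\<forall>x\<in>W. \<forall>v. dfun A (\<lambda>y. h y (s y) (t y)) x v = h x (D x v s) (t x) + h x (s x) (D x v t)))"

text \<open>
  The condition that D_X Y - D_Y X is the Lie bracket [X,Y], with both sides evaluated as
  derivations on smooth functions: [X,Y] f = X (Y f) - Y (X f).
\<close>

definition torsion_free ::
    "('m::topological_space, 'e::euclidean_space) chart set \<Rightarrow> ('m, 'e, 'e) connection \<Rightarrow> bool" where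
  "torsion_free A D \<longleftrightarrow>
     (\<forall>W X Y f. open W \<and> smooth_section A (tangent_bundle A) W X \<and>
        smooth_section A (tangent_bundle A) W Y \<and> smooth_fun A W (f :: 'm \<Rightarrow> real) \<longrightarrow>
        (\<forall>x\<in>W. dfun A f x (D x (X x) Y - D x (Y x) X) =
           dfun A (\<lambda>y. dfun A f y (Y y)) x (X x) - dfun A (\<lambda>y. dfun A f y (X y)) x (Y x)))"

definition levi_civita ::
    "('m::topological_space, 'e::euclidean_space) chart set \<Rightarrow> ('m, 'e) form_field \<Rightarrow>
     ('m, 'e, 'e) connection \<Rightarrow> bool" where
  "levi_civita A g D \<longleftrightarrow>
     linear_connection A (tangent_bundle A) D \<and> metric_connection A (tangent_bundle A) g D \<and>
     torsion_free A D"

text \<open>The connection induced by \<open>D\<close> on the pull-back of the tangent bundle along \<open>\<Psi>\<close>.\<close>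

definition pullback_connection ::
    "('m::topological_space, 'e::euclidean_space) chart set \<Rightarrow>
     ('p::topological_space, 'f::euclidean_space) chart set \<Rightarrow> ('m \<Rightarrow> 'p) \<Rightarrow>
     ('p, 'f, 'f) connection \<Rightarrow> ('m, 'e, 'f) connection \<Rightarrow> bool" where
  "pullback_connection A B \<Psi> D D' \<longleftrightarrow>
     linear_connection A (pullback_bundle \<Psi> (tangent_bundle B)) D' \<and>
     (\<forall>V Y. open V \<and> smooth_section B (tangent_bundle B) V Y \<longrightarrow>
        (\<forall>x\<in>\<Psi> -` V. \<forall>v. D' x v (Y \<circ> \<Psi>) = D (\<Psi> x) (dmap A B \<Psi> x v) Y))"

section \<open>Spacelike immersions\<close>

definition induced_metric ::
    "('m, 'e::euclidean_space) chart set \<Rightarrow> ('p, 'f::euclidean_space) chart set \<Rightarrow>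
     ('m \<Rightarrow> 'p) \<Rightarrow> ('p, 'f) form_field \<Rightarrow> ('m, 'e) form_field" where
  "induced_metric A B \<Psi> gt = (\<lambda>x v w. gt (\<Psi> x) (dmap A B \<Psi> x v) (dmap A B \<Psi> x w))"

definition immersion ::
    "('m::topological_space, 'e::euclidean_space) chart set \<Rightarrow>
     ('p::topological_space, 'f::euclidean_space) chart set \<Rightarrow> ('m \<Rightarrow> 'p) \<Rightarrow> bool" where
  "immersion A B \<Psi> \<longleftrightarrow> smooth_map A B \<Psi> \<and> (\<forall>x. inj (dmap A B \<Psi> x))"

definition spacelike_immersion ::
    "('m::topological_space, 'e::euclidean_space) chart set \<Rightarrow>
     ('p::topological_space, 'f::euclidean_space) chart set \<Rightarrow> ('p, 'f) form_field \<Rightarrow>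
     ('m \<Rightarrow> 'p) \<Rightarrow> bool" where
  "spacelike_immersion A B gt \<Psi> \<longleftrightarrow>
     immersion A B \<Psi> \<and> riemannian_metric A (induced_metric A B \<Psi> gt)"

definition normal_space ::
    "('m, 'e::euclidean_space) chart set \<Rightarrow> ('p, 'f::euclidean_space) chart set \<Rightarrow>
     ('m \<Rightarrow> 'p) \<Rightarrow> ('p, 'f) form_field \<Rightarrow> 'm \<Rightarrow> 'f set" where
  "normal_space A B \<Psi> gt x = {w. \<forall>u. gt (\<Psi> x) w (dmap A B \<Psi> x u) = 0}"

definition normal_field ::
    "('m::topological_space, 'e::euclidean_space) chart set \<Rightarrow>
     ('p::topological_space, 'f::euclidean_space) chart set \<Rightarrow> ('m \<Rightarrow> 'p) \<Rightarrow>
     ('p, 'f) form_field \<Rightarrow> ('m \<Rightarrow> 'f) \<Rightarrow> bool" where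
  "normal_field A B \<Psi> gt \<xi> \<longleftrightarrow>
     smooth_section A (pullback_bundle \<Psi> (tangent_bundle B)) UNIV \<xi> \<and>
     (\<forall>x. \<xi> x \<in> normal_space A B \<Psi> gt x)"

definition lightlike_field :: "('m \<Rightarrow> 'p) \<Rightarrow> ('p, 'f::euclidean_space) form_field \<Rightarrow> ('m \<Rightarrow> 'f) \<Rightarrow> bool" where
  "lightlike_field \<Psi> gt \<xi> \<longleftrightarrow> (\<forall>x. \<xi> x \<noteq> 0 \<and> gt (\<Psi> x) (\<xi> x) (\<xi> x) = 0)"

text \<open>
  Weingarten formula: minus the image of \<open>weingarten \<dots> x v\<close> under the differential of \<open>\<Psi>\<close> is the
  tangential part of \<open>D x v \<xi>\<close>. The vector \<open>w\<close> is unique because the induced metric is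
  nondegenerate.
\<close>

definition weingarten ::
    "('m, 'e::euclidean_space) chart set \<Rightarrow> ('p, 'f::euclidean_space) chart set \<Rightarrow>
     ('m \<Rightarrow> 'p) \<Rightarrow> ('p, 'f) form_field \<Rightarrow> ('m, 'e, 'f) connection \<Rightarrow> ('m \<Rightarrow> 'f) \<Rightarrow> 'm \<Rightarrow> 'e \<Rightarrow> 'e" where
  "weingarten A B \<Psi> gt D \<xi> x v =
     (THE w. D x v \<xi> + dmap A B \<Psi> x w \<in> normal_space A B \<Psi> gt x)"

section \<open>Tractor conformal bundles and tractor connections\<close>

text \<open>A field of subsets \<open>L x\<close> of the fibres that is a smooth subbundle of rank one.\<close>

definition line_subbundle ::
    "('m::topological_space, 'e::euclidean_space) chart set \<Rightarrow> ('m, 'v::euclidean_space) triv set \<Rightarrow>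
     ('m \<Rightarrow> 'v set) \<Rightarrow> bool" where
  "line_subbundle A E L \<longleftrightarrow>
     (\<forall>x. subspace (L x) \<and> dim (L x) = 1) \<and>
     (\<forall>x. \<exists>W s. open W \<and> x \<in> W \<and> smooth_section A E W s \<and> (\<forall>y\<in>W. L y = span {s y}))"

definition tractor_conformal_bundle ::
    "('m::{t2_space,second_countable_topology}, 'e::euclidean_space) chart set \<Rightarrow>
     ('m, 'v::euclidean_space) triv set \<Rightarrow> ('m \<Rightarrow> 'v set) \<Rightarrow> ('m, 'v) form_field \<Rightarrow> bool" where
  "tractor_conformal_bundle A E L h \<longleftrightarrow>
     smooth_manifold A \<and> DIM('e) \<ge> 2 \<and>
     vector_bundle A E \<and> DIM('v) = DIM('e) + 2 \<and>
     bundle_metric A E h \<and> (\<forall>x. has_signature (DIM('e) + 1) 1 (h x)) \<and>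
     line_subbundle A E L \<and> (\<forall>x. \<forall>v\<in>L x. h x v v = 0)"

text \<open>
  Sections of \<open>L\<close>, and the orthogonal complement of \<open>L\<close> with respect to \<open>h\<close>.
\<close>

definition sub_section ::
    "('m::topological_space, 'e::euclidean_space) chart set \<Rightarrow> ('m, 'v::euclidean_space) triv set \<Rightarrow>
     ('m \<Rightarrow> 'v set) \<Rightarrow> 'm set \<Rightarrow> ('m \<Rightarrow> 'v) \<Rightarrow> bool" where
  "sub_section A E L W s \<longleftrightarrow> smooth_section A E W s \<and> (\<forall>x\<in>W. s x \<in> L x)"

definition perp :: "('m, 'v) form_field \<Rightarrow> ('m \<Rightarrow> 'v set) \<Rightarrow> 'm \<Rightarrow> 'v set" where
  "perp h L x = {v. \<forall>w\<in>L x. h x v w = 0}"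

text \<open>
  The quotient of a subspace \<open>V\<close> by a subspace \<open>L\<close> of \<open>V\<close>: its elements are the classes \<open>a + L\<close>
  with \<open>a \<in> V\<close>, as sets of vectors. Adding \<open>L\<close> in \<open>qscale\<close> matters only for the scalar 0.
\<close>

definition qclass :: "'v::real_vector set \<Rightarrow> 'v \<Rightarrow> 'v set" where
  "qclass L a = {a + w |w. w \<in> L}"

definition quotient_space :: "'v::real_vector set \<Rightarrow> 'v set \<Rightarrow> 'v set set" where
  "quotient_space V L = qclass L ` V"

definition qadd :: "'v::real_vector set \<Rightarrow> 'v set \<Rightarrow> 'v set" where
  "qadd C C' = {a + b |a b. a \<in> C \<and> b \<in> C'}"

definition qscale :: "'v::real_vector set \<Rightarrow> real \<Rightarrow> 'v set \<Rightarrow> 'v set" where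
  "qscale L c C = {c *\<^sub>R a + w |a w. a \<in> C \<and> w \<in> L}"

text \<open>Linear maps from \<open>L\<close> to \<open>V/L\<close>, made extensional outside \<open>L\<close>.\<close>

definition hom_quotient :: "'v::real_vector set \<Rightarrow> 'v set \<Rightarrow> ('v \<Rightarrow> 'v set) set" where
  "hom_quotient V L =
     {F \<in> L \<rightarrow>\<^sub>E quotient_space V L.
        (\<forall>v\<in>L. \<forall>w\<in>L. F (v + w) = qadd (F v) (F w)) \<and>
        (\<forall>c. \<forall>v\<in>L. F (c *\<^sub>R v) = qscale L c (F v))}"

text \<open>
  Smooth sections over \<open>W\<close> of the quotient bundle \<open>V/L\<close> (those which locally lift to smooth sections
  of \<open>V\<close>) and of \<open>Hom(L, V/L)\<close> (those which map smooth local sections of \<open>L\<close> to smooth sections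
  of \<open>V/L\<close>).
\<close>

definition smooth_quotient_section ::
    "('m::topological_space, 'e::euclidean_space) chart set \<Rightarrow> ('m, 'v::euclidean_space) triv set \<Rightarrow>
     ('m \<Rightarrow> 'v set) \<Rightarrow> ('m \<Rightarrow> 'v set) \<Rightarrow> 'm set \<Rightarrow> ('m \<Rightarrow> 'v set) \<Rightarrow> bool" where
  "smooth_quotient_section A E V L W q \<longleftrightarrow>
     (\<forall>x\<in>W. \<exists>W' s. open W' \<and> x \<in> W' \<and> W' \<subseteq> W \<and> sub_section A E V W' s \<and>
        (\<forall>y\<in>W'. q y = qclass (L y) (s y)))"

definition smooth_hom_section ::
    "('m::topological_space, 'e::euclidean_space) chart set \<Rightarrow> ('m, 'v::euclidean_space) triv set \<Rightarrow>
     ('m \<Rightarrow> 'v set) \<Rightarrow> ('m \<Rightarrow> 'v set) \<Rightarrow> 'm set \<Rightarrow> ('m \<Rightarrow> 'v \<Rightarrow> 'v set) \<Rightarrow> bool" where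
  "smooth_hom_section A E V L W F \<longleftrightarrow>
     (\<forall>W' \<sigma>. open W' \<and> W' \<subseteq> W \<and> sub_section A E L W' \<sigma> \<longrightarrow>
        smooth_quotient_section A E V L W' (\<lambda>x. F x (\<sigma> x)))"

text \<open>
  The map \<open>\<beta>\<close>. The class of \<open>D x X \<sigma>\<close> modulo \<open>L x\<close> does not depend on the section \<open>\<sigma>\<close> of \<open>L\<close>
  with \<open>\<sigma> x = v\<close>: by the Leibniz rule it does not change if a section of \<open>L\<close> vanishing at \<open>x\<close>
  is added to \<open>\<sigma>\<close>.
\<close>

definition tractor_beta ::
    "('m::topological_space, 'e::euclidean_space) chart set \<Rightarrow> ('m, 'v::euclidean_space) triv set \<Rightarrow>
     ('m \<Rightarrow> 'v set) \<Rightarrow> ('m, 'e, 'v) connection \<Rightarrow> 'm \<Rightarrow> 'e \<Rightarrow> 'v \<Rightarrow> 'v set" where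
  "tractor_beta A E L D x X =
     (\<lambda>v\<in>L x. qclass (L x) (D x X (SOME \<sigma>. sub_section A E L UNIV \<sigma> \<and> \<sigma> x = v)))"

text \<open>
  A vector bundle isomorphism from the tangent bundle to \<open>Hom(L, V/L)\<close> over the identity:
  a linear isomorphism on each fibre which is smooth (the direction from left to right of the
  last clause) and has a smooth inverse (the other direction).
\<close>

definition bundle_iso_to_hom ::
    "('m::topological_space, 'e::euclidean_space) chart set \<Rightarrow> ('m, 'v::euclidean_space) triv set \<Rightarrow>
     ('m \<Rightarrow> 'v set) \<Rightarrow> ('m \<Rightarrow> 'v set) \<Rightarrow> ('m \<Rightarrow> 'e \<Rightarrow> 'v \<Rightarrow> 'v set) \<Rightarrow> bool" where
  "bundle_iso_to_hom A E V L \<beta> \<longleftrightarrow>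
     (\<forall>x. bij_betw (\<beta> x) UNIV (hom_quotient (V x) (L x)) \<and>
        (\<forall>X Y. \<forall>v\<in>L x. \<beta> x (X + Y) v = qadd (\<beta> x X v) (\<beta> x Y v)) \<and>
        (\<forall>c X. \<forall>v\<in>L x. \<beta> x (c *\<^sub>R X) v = qscale (L x) c (\<beta> x X v))) \<and>
     (\<forall>W X. open W \<longrightarrow>
        (smooth_section A (tangent_bundle A) W X \<longleftrightarrow>
         smooth_hom_section A E V L W (\<lambda>x. \<beta> x (X x))))"

definition tractor_connection ::
    "('m::topological_space, 'e::euclidean_space) chart set \<Rightarrow> ('m, 'v::euclidean_space) triv set \<Rightarrow>
     ('m \<Rightarrow> 'v set) \<Rightarrow> ('m, 'v) form_field \<Rightarrow> ('m, 'e, 'v) connection \<Rightarrow> bool" where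
  "tractor_connection A E L h D \<longleftrightarrow>
     linear_connection A E D \<and> metric_connection A E h D \<and>
     bundle_iso_to_hom A E (perp h L) L (tractor_beta A E L D)"

text \<open>
  The bilinear form induced by a form \<open>b\<close> on \<open>V/L\<close> with \<open>V\<close> orthogonal to \<open>L\<close>; the value does
  not depend on the representatives.
\<close>

definition quotient_form :: "('v \<Rightarrow> 'v \<Rightarrow> real) \<Rightarrow> 'v set \<Rightarrow> 'v set \<Rightarrow> real" where
  "quotient_form b C C' = b (SOME a. a \<in> C) (SOME a. a \<in> C')"

definition tractor_metric ::
    "('m \<Rightarrow> 'v::real_vector set) \<Rightarrow> ('m, 'v) form_field \<Rightarrow> ('m, 'e, 'v) connection \<Rightarrow> ('m \<Rightarrow> 'v) \<Rightarrow>
     ('m, 'e) form_field" where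
  "tractor_metric L h D \<sigma> =
     (\<lambda>x X Y. quotient_form (h x) (qclass (L x) (D x X \<sigma>)) (qclass (L x) (D x Y \<sigma>)))"

definition tractor_conformal_structure ::
    "('m::topological_space, 'e::euclidean_space) chart set \<Rightarrow> ('m, 'v::euclidean_space) triv set \<Rightarrow>
     ('m \<Rightarrow> 'v set) \<Rightarrow> ('m, 'v) form_field \<Rightarrow> ('m, 'e, 'v) connection \<Rightarrow> ('m, 'e) form_field set" where
  "tractor_conformal_structure A E L h D =
     {g. \<exists>\<sigma>. sub_section A E L UNIV \<sigma> \<and> (\<forall>x. \<sigma> x \<noteq> 0) \<and>
             conformally_equivalent A (tractor_metric L h D \<sigma>) g}"

end

(* Write S for the Weingarten endomorphism of the lightlike normal field xi. A normal vector u
   orthogonal to xi is a multiple of xi: otherwise the tangent space, xi and u would span the whole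
   fibre, and xi, being orthogonal to all of them, would be zero. As h(xi, xi) = 0, the derivative
   D_X xi is orthogonal to xi, so D_X xi equals -dPsi(S X) modulo xi. Hence beta is injective at x,
   equivalently bijective, exactly when S is. For sigma = f xi the tractor metric is
   f^2 g(S X, S Y) = f^2 g(S^2 X, Y), because S is self-adjoint. So g = e^(2u) f^2 g(S^2 ., .) is
   equivalent to S^2 = l^2 Id with l = e^(-u) / f. *)

theory Submission
  imports Defs
begin

section \<open>Smooth maps between Euclidean spaces\<close>

text \<open>Two steps named in the overview carry most of the work. Self-adjointness of
  \<open>S\<close> is the symmetry of the second fundamental form: differentiating the relation that
  \<xi> is orthogonal to \<open>d y (Y y)\<close> reduces it to an exchange of directions in the
  covariant derivative of d\<Psi> along coordinate fields, hence to equality of mixed second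
  derivatives and to vanishing torsion. The obstacle is that the induced connection is prescribed
  only on sections of the form \<open>Y \<circ> \<Psi>\<close>. Other sections, such as the image of
  a tangent field, are reached by expanding in a pulled-back frame and using the Leibniz rule;
  metric compatibility of \<open>D\<close> comes out in the same way. The second step is the smooth
  inverse demanded of a bundle isomorphism. In a coordinate frame it amounts to solving a linear
  system whose matrix is smooth and nonsingular. Coordinates of tangent vectors refer to a chart
  that may jump with the point. Smoothness of a field can therefore never be read off its values,
  and every smoothness argument passes through a trivialization.\<close>

lemma Ck_on_cong:
  assumes "open S" "\<And>x. x \<in> S \<Longrightarrow> f x = g x"
  shows "Ck_on k S f \<longleftrightarrow> Ck_on k S g"
  using assms(2)
proof (induction k arbitrary: f g)
  case 0
  then show ?case by (auto cong: continuous_on_cong)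
next
  case (Suc k)
  have hd: "(f has_derivative F) (at x) \<longleftrightarrow> (g has_derivative F) (at x)" if "x \<in> S" for x F
    using that Suc.prems
      has_derivative_transform_within_open[OF _ \<open>open S\<close> that, of f F UNIV g]
      has_derivative_transform_within_open[OF _ \<open>open S\<close> that, of g F UNIV f]
    by auto
  then have d: "f differentiable at x \<longleftrightarrow> g differentiable at x" if "x \<in> S" for x
    using that unfolding differentiable_def by simp
  have fd: "frechet_derivative f (at x) = frechet_derivative g (at x)" if "x \<in> S" for x
    using hd[OF that] by (simp add: frechet_derivative_def)
  have "Ck_on k S (\<lambda>x. frechet_derivative f (at x) v) \<longleftrightarrow>
        Ck_on k S (\<lambda>x. frechet_derivative g (at x) v)" for v
    by (rule Suc.IH) (simp add: fd)
  then show ?case using d by simp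
qed

lemma Ck_on_subset: "Ck_on k S f \<Longrightarrow> T \<subseteq> S \<Longrightarrow> Ck_on k T f"
  by (induction k arbitrary: f) (auto intro: continuous_on_subset)

text \<open>The recursive clause at \<open>Suc k\<close> speaks of differentiability and of the
  derivatives, not of level \<open>k\<close> of \<open>f\<close> itself. Product and chain rules
  need that level, because undifferentiated factors survive in the derivative.\<close>

lemma Ck_on_SucD: "Ck_on (Suc k) S f \<Longrightarrow> Ck_on k S f"
proof (induction k arbitrary: f)
  case 0
  then show ?case
    by (simp add: continuous_at_imp_continuous_on differentiable_imp_continuous_within)
next
  case (Suc k)
  then have "Ck_on k S (\<lambda>x. frechet_derivative f (at x) v)" for v
    by (intro Suc.IH) (simp del: Ck_on.simps add: Ck_on.simps(2)[of "Suc k"])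
  with Suc.prems show ?case by simp
qed

text \<open>The closure lemmas below exhibit an explicit derivative \<open>f'\<close> and treat it
  by the induction hypothesis; this rule spares them any rewriting of
  \<open>frechet_derivative\<close>.\<close>

lemma Ck_on_SucI:
  assumes "open S" "\<And>x. x \<in> S \<Longrightarrow> (f has_derivative f' x) (at x)"
    and "\<And>v. Ck_on k S (\<lambda>x. f' x v)"
  shows "Ck_on (Suc k) S f"
proof -
  have "frechet_derivative f (at x) = f' x" if "x \<in> S" for x
    using assms(2)[OF that] by (metis frechet_derivative_at)
  then have "Ck_on k S (\<lambda>x. frechet_derivative f (at x) v)" for v
    using assms(3) Ck_on_cong[OF \<open>open S\<close>, of "\<lambda>x. frechet_derivative f (at x) v" "\<lambda>x. f' x v"]
    by simp
  then show ?thesis using assms(2) by (auto simp: differentiable_def)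
qed

lemma Ck_on_Suc_derivative:
  assumes "Ck_on (Suc k) S f"
  shows "x \<in> S \<Longrightarrow> (f has_derivative frechet_derivative f (at x)) (at x)"
    and "Ck_on k S (\<lambda>x. frechet_derivative f (at x) v)" and "Ck_on k S f"
  using assms Ck_on_SucD[OF assms] by (simp_all add: frechet_derivative_works[symmetric])

text \<open>Derivatives are taken in the full neighbourhood filter \<open>at x\<close>, so they are
  local already; only continuity on \<open>S\<close>, which may fail to be open, needs the
  comparison of \<open>at x within S\<close> with \<open>at x within S \<inter> T\<close>.\<close>

lemma Ck_on_local:
  assumes "\<And>x. x \<in> S \<Longrightarrow> \<exists>T. open T \<and> x \<in> T \<and> Ck_on k (S \<inter> T) f"
  shows "Ck_on k S f"
  using assms
proof (induction k arbitrary: f)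
  case 0
  have "continuous (at x within S) f" if "x \<in> S" for x
  proof -
    obtain T where T: "open T" "x \<in> T" "continuous_on (S \<inter> T) f"
      using 0[OF \<open>x \<in> S\<close>] by auto
    have "at x within S = at x within S \<inter> T"
      by (rule at_within_nhd[OF T(2,1)]) blast
    then show ?thesis
      using T that by (simp add: continuous_on_eq_continuous_within)
  qed
  then show ?case by (simp add: continuous_on_eq_continuous_within)
next
  case (Suc k)
  show ?case
    unfolding Ck_on.simps
  proof (intro conjI ballI allI)
    fix x assume "x \<in> S"
    from Suc.prems[OF this] show "f differentiable at x"
      using \<open>x \<in> S\<close> by auto
  next
    fix v
    show "Ck_on k S (\<lambda>x. frechet_derivative f (at x) v)"
    proof (rule Suc.IH)
      fix x assume "x \<in> S"
      from Suc.prems[OF this]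
      show "\<exists>T. open T \<and> x \<in> T \<and> Ck_on k (S \<inter> T) (\<lambda>x. frechet_derivative f (at x) v)"
        by auto
    qed
  qed
qed

section \<open>Closure properties of k-fold differentiability\<close>

lemma Ck_on_const [intro, simp]: "open S \<Longrightarrow> Ck_on k S (\<lambda>x. c)"
  by (induction k arbitrary: c) auto

lemma Ck_on_bounded_linear:
  assumes "open S" "bounded_linear L" "Ck_on k S f"
  shows "Ck_on k S (\<lambda>x. L (f x))"
  using assms(3)
proof (induction k arbitrary: f)
  case 0
  then show ?case by (simp add: bounded_linear.continuous_on[OF assms(2)])
next
  case (Suc k)
  let ?f' = "\<lambda>x. frechet_derivative f (at x)"
  note f' = Ck_on_Suc_derivative[OF Suc.prems]
  show ?case
  proof (rule Ck_on_SucI[OF \<open>open S\<close>, where f' = "\<lambda>x v. L (?f' x v)"])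
    show "((\<lambda>x. L (f x)) has_derivative (\<lambda>v. L (?f' x v))) (at x)" if "x \<in> S" for x
      by (rule bounded_linear.has_derivative[OF assms(2) f'(1)[OF that]])
  qed (rule Suc.IH[OF f'(2)])
qed

lemma Ck_on_add:
  assumes "open S" "Ck_on k S f" "Ck_on k S g"
  shows "Ck_on k S (\<lambda>x. f x + g x)"
  using assms(2,3)
proof (induction k arbitrary: f g)
  case 0
  then show ?case by (simp add: continuous_on_add)
next
  case (Suc k)
  let ?f' = "\<lambda>x. frechet_derivative f (at x)"
  note f' = Ck_on_Suc_derivative[OF Suc.prems(1)]
  let ?g' = "\<lambda>x. frechet_derivative g (at x)"
  note g' = Ck_on_Suc_derivative[OF Suc.prems(2)]
  show ?case
  proof (rule Ck_on_SucI[OF \<open>open S\<close>, where f' = "\<lambda>x v. ?f' x v + ?g' x v"])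
    show "((\<lambda>x. f x + g x) has_derivative (\<lambda>v. ?f' x v + ?g' x v)) (at x)" if "x \<in> S" for x
      by (rule has_derivative_add[OF f'(1)[OF that] g'(1)[OF that]])
  qed (rule Suc.IH[OF f'(2) g'(2)])
qed

lemma Ck_on_bilinear:
  assumes "open S" "bounded_bilinear b" "Ck_on k S f" "Ck_on k S g"
  shows "Ck_on k S (\<lambda>x. b (f x) (g x))"
  using assms(3,4)
proof (induction k arbitrary: f g)
  case 0
  then show ?case by (simp add: bounded_bilinear.continuous_on[OF assms(2)])
next
  case (Suc k)
  let ?f' = "\<lambda>x. frechet_derivative f (at x)"
  note f' = Ck_on_Suc_derivative[OF Suc.prems(1)]
  let ?g' = "\<lambda>x. frechet_derivative g (at x)"
  note g' = Ck_on_Suc_derivative[OF Suc.prems(2)]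
  show ?case
  proof (rule Ck_on_SucI[OF \<open>open S\<close>, where f' = "\<lambda>x v. b (f x) (?g' x v) + b (?f' x v) (g x)"])
    show "((\<lambda>x. b (f x) (g x)) has_derivative (\<lambda>v. b (f x) (?g' x v) + b (?f' x v) (g x))) (at x)"
      if "x \<in> S" for x
      by (rule bounded_bilinear.FDERIV[OF assms(2) f'(1)[OF that] g'(1)[OF that]])
    show "Ck_on k S (\<lambda>x. b (f x) (?g' x v) + b (?f' x v) (g x))" for v
      by (rule Ck_on_add[OF \<open>open S\<close> Suc.IH[OF f'(3) g'(2)] Suc.IH[OF f'(2) g'(3)]])
  qed
qed

lemma Ck_on_sum:
  assumes "open S" "\<And>i. i \<in> I \<Longrightarrow> Ck_on k S (f i)"
  shows "Ck_on k S (\<lambda>x. \<Sum>i\<in>I. f i x)"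
proof (cases "finite I")
  case True
  then show ?thesis using assms(2)
    by (induction I) (auto intro: Ck_on_add[OF \<open>open S\<close>] assms(1))
qed (use assms(1) in auto)

lemma Ck_on_compose:
  assumes "open S" "open T" "f ` S \<subseteq> T" "Ck_on k S f" "Ck_on k T g"
  shows "Ck_on k S (\<lambda>x. g (f x))"
  using assms(4,5)
proof (induction k arbitrary: g)
  case 0
  then show ?case using assms(3) by (auto intro: continuous_on_compose2)
next
  case (Suc k)
  let ?f' = "\<lambda>x. frechet_derivative f (at x)"
  note f' = Ck_on_Suc_derivative[OF Suc.prems(1)]
  let ?g' = "\<lambda>x. frechet_derivative g (at x)"
  note g' = Ck_on_Suc_derivative[OF Suc.prems(2)]
  have c: "Ck_on k S (\<lambda>x. ?g' (f x) v)" for v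
    using Suc.IH[OF f'(3) g'(2)] .
  \<comment> \<open>\<open>Ck_on\<close> controls derivatives in fixed directions only, while the
    chain rule produces \<open>?g' (f x)\<close> in the varying direction \<open>?f' x v\<close>.
    Expanding this direction in \<open>Basis\<close> leaves products of a coefficient with a
    derivative in a fixed direction.\<close>
  show ?case
  proof (rule Ck_on_SucI[OF \<open>open S\<close>, where f' = "\<lambda>x v. \<Sum>b\<in>Basis. (?f' x v \<bullet> b) *\<^sub>R ?g' (f x) b"])
    fix x assume x: "x \<in> S"
    have g: "(g has_derivative ?g' (f x)) (at (f x))" using g'(1) x assms(3) by auto
    then have lin: "linear (?g' (f x))"
      using has_derivative_linear by blast
    have "?g' (f x) (?f' x v) = (\<Sum>b\<in>Basis. (?f' x v \<bullet> b) *\<^sub>R ?g' (f x) b)" for v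
      using linear_sum[OF lin, of "\<lambda>b. (?f' x v \<bullet> b) *\<^sub>R b" Basis]
      by (simp add: linear_cmul[OF lin] euclidean_representation)
    moreover have "((\<lambda>x. g (f x)) has_derivative (\<lambda>v. ?g' (f x) (?f' x v))) (at x)"
      using has_derivative_compose[OF f'(1)[OF x] g] .
    ultimately show "((\<lambda>x. g (f x)) has_derivative
        (\<lambda>v. \<Sum>b\<in>Basis. (?f' x v \<bullet> b) *\<^sub>R ?g' (f x) b)) (at x)"
      by simp
  next
    fix v
    show "Ck_on k S (\<lambda>x. \<Sum>b\<in>Basis. (?f' x v \<bullet> b) *\<^sub>R ?g' (f x) b)"
      by (intro Ck_on_sum[OF \<open>open S\<close>] Ck_on_bilinear[OF \<open>open S\<close> bounded_bilinear_scaleR] c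
          Ck_on_bounded_linear[OF \<open>open S\<close> bounded_linear_inner_left] f'(2))
  qed
qed

text \<open>The derivative contains \<open>inverse (f x)\<close> again, so the induction hypothesis
  for the same \<open>f\<close> at level \<open>k\<close> is what closes the step.\<close>

lemma Ck_on_inverse:
  fixes f :: "'a::euclidean_space \<Rightarrow> real"
  assumes "open S" "Ck_on k S f" "\<And>x. x \<in> S \<Longrightarrow> f x \<noteq> 0"
  shows "Ck_on k S (\<lambda>x. inverse (f x))"
  using assms(2)
proof (induction k)
  case 0
  then show ?case using assms(3) by (simp add: continuous_on_inverse)
next
  case (Suc k)
  let ?f' = "\<lambda>x. frechet_derivative f (at x)"
  note f' = Ck_on_Suc_derivative[OF Suc.prems(1)]
  show ?case
  proof (rule Ck_on_SucI[OF \<open>open S\<close>,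
        where f' = "\<lambda>x v. - (inverse (f x) * ?f' x v * inverse (f x))"])
    show "Ck_on k S (\<lambda>x. - (inverse (f x) * ?f' x v * inverse (f x)))" for v
      by (rule Ck_on_bounded_linear[OF \<open>open S\<close> bounded_linear_minus[OF bounded_linear_ident]
          Ck_on_bilinear[OF \<open>open S\<close> bounded_bilinear_mult
            Ck_on_bilinear[OF \<open>open S\<close> bounded_bilinear_mult Suc.IH[OF f'(3)] f'(2)] Suc.IH[OF f'(3)]]])
    show "((\<lambda>x. inverse (f x)) has_derivative
        (\<lambda>v. - (inverse (f x) * ?f' x v * inverse (f x)))) (at x)" if "x \<in> S" for x
      by (rule Deriv.has_derivative_inverse[OF assms(3)[OF that] f'(1)[OF that]])
  qed
qed

lemma Ck_on_exp:
  fixes f :: "'a::euclidean_space \<Rightarrow> real"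
  assumes "open S" "Ck_on k S f"
  shows "Ck_on k S (\<lambda>x. exp (f x))"
  using assms(2)
proof (induction k)
  case 0
  then show ?case by (simp add: continuous_on_exp)
next
  case (Suc k)
  let ?f' = "\<lambda>x. frechet_derivative f (at x)"
  note f' = Ck_on_Suc_derivative[OF Suc.prems(1)]
  show ?case
  proof (rule Ck_on_SucI[OF \<open>open S\<close>, where f' = "\<lambda>x v. ?f' x v * exp (f x)"])
    show "((\<lambda>x. exp (f x)) has_derivative (\<lambda>v. ?f' x v * exp (f x))) (at x)" if "x \<in> S" for x
      by (rule has_derivative_exp[OF f'(1)[OF that]])
    show "Ck_on k S (\<lambda>x. ?f' x v * exp (f x))" for v
      by (rule Ck_on_bilinear[OF \<open>open S\<close> bounded_bilinear_mult f'(2) Suc.IH[OF f'(3)]])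
  qed
qed

section \<open>Smooth maps on subsets of Euclidean space\<close>

lemma smooth_on_cong:
  "open S \<Longrightarrow> (\<And>x. x \<in> S \<Longrightarrow> f x = g x) \<Longrightarrow> smooth_on S f \<longleftrightarrow> smooth_on S g"
  unfolding smooth_on_def using Ck_on_cong by blast

lemma smooth_on_transform:
  assumes "smooth_on S f" "open S" "\<And>x. x \<in> S \<Longrightarrow> f x = g x"
  shows "smooth_on S g"
  using assms(1) smooth_on_cong[OF assms(2,3)] by simp

lemma smooth_on_subset: "smooth_on S f \<Longrightarrow> T \<subseteq> S \<Longrightarrow> smooth_on T f"
  unfolding smooth_on_def using Ck_on_subset by blast

lemma smooth_on_local:
  assumes "\<And>x. x \<in> S \<Longrightarrow> \<exists>T. open T \<and> x \<in> T \<and> smooth_on (S \<inter> T) f"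
  shows "smooth_on S f"
  unfolding smooth_on_def
proof
  fix k
  show "Ck_on k S f"
    by (rule Ck_on_local) (use assms in \<open>fastforce simp: smooth_on_def\<close>)
qed

lemma smooth_on_compose:
  "open S \<Longrightarrow> open T \<Longrightarrow> f ` S \<subseteq> T \<Longrightarrow> smooth_on S f \<Longrightarrow> smooth_on T g \<Longrightarrow>
    smooth_on S (\<lambda>x. g (f x))"
  unfolding smooth_on_def using Ck_on_compose by blast

lemma smooth_on_imp_continuous_on: "smooth_on S f \<Longrightarrow> continuous_on S f"
  unfolding smooth_on_def by (metis Ck_on.simps(1))

lemma smooth_on_differentiable: "smooth_on S f \<Longrightarrow> x \<in> S \<Longrightarrow> f differentiable at x"
  unfolding smooth_on_def by (metis Ck_on.simps(2))

lemma smooth_on_derivative: "smooth_on S f \<Longrightarrow> smooth_on S (\<lambda>x. frechet_derivative f (at x) v)"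
  unfolding smooth_on_def by (metis Ck_on.simps(2))

lemma smooth_on_derivative_section:
  assumes "open S" "smooth_on S f" "smooth_on S s"
  shows "smooth_on S (\<lambda>x. frechet_derivative f (at x) (s x))"
proof -
  have "smooth_on S (\<lambda>x. \<Sum>b\<in>Basis. (s x \<bullet> b) *\<^sub>R frechet_derivative f (at x) b)"
    using assms(3) smooth_on_derivative[OF assms(2)]
    unfolding smooth_on_def
    by (auto intro!: Ck_on_sum Ck_on_bilinear[OF _ bounded_bilinear_scaleR]
        Ck_on_bounded_linear[OF _ bounded_linear_inner_left] assms(1))
  moreover have "frechet_derivative f (at x) (s x) =
      (\<Sum>b\<in>Basis. (s x \<bullet> b) *\<^sub>R frechet_derivative f (at x) b)" if "x \<in> S" for x
  proof -
    have lin: "linear (frechet_derivative f (at x))"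
      using smooth_on_differentiable[OF assms(2) that] by (rule linear_frechet_derivative)
    show ?thesis
      using linear_sum[OF lin, of "\<lambda>b. (s x \<bullet> b) *\<^sub>R b" Basis]
      by (simp add: linear_cmul[OF lin] euclidean_representation)
  qed
  ultimately show ?thesis by (subst smooth_on_cong[OF assms(1)]) auto
qed

section \<open>Symmetry of second derivatives\<close>

text \<open>The mean value theorem is used twice: along \<open>u\<close>, for the difference of
  \<open>f\<close> across the shift \<open>s *\<^sub>R v\<close>, and then along \<open>v\<close>,
  for the directional derivative \<open>f' _ u\<close>. The second difference becomes exactly
  \<open>s * s\<close> times a mixed derivative at some point of the ball.\<close>

lemma second_difference_mvt:
  fixes f :: "'a::real_normed_vector \<Rightarrow> real"
  assumes ball: "ball x r \<subseteq> S" and s: "0 < s" "s * (norm u + norm v) < r"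
    and f: "\<And>y. y \<in> S \<Longrightarrow> (f has_derivative f' y) (at y)"
    and g: "\<And>y. y \<in> S \<Longrightarrow> ((\<lambda>y. f' y u) has_derivative f'' y) (at y)"
  obtains p where "p \<in> ball x r"
    "f (x + s *\<^sub>R u + s *\<^sub>R v) - f (x + s *\<^sub>R u) - f (x + s *\<^sub>R v) + f x = s * s * f'' p v"
proof -
  have near: "x + a *\<^sub>R u + b *\<^sub>R v \<in> ball x r" if "0 \<le> a" "a \<le> s" "0 \<le> b" "b \<le> s" for a b
  proof -
    have "norm (a *\<^sub>R u + b *\<^sub>R v) \<le> a * norm u + b * norm v"
      using that norm_triangle_ineq[of "a *\<^sub>R u" "b *\<^sub>R v"] by simp
    also have "\<dots> \<le> s * norm u + s * norm v"
      using that by (intro add_mono mult_right_mono) auto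
    also have "\<dots> < r" using s by (simp add: distrib_left)
    finally have "norm (x - (x + a *\<^sub>R u + b *\<^sub>R v)) < r"
      by (metis add.assoc add_diff_cancel_left' norm_minus_commute)
    then show ?thesis by (simp add: dist_norm)
  qed
  have inS: "x + a *\<^sub>R u + b *\<^sub>R v \<in> S" if "0 \<le> a" "a \<le> s" "0 \<le> b" "b \<le> s" for a b
    using near[OF that] ball by blast
  \<comment> \<open>Here \<open>t\<close> is the position along \<open>u\<close> and
    \<open>b\<close> the shift along \<open>v\<close>.\<close>
  define G where "G b t = f (x + t *\<^sub>R u + b *\<^sub>R v)" for b t
  have linf: "linear (f' y)" and ling: "linear (f'' y)" if "y \<in> S" for y
    using f[OF that] g[OF that] has_derivative_linear by blast+
  have G': "(G b has_derivative (\<lambda>h. h * f' (x + t *\<^sub>R u + b *\<^sub>R v) u)) (at t)"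
    if "0 \<le> t" "t \<le> s" "0 \<le> b" "b \<le> s" for t b
  proof -
    have "((\<lambda>t. x + t *\<^sub>R u + b *\<^sub>R v) has_derivative (\<lambda>h. h *\<^sub>R u)) (at t)"
      by (auto intro!: derivative_eq_intros)
    from has_derivative_compose[OF this f[OF inS[OF that]]]
    show ?thesis unfolding G_def using linear_cmul[OF linf[OF inS[OF that]]] by simp
  qed
  have "\<exists>t\<in>{0<..<s}. (G s s - G 0 s) - (G s 0 - G 0 0) =
      (s - 0) * f' (x + t *\<^sub>R u + s *\<^sub>R v) u - (s - 0) * f' (x + t *\<^sub>R u + 0 *\<^sub>R v) u"
  proof (rule mvt_simple[OF \<open>0 < s\<close>])
    fix t assume "0 \<le> t" "t \<le> s"
    then show "((\<lambda>t. G s t - G 0 t) has_derivative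
        (\<lambda>h. h * f' (x + t *\<^sub>R u + s *\<^sub>R v) u - h * f' (x + t *\<^sub>R u + 0 *\<^sub>R v) u))
        (at t within {0..s})"
      using \<open>0 < s\<close> by (intro has_derivative_diff has_derivative_at_withinI[OF G']) simp_all
  qed
  then obtain t where t: "0 < t" "t < s" and eq1: "(G s s - G 0 s) - (G s 0 - G 0 0) =
      s * (f' (x + t *\<^sub>R u + s *\<^sub>R v) u - f' (x + t *\<^sub>R u + 0 *\<^sub>R v) u)"
    by (fastforce simp: right_diff_distrib)
  have H': "((\<lambda>b. f' (x + t *\<^sub>R u + b *\<^sub>R v) u) has_derivative
      (\<lambda>h. h * f'' (x + t *\<^sub>R u + b *\<^sub>R v) v)) (at b)"
    if "0 \<le> b" "b \<le> s" for b
  proof -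
    have i: "x + t *\<^sub>R u + b *\<^sub>R v \<in> S" using inS that t by simp
    have "((\<lambda>b. x + t *\<^sub>R u + b *\<^sub>R v) has_derivative (\<lambda>h. h *\<^sub>R v)) (at b)"
      by (auto intro!: derivative_eq_intros)
    from has_derivative_compose[OF this g[OF i]]
    show ?thesis using linear_cmul[OF ling[OF i]] by simp
  qed
  have "\<exists>b\<in>{0<..<s}. f' (x + t *\<^sub>R u + s *\<^sub>R v) u - f' (x + t *\<^sub>R u + 0 *\<^sub>R v) u =
      (s - 0) * f'' (x + t *\<^sub>R u + b *\<^sub>R v) v"
  proof (rule mvt_simple[OF \<open>0 < s\<close>])
    fix b assume "0 \<le> b" "b \<le> s"
    then show "((\<lambda>b. f' (x + t *\<^sub>R u + b *\<^sub>R v) u) has_derivative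
        (\<lambda>h. h * f'' (x + t *\<^sub>R u + b *\<^sub>R v) v)) (at b within {0..s})"
      by (rule has_derivative_at_withinI[OF H'])
  qed
  then obtain b where b: "0 < b" "b < s" and eq2:
    "f' (x + t *\<^sub>R u + s *\<^sub>R v) u - f' (x + t *\<^sub>R u + 0 *\<^sub>R v) u =
      s * f'' (x + t *\<^sub>R u + b *\<^sub>R v) v" by auto
  show ?thesis
  proof (rule that)
    show "x + t *\<^sub>R u + b *\<^sub>R v \<in> ball x r"
      by (rule near) (use t b in simp_all)
    show "f (x + s *\<^sub>R u + s *\<^sub>R v) - f (x + s *\<^sub>R u) - f (x + s *\<^sub>R v) + f x =
        s * s * f'' (x + t *\<^sub>R u + b *\<^sub>R v) v"
      using eq1 unfolding eq2 by (simp add: G_def)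
  qed
qed

text \<open>The second difference over a small parallelogram does not change when \<open>u\<close>
  and \<open>v\<close> are exchanged. Hence the two mixed derivatives agree at two possibly
  different points near \<open>x\<close>, and continuity brings the equality to
  \<open>x\<close>.\<close>

lemma second_derivative_symmetric_real:
  fixes f :: "'a::real_normed_vector \<Rightarrow> real"
  assumes "open S" "x \<in> S"
    and f: "\<And>y. y \<in> S \<Longrightarrow> (f has_derivative f' y) (at y)"
    and u: "\<And>y. y \<in> S \<Longrightarrow> ((\<lambda>y. f' y u) has_derivative P y) (at y)"
    and v: "\<And>y. y \<in> S \<Longrightarrow> ((\<lambda>y. f' y v) has_derivative Q y) (at y)"
    and cont: "continuous_on S (\<lambda>y. P y v)" "continuous_on S (\<lambda>y. Q y u)"
  shows "P x v = Q x u"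
proof (rule ccontr)
  assume ne: "P x v \<noteq> Q x u"
  \<comment> \<open>Half the gap: each mixed derivative moves by less than \<open>e\<close> near
    \<open>x\<close>, so the two together cannot bridge \<open>2 * e\<close>.\<close>
  define e where "e = \<bar>P x v - Q x u\<bar> / 2"
  have e: "e > 0" using ne by (simp add: e_def)
  have ev: "\<forall>\<^sub>F y in nhds x. \<bar>F y - F x\<bar> < e" if "continuous_on S F" for F :: "'a \<Rightarrow> real"
  proof -
    have "(F \<longlongrightarrow> F x) (nhds x)"
      using that assms(1,2)
      by (simp add: continuous_on_eq_continuous_at isCont_def tendsto_at_iff_tendsto_nhds)
    from tendstoD[OF this e] show ?thesis by (simp add: dist_real_def)
  qed
  then have "\<forall>\<^sub>F y in nhds x. y \<in> S \<and> \<bar>P y v - P x v\<bar> < e \<and> \<bar>Q y u - Q x u\<bar> < e"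
    using ev[OF cont(1)] ev[OF cont(2)] eventually_nhds_in_open[OF assms(1,2)]
    by (simp add: eventually_conj_iff)
  then obtain r where "r > 0" and
    r: "\<And>y. dist y x < r \<Longrightarrow> y \<in> S \<and> \<bar>P y v - P x v\<bar> < e \<and> \<bar>Q y u - Q x u\<bar> < e"
    unfolding eventually_nhds_metric by blast
  then have ball: "ball x r \<subseteq> S" by (auto simp: dist_commute)
  \<comment> \<open>Small enough to keep the parallelogram inside the ball; the summand 1 keeps the
    denominator positive even if \<open>u\<close> and \<open>v\<close> vanish.\<close>
  define s where "s = r / (2 * (1 + norm u + norm v))"
  have pos: "1 + norm u + norm v > 0" by (simp add: add_pos_nonneg)
  then have s0: "s > 0" using \<open>r > 0\<close> by (simp add: s_def)
  have "s * (norm u + norm v) < s * (2 * (1 + norm u + norm v))"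
  proof (rule mult_strict_left_mono[OF _ s0])
    show "norm u + norm v < 2 * (1 + norm u + norm v)"
      using norm_ge_zero[of u] norm_ge_zero[of v] unfolding distrib_left by linarith
  qed
  also have "\<dots> = r" using pos unfolding s_def by simp
  finally have sr: "s * (norm u + norm v) < r" .
  then have sr': "s * (norm v + norm u) < r" by (simp add: add.commute)
  obtain p where p: "p \<in> ball x r"
    "f (x + s *\<^sub>R u + s *\<^sub>R v) - f (x + s *\<^sub>R u) - f (x + s *\<^sub>R v) + f x = s * s * P p v"
    using second_difference_mvt[OF ball s0 sr f u] by blast
  obtain q where q: "q \<in> ball x r"
    "f (x + s *\<^sub>R v + s *\<^sub>R u) - f (x + s *\<^sub>R v) - f (x + s *\<^sub>R u) + f x = s * s * Q q u"
    using second_difference_mvt[OF ball s0 sr' f v] by blast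
  have "s * s * P p v = s * s * Q q u"
    using p(2) q(2) by (simp add: algebra_simps)
  then have "P p v = Q q u" using s0 by simp
  moreover have "\<bar>P p v - P x v\<bar> < e" "\<bar>Q q u - Q x u\<bar> < e"
    using r p(1) q(1) by (auto simp: dist_commute)
  moreover have "2 * e = \<bar>P x v - Q x u\<bar>" by (simp add: e_def)
  ultimately show False by linarith
qed

text \<open>Taken componentwise, because the mean value theorem yields an exact intermediate point
  for real functions.\<close>

lemma smooth_on_second_derivative_symmetric:
  assumes "open S" "x \<in> S" "smooth_on S f"
  shows "frechet_derivative (\<lambda>y. frechet_derivative f (at y) u) (at x) v =
    frechet_derivative (\<lambda>y. frechet_derivative f (at y) v) (at x) u"
proof (rule euclidean_eqI)
  fix b :: 'b assume "b \<in> Basis"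
  let ?D = "\<lambda>w y. frechet_derivative f (at y) w"
  have d1: "((\<lambda>y. f y \<bullet> b) has_derivative (\<lambda>w. ?D w y \<bullet> b)) (at y)" if "y \<in> S" for y
    using smooth_on_differentiable[OF assms(3) that] unfolding frechet_derivative_works
    by (rule has_derivative_inner_left)
  have d2: "((\<lambda>y. ?D w y \<bullet> b) has_derivative (\<lambda>z. frechet_derivative (?D w) (at y) z \<bullet> b)) (at y)"
    if "y \<in> S" for y w
    using smooth_on_differentiable[OF smooth_on_derivative[OF assms(3)] that]
    unfolding frechet_derivative_works by (rule has_derivative_inner_left)
  have c: "continuous_on S (\<lambda>y. frechet_derivative (?D w) (at y) z \<bullet> b)" for w z
    by (intro continuous_on_inner continuous_on_const smooth_on_imp_continuous_on
        smooth_on_derivative assms(3))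
  show "frechet_derivative (?D u) (at x) v \<bullet> b = frechet_derivative (?D v) (at x) u \<bullet> b"
    by (rule second_derivative_symmetric_real[OF assms(1,2),
          where f = "\<lambda>y. f y \<bullet> b" and f' = "\<lambda>y w. ?D w y \<bullet> b"
            and P = "\<lambda>y z. frechet_derivative (?D u) (at y) z \<bullet> b"
            and Q = "\<lambda>y z. frechet_derivative (?D v) (at y) z \<bullet> b"])
      (simp_all only: d1 d2 c)
qed

section \<open>Smooth functions on manifolds\<close>

lemma smooth_manifold_chart:
  assumes "smooth_manifold A" "(U, \<phi>) \<in> A"
  shows chart_open: "open U"
    and chart_image_open: "open W \<Longrightarrow> open (\<phi> ` (U \<inter> W))"
    and chart_inj: "inj_on \<phi> U"
proof -
  have "\<forall>(U, \<phi>)\<in>A. open U \<and> open (\<phi> ` U) \<and> homeomorphism U (\<phi> ` U) \<phi> (inv_into U \<phi>)"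
    using assms(1) unfolding smooth_manifold_def by (elim conjE)
  from bspec[OF this assms(2)]
  have *: "open U" "open (\<phi> ` U)" "homeomorphism U (\<phi> ` U) \<phi> (inv_into U \<phi>)" by auto
  show "open U" by fact
  show "inj_on \<phi> U"
    using *(3) unfolding homeomorphism_def by (metis inj_on_inverseI)
  assume "open W"
  then have "openin (top_of_set U) (U \<inter> W)" by (simp add: openin_open_Int)
  then have "openin (top_of_set (\<phi> ` U)) (\<phi> ` (U \<inter> W))"
    by (rule homeomorphism_imp_open_map[OF *(3)])
  then show "open (\<phi> ` (U \<inter> W))" using *(2) openin_open_trans by blast
qed

lemma smooth_manifold_chart_exists:
  assumes "smooth_manifold A"
  obtains U \<phi> where "(U, \<phi>) \<in> A" "x \<in> U"
proof -
  have "x \<in> (\<Union>(U, \<phi>)\<in>A. U)" using assms unfolding smooth_manifold_def by simp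
  then show ?thesis using that by auto
qed

lemma chart_at_works:
  assumes "smooth_manifold A"
  shows "chart_at A x \<in> A" "x \<in> fst (chart_at A x)"
proof -
  have "\<exists>c. c \<in> A \<and> x \<in> fst c"
    using smooth_manifold_chart_exists[OF assms, of x] by (metis fst_conv)
  from someI_ex[OF this] show "chart_at A x \<in> A" "x \<in> fst (chart_at A x)"
    unfolding chart_at_def by auto
qed

lemma smooth_funI:
  "(\<And>U \<phi>. (U, \<phi>) \<in> A \<Longrightarrow> smooth_on (\<phi> ` (U \<inter> W)) (f \<circ> inv_into U \<phi>)) \<Longrightarrow> smooth_fun A W f"
  unfolding smooth_fun_def by auto

lemma smooth_fun_chart_rep:
  assumes "(U, \<phi>) \<in> A" "smooth_fun A W f"
  shows "smooth_on (\<phi> ` (U \<inter> W)) (f \<circ> inv_into U \<phi>)"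
  using bspec[OF assms(2)[unfolded smooth_fun_def] assms(1)] by simp

lemma smooth_fun_cong:
  assumes "smooth_manifold A" "open W" "\<And>x. x \<in> W \<Longrightarrow> f x = g x" "smooth_fun A W f"
  shows "smooth_fun A W g"
proof (rule smooth_funI)
  fix U \<phi> assume c: "(U, \<phi>) \<in> A"
  show "smooth_on (\<phi> ` (U \<inter> W)) (g \<circ> inv_into U \<phi>)"
  proof (rule smooth_on_transform[OF smooth_fun_chart_rep[OF c assms(4)]
        chart_image_open[OF assms(1) c assms(2)]])
    show "(f \<circ> inv_into U \<phi>) z = (g \<circ> inv_into U \<phi>) z" if "z \<in> \<phi> ` (U \<inter> W)" for z
      using that assms(3) chart_inj[OF assms(1) c] by auto
  qed
qed

lemma smooth_fun_subset: "smooth_fun A W f \<Longrightarrow> W' \<subseteq> W \<Longrightarrow> smooth_fun A W' f"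
  by (rule smooth_funI, rule smooth_on_subset[OF smooth_fun_chart_rep]) auto

lemma smooth_fun_local:
  assumes "smooth_manifold A"
    and "\<And>x. x \<in> W \<Longrightarrow> \<exists>V. open V \<and> x \<in> V \<and> smooth_fun A (W \<inter> V) f"
  shows "smooth_fun A W f"
proof (rule smooth_funI)
  fix U \<phi> assume c: "(U, \<phi>) \<in> A"
  show "smooth_on (\<phi> ` (U \<inter> W)) (f \<circ> inv_into U \<phi>)"
  proof (rule smooth_on_local)
    fix z assume "z \<in> \<phi> ` (U \<inter> W)"
    then obtain x where x: "x \<in> U" "x \<in> W" "z = \<phi> x" by auto
    then obtain V where V: "open V" "x \<in> V" "smooth_fun A (W \<inter> V) f" using assms(2) by blast
    have "\<phi> ` (U \<inter> W) \<inter> \<phi> ` (U \<inter> V) = \<phi> ` (U \<inter> (W \<inter> V))"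
      using inj_on_image_Int[OF chart_inj[OF assms(1) c], of "U \<inter> W" "U \<inter> V"]
      by (simp add: Int_ac)
    with smooth_fun_chart_rep[OF c V(3)]
    have "smooth_on (\<phi> ` (U \<inter> W) \<inter> \<phi> ` (U \<inter> V)) (f \<circ> inv_into U \<phi>)" by simp
    moreover have "z \<in> \<phi> ` (U \<inter> V)" using x V(2) by simp
    ultimately show "\<exists>T. open T \<and> z \<in> T \<and> smooth_on (\<phi> ` (U \<inter> W) \<inter> T) (f \<circ> inv_into U \<phi>)"
      using chart_image_open[OF assms(1) c V(1)] by blast
  qed
qed

context
  fixes A :: "('m::{t2_space,second_countable_topology}, 'e::euclidean_space) chart set" and W :: "'m set"
  assumes M: "smooth_manifold A" and W: "open W"
begin

lemma smooth_fun_iff_Ck_on: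
  "smooth_fun A W f \<longleftrightarrow>
    (\<forall>U \<phi> k. (U, \<phi>) \<in> A \<longrightarrow> Ck_on k (\<phi> ` (U \<inter> W)) (\<lambda>z. f (inv_into U \<phi> z)))"
  unfolding smooth_fun_def smooth_on_def o_def by blast

lemma smooth_fun_const: "smooth_fun A W (\<lambda>x. c)"
  unfolding smooth_fun_iff_Ck_on using chart_image_open[OF M _ W] Ck_on_const by metis

lemma smooth_fun_add:
  "smooth_fun A W f \<Longrightarrow> smooth_fun A W g \<Longrightarrow> smooth_fun A W (\<lambda>x. f x + g x)"
  unfolding smooth_fun_iff_Ck_on by (rule allI impI)+ (rule Ck_on_add[OF chart_image_open[OF M _ W]]; blast)

lemma smooth_fun_sum:
  "(\<And>i. i \<in> I \<Longrightarrow> smooth_fun A W (f i)) \<Longrightarrow> smooth_fun A W (\<lambda>x. \<Sum>i\<in>I. f i x)"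
  by (induction I rule: infinite_finite_induct) (simp_all add: smooth_fun_const smooth_fun_add)

lemma smooth_fun_bilinear:
  "bounded_bilinear b \<Longrightarrow> smooth_fun A W f \<Longrightarrow> smooth_fun A W g \<Longrightarrow>
    smooth_fun A W (\<lambda>x. b (f x) (g x))"
  unfolding smooth_fun_iff_Ck_on by (rule allI impI)+ (rule Ck_on_bilinear[OF chart_image_open[OF M _ W]]; blast)

lemmas smooth_fun_scaleR = smooth_fun_bilinear[OF bounded_bilinear_scaleR]
lemmas smooth_fun_inner = smooth_fun_bilinear[OF bounded_bilinear_inner]

lemma smooth_fun_mult:
  fixes f g :: "'m \<Rightarrow> real"
  shows "smooth_fun A W f \<Longrightarrow> smooth_fun A W g \<Longrightarrow> smooth_fun A W (\<lambda>x. f x * g x)"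
  by (rule smooth_fun_bilinear[OF bounded_bilinear_mult])

lemma smooth_fun_prod:
  fixes f :: "'i \<Rightarrow> 'm \<Rightarrow> real"
  shows "(\<And>i. i \<in> I \<Longrightarrow> smooth_fun A W (f i)) \<Longrightarrow> smooth_fun A W (\<lambda>x. \<Prod>i\<in>I. f i x)"
  by (induction I rule: infinite_finite_induct) (simp_all add: smooth_fun_const smooth_fun_mult)

lemma smooth_fun_inverse:
  fixes f :: "'m \<Rightarrow> real"
  assumes "smooth_fun A W f" "\<And>x. x \<in> W \<Longrightarrow> f x \<noteq> 0"
  shows "smooth_fun A W (\<lambda>x. inverse (f x))"
  unfolding smooth_fun_iff_Ck_on
proof (intro allI impI)
  fix U \<phi> k assume c: "(U, \<phi>) \<in> A"
  show "Ck_on k (\<phi> ` (U \<inter> W)) (\<lambda>z. inverse (f (inv_into U \<phi> z)))"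
    by (rule Ck_on_inverse[OF chart_image_open[OF M c W]])
      (use assms c chart_inj[OF M c] in \<open>auto simp: smooth_fun_iff_Ck_on\<close>)
qed

lemma smooth_fun_exp:
  fixes f :: "'m \<Rightarrow> real"
  shows "smooth_fun A W f \<Longrightarrow> smooth_fun A W (\<lambda>x. exp (f x))"
  unfolding smooth_fun_iff_Ck_on by (rule allI impI)+ (rule Ck_on_exp[OF chart_image_open[OF M _ W]]; blast)

lemma smooth_fun_compose:
  assumes "smooth_fun A W f" "open T" "smooth_on T g" "f ` W \<subseteq> T"
  shows "smooth_fun A W (\<lambda>x. g (f x))"
proof (rule smooth_funI)
  fix U \<phi> assume c: "(U, \<phi>) \<in> A"
  show "smooth_on (\<phi> ` (U \<inter> W)) ((\<lambda>x. g (f x)) \<circ> inv_into U \<phi>)"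
    using smooth_on_compose[OF chart_image_open[OF M c W] assms(2) _ smooth_fun_chart_rep[OF c assms(1)]
        assms(3)] assms(4) chart_inj[OF M c]
    by (auto simp: o_def image_subset_iff)
qed

lemma smooth_fun_det:
  fixes F :: "'m \<Rightarrow> real ^ 'i ^ 'i"
  assumes "\<And>i j. smooth_fun A W (\<lambda>x. F x $ i $ j)"
  shows "smooth_fun A W (\<lambda>x. det (F x))"
  unfolding det_def by (rule smooth_fun_sum, rule smooth_fun_mult, rule smooth_fun_const, rule smooth_fun_prod, rule assms)

end

lemma smooth_fun_chart:
  assumes "smooth_manifold A" "(U, \<phi>) \<in> A"
  shows "smooth_fun A U \<phi>"
proof (rule smooth_funI)
  fix V \<psi> assume c: "(V, \<psi>) \<in> A"
  have "\<forall>(U, \<phi>)\<in>A. \<forall>(V, \<psi>)\<in>A. smooth_on (\<phi> ` (U \<inter> V)) (\<psi> \<circ> inv_into U \<phi>)"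
    using assms(1) unfolding smooth_manifold_def by (elim conjE)
  from bspec[OF this c] assms(2) show "smooth_on (\<psi> ` (V \<inter> U)) (\<phi> \<circ> inv_into V \<psi>)" by auto
qed

text \<open>Smoothness of \<Psi> is given through the target charts, so \<open>f\<close> is factored
  near each point through a chart of \<open>B\<close> and its inverse.\<close>

lemma smooth_fun_compose_map:
  assumes A: "smooth_manifold A" and B: "smooth_manifold B" and \<Psi>: "smooth_map A B \<Psi>"
    and "open V" "smooth_fun B V f"
  shows "smooth_fun A (\<Psi> -` V) (\<lambda>x. f (\<Psi> x))"
proof (rule smooth_fun_local[OF A])
  have cont: "continuous_on UNIV \<Psi>" using \<Psi> unfolding smooth_map_def by blast
  fix x assume x: "x \<in> \<Psi> -` V"
  obtain V' \<psi> where c: "(V', \<psi>) \<in> B" "\<Psi> x \<in> V'" using smooth_manifold_chart_exists[OF B] .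
  have o': "open (\<Psi> -` V')" using open_vimage[OF chart_open[OF B c(1)] cont] .
  have o: "open (\<Psi> -` V \<inter> \<Psi> -` V')"
    using open_vimage[OF \<open>open V\<close> cont] o' by blast
  have s: "smooth_fun A (\<Psi> -` V \<inter> \<Psi> -` V') (\<lambda>x. \<psi> (\<Psi> x))"
    using \<Psi> c(1) unfolding smooth_map_def o_def by (blast intro: smooth_fun_subset)
  have "smooth_fun A (\<Psi> -` V \<inter> \<Psi> -` V') (\<lambda>x. (f \<circ> inv_into V' \<psi>) (\<psi> (\<Psi> x)))"
    by (rule smooth_fun_compose[OF A o s chart_image_open[OF B c(1) \<open>open V\<close>]
          smooth_fun_chart_rep[OF c(1) assms(5)]]) auto
  then have "smooth_fun A (\<Psi> -` V \<inter> \<Psi> -` V') (\<lambda>x. f (\<Psi> x))"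
    by (rule smooth_fun_cong[OF A o, rotated]) (use chart_inj[OF B c(1)] in auto)
  then show "\<exists>V'. open V' \<and> x \<in> V' \<and> smooth_fun A (\<Psi> -` V \<inter> V') (\<lambda>x. f (\<Psi> x))"
    using o' c(2) by blast
qed

section \<open>Differentials\<close>

lemma dfun_eqI:
  "(f \<circ> coord_inv (chart_at A x) has_derivative F) (at (snd (chart_at A x) x)) \<Longrightarrow> dfun A f x = F"
  unfolding dfun_def by (metis frechet_derivative_at)

context
  fixes A :: "('m::{t2_space,second_countable_topology}, 'e::euclidean_space) chart set"
    and W :: "'m set" and x :: 'm
  assumes M: "smooth_manifold A" and W: "open W" and x: "x \<in> W"
begin

lemma dfun_has_derivative:
  assumes "smooth_fun A W f"
  shows "(f \<circ> coord_inv (chart_at A x) has_derivative dfun A f x) (at (snd (chart_at A x) x))"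
proof -
  obtain U \<phi> where c: "chart_at A x = (U, \<phi>)" by fastforce
  have U: "(U, \<phi>) \<in> A" "x \<in> U" using chart_at_works[OF M, of x] c by auto
  have "f \<circ> inv_into U \<phi> differentiable at (\<phi> x)"
    using smooth_on_differentiable[OF smooth_fun_chart_rep[OF U(1) assms]] U(2) x by blast
  then show ?thesis
    unfolding dfun_def c coord_inv_def by (simp add: frechet_derivative_works)
qed

lemma coord_inv_chart_at: "coord_inv (chart_at A x) (snd (chart_at A x) x) = x"
proof -
  obtain U \<phi> where c: "chart_at A x = (U, \<phi>)" by fastforce
  have U: "(U, \<phi>) \<in> A" "x \<in> U" using chart_at_works[OF M, of x] c by auto
  then show ?thesis using chart_inj[OF M U(1)] by (simp add: c coord_inv_def)
qed

lemma dfun_linear: "smooth_fun A W f \<Longrightarrow> linear (dfun A f x)"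
  using dfun_has_derivative has_derivative_linear by blast

lemma dfun_cong:
  assumes "smooth_fun A W f" "\<And>y. y \<in> W \<Longrightarrow> f y = g y"
  shows "dfun A f x = dfun A g x"
proof -
  obtain U \<phi> where c: "chart_at A x = (U, \<phi>)" by fastforce
  have U: "(U, \<phi>) \<in> A" "x \<in> U" using chart_at_works[OF M, of x] c by auto
  have "(g \<circ> coord_inv (chart_at A x) has_derivative dfun A f x) (at (snd (chart_at A x) x))"
  proof (rule has_derivative_transform_within_open[OF dfun_has_derivative[OF assms(1)]])
    show "open (\<phi> ` (U \<inter> W))" by (rule chart_image_open[OF M U(1) W])
    show "snd (chart_at A x) x \<in> \<phi> ` (U \<inter> W)" using U x by (simp add: c)
    show "(f \<circ> coord_inv (chart_at A x)) z = (g \<circ> coord_inv (chart_at A x)) z"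
      if "z \<in> \<phi> ` (U \<inter> W)" for z
      using that assms(2) chart_inj[OF M U(1)] by (auto simp: c coord_inv_def)
  qed
  from dfun_eqI[OF this] show ?thesis by simp
qed

lemma dfun_const: "dfun A (\<lambda>y. c) x = (\<lambda>v. 0)"
  unfolding dfun_def o_def by simp

lemma dfun_bounded_linear:
  assumes "bounded_linear L" "smooth_fun A W f"
  shows "dfun A (\<lambda>y. L (f y)) x v = L (dfun A f x v)"
proof -
  have "((\<lambda>y. L (f y)) \<circ> coord_inv (chart_at A x) has_derivative (\<lambda>v. L (dfun A f x v)))
      (at (snd (chart_at A x) x))"
    using bounded_linear.has_derivative[OF assms(1) dfun_has_derivative[OF assms(2)]]
    by (simp add: o_def)
  from dfun_eqI[OF this] show ?thesis by simp
qed

lemma dfun_inner_left: "smooth_fun A W f \<Longrightarrow> dfun A (\<lambda>y. f y \<bullet> b) x v = dfun A f x v \<bullet> b"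
  by (rule dfun_bounded_linear[OF bounded_linear_inner_left])

lemma dfun_bilinear:
  assumes "bounded_bilinear b" "smooth_fun A W f" "smooth_fun A W g"
  shows "dfun A (\<lambda>y. b (f y) (g y)) x v = b (dfun A f x v) (g x) + b (f x) (dfun A g x v)"
proof -
  have "((\<lambda>y. b (f y) (g y)) \<circ> coord_inv (chart_at A x) has_derivative
      (\<lambda>v. b (f x) (dfun A g x v) + b (dfun A f x v) (g x))) (at (snd (chart_at A x) x))"
    using bounded_bilinear.FDERIV[OF assms(1) dfun_has_derivative[OF assms(2)]
        dfun_has_derivative[OF assms(3)]]
    by (simp add: o_def coord_inv_chart_at)
  from dfun_eqI[OF this] show ?thesis by (simp add: add.commute)
qed

lemma dfun_add:
  assumes "smooth_fun A W f" "smooth_fun A W g"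
  shows "dfun A (\<lambda>y. f y + g y) x v = dfun A f x v + dfun A g x v"
proof -
  have "((\<lambda>y. f y + g y) \<circ> coord_inv (chart_at A x) has_derivative
      (\<lambda>v. dfun A f x v + dfun A g x v)) (at (snd (chart_at A x) x))"
    using has_derivative_add[OF dfun_has_derivative[OF assms(1)] dfun_has_derivative[OF assms(2)]]
    by (simp add: o_def)
  from dfun_eqI[OF this] show ?thesis by simp
qed

lemma dfun_sum:
  assumes "\<And>i. i \<in> I \<Longrightarrow> smooth_fun A W (f i)"
  shows "dfun A (\<lambda>y. \<Sum>i\<in>I. f i y) x v = (\<Sum>i\<in>I. dfun A (f i) x v)"
  using assms
  by (induction I rule: infinite_finite_induct)
    (simp_all add: dfun_const dfun_add smooth_fun_sum[OF M W])

lemma dfun_compose: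
  assumes "smooth_fun A W f" "open T" "smooth_on T g" "f x \<in> T"
  shows "dfun A (\<lambda>y. g (f y)) x v = frechet_derivative g (at (f x)) (dfun A f x v)"
proof -
  have g: "(g has_derivative frechet_derivative g (at (f x))) (at (f x))"
    using smooth_on_differentiable[OF assms(3,4)] by (simp add: frechet_derivative_works)
  have fx: "(f \<circ> coord_inv (chart_at A x)) (snd (chart_at A x) x) = f x"
    by (simp add: coord_inv_chart_at)
  have "((\<lambda>y. g (f y)) \<circ> coord_inv (chart_at A x) has_derivative
      (\<lambda>v. frechet_derivative g (at (f x)) (dfun A f x v))) (at (snd (chart_at A x) x))"
    using has_derivative_compose[OF dfun_has_derivative[OF assms(1)], of g
        "frechet_derivative g (at (f x))"] g
    unfolding fx by (simp add: o_def)
  from dfun_eqI[OF this] show ?thesis by simp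
qed

end

text \<open>Tangent vectors at \<open>x\<close> are stored in the coordinates of
  \<open>chart_at A x\<close>, so \<open>dfun A \<phi> x\<close> is the change to the coordinates of
  \<phi>. The chain rule for \<phi> followed by \<open>f \<circ> inv_into U \<phi>\<close> thus
  moves a computation into a chart that stays fixed near \<open>x\<close>.\<close>

lemma dfun_in_chart:
  assumes M: "smooth_manifold A" and W: "open W" and x: "x \<in> W"
    and c: "(U, \<phi>) \<in> A" "x \<in> U" and f: "smooth_fun A W f"
  shows "dfun A f x v = frechet_derivative (f \<circ> inv_into U \<phi>) (at (\<phi> x)) (dfun A \<phi> x v)"
proof -
  have o: "open (U \<inter> W)" and xUW: "x \<in> U \<inter> W"
    using chart_open[OF M c(1)] W x c(2) by auto
  have "dfun A f x = dfun A (\<lambda>y. (f \<circ> inv_into U \<phi>) (\<phi> y)) x"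
    by (rule dfun_cong[OF M o xUW smooth_fun_subset[OF f]]) (use chart_inj[OF M c(1)] in auto)
  moreover have "dfun A (\<lambda>y. (f \<circ> inv_into U \<phi>) (\<phi> y)) x v =
      frechet_derivative (f \<circ> inv_into U \<phi>) (at (\<phi> x)) (dfun A \<phi> x v)"
    by (rule dfun_compose[OF M chart_open[OF M c(1)] c(2) smooth_fun_chart[OF M c(1)]
        chart_image_open[OF M c(1) W] smooth_fun_chart_rep[OF c(1) f]]) (use x c(2) in auto)
  ultimately show ?thesis by simp
qed

lemma dfun_chart_linear:
  assumes "smooth_manifold A" "(U, \<phi>) \<in> A" "x \<in> U"
  shows "linear (dfun A \<phi> x)"
  using dfun_linear[OF assms(1) chart_open[OF assms(1,2)] assms(3) smooth_fun_chart[OF assms(1,2)]] .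

lemma dfun_chart_at:
  assumes "smooth_manifold A"
  shows "dfun A (snd (chart_at A x)) x = (\<lambda>v. v)"
proof (rule dfun_eqI)
  obtain U \<phi> where c: "chart_at A x = (U, \<phi>)" by fastforce
  have U: "(U, \<phi>) \<in> A" "x \<in> U" using chart_at_works[OF assms, of x] c by auto
  have "open (\<phi> ` U)" using chart_image_open[OF assms U(1) open_UNIV] by simp
  then have "(\<phi> \<circ> inv_into U \<phi> has_derivative (\<lambda>v. v)) (at (\<phi> x))"
    by (rule has_derivative_transform_within_open[OF has_derivative_ident])
      (use U in \<open>auto simp: f_inv_into_f\<close>)
  then show "(snd (chart_at A x) \<circ> coord_inv (chart_at A x) has_derivative (\<lambda>v. v))
      (at (snd (chart_at A x) x))"
    by (simp add: c coord_inv_def)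
qed

text \<open>The derivative of the coordinate change from \<phi> to the reference chart at
  \<open>x\<close> is a left inverse, because the reference chart has the identity as its
  differential. Finite dimension gives surjectivity.\<close>

lemma dfun_chart_bij:
  assumes "smooth_manifold A" "(U, \<phi>) \<in> A" "x \<in> U"
  shows "bij (dfun A \<phi> x)"
proof -
  obtain V \<psi> where c: "chart_at A x = (V, \<psi>)" by fastforce
  have V: "(V, \<psi>) \<in> A" "x \<in> V" using chart_at_works[OF assms(1), of x] c by auto
  have "v = frechet_derivative (\<psi> \<circ> inv_into U \<phi>) (at (\<phi> x)) (dfun A \<phi> x v)" for v
    using dfun_in_chart[OF assms(1) chart_open[OF assms(1) V(1)] V(2) assms(2,3)
        smooth_fun_chart[OF assms(1) V(1)], of v] dfun_chart_at[OF assms(1), of x]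
    by (simp add: c)
  then have "inj (dfun A \<phi> x)" by (metis injI)
  then show ?thesis
    using linear_injective_imp_surjective[OF dfun_chart_linear[OF assms]] by (simp add: bij_def)
qed

text \<open>\<open>dmap\<close> is the derivative of \<Psi> in the reference chart at
  \<open>\<Psi> x\<close>, so \<open>f\<close> is factored through precisely that chart.\<close>

lemma dfun_compose_map:
  assumes A: "smooth_manifold A" and B: "smooth_manifold B" and \<Psi>: "smooth_map A B \<Psi>"
    and V: "open V" "smooth_fun B V f" "\<Psi> x \<in> V"
  shows "dfun A (\<lambda>y. f (\<Psi> y)) x v = dfun B f (\<Psi> x) (dmap A B \<Psi> x v)"
proof -
  have cont: "continuous_on UNIV \<Psi>" using \<Psi> unfolding smooth_map_def by blast
  obtain V' \<psi> where c: "chart_at B (\<Psi> x) = (V', \<psi>)" by fastforce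
  have V': "(V', \<psi>) \<in> B" "\<Psi> x \<in> V'" using chart_at_works[OF B, of "\<Psi> x"] c by auto
  have oV': "open (\<Psi> -` V')" by (rule open_vimage[OF chart_open[OF B V'(1)] cont])
  have o: "open (\<Psi> -` (V' \<inter> V))"
    using open_vimage[OF _ cont] chart_open[OF B V'(1)] V(1) by blast
  have s: "smooth_fun A (\<Psi> -` V') (\<lambda>y. \<psi> (\<Psi> y))"
    using \<Psi> V'(1) unfolding smooth_map_def o_def by blast
  have "dfun A (\<lambda>y. f (\<Psi> y)) x v = dfun A (\<lambda>y. (f \<circ> inv_into V' \<psi>) (\<psi> (\<Psi> y))) x v"
    using chart_inj[OF B V'(1)]
    by (intro fun_cong[OF dfun_cong[OF A o _
            smooth_fun_subset[OF smooth_fun_compose_map[OF A B \<Psi> V(1,2)]]]])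
      (use V'(2) V(3) in auto)
  also have "\<dots> = frechet_derivative (f \<circ> inv_into V' \<psi>) (at (\<psi> (\<Psi> x)))
      (dfun A (\<lambda>y. \<psi> (\<Psi> y)) x v)"
    using dfun_compose[OF A oV' _ s chart_image_open[OF B V'(1) V(1)]
        smooth_fun_chart_rep[OF V'(1) V(2)]] V'(2) V(3) by auto
  also have "\<dots> = dfun B f (\<Psi> x) (dmap A B \<Psi> x v)"
    by (simp add: dmap_def c coord_inv_def dfun_def[of B f] o_def)
  finally show ?thesis .
qed

text \<open>\<open>dfun A f x\<close> and \<open>X x\<close> both refer to a chart that may jump
  with \<open>x\<close>. In a fixed chart the jumps cancel: the derivative of the local
  representative of \<open>f\<close> is applied to the coordinates
  \<open>dfun A \<phi> x (X x)\<close>.\<close>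

lemma smooth_fun_dfun:
  assumes M: "smooth_manifold A" and W: "open W"
    and f: "smooth_fun A W f" and X: "smooth_section A (tangent_bundle A) W X"
  shows "smooth_fun A W (\<lambda>x. dfun A f x (X x))"
proof (rule smooth_funI)
  fix U \<phi> assume c: "(U, \<phi>) \<in> A"
  note o = chart_image_open[OF M c W]
  have "(U, \<lambda>x. dfun A \<phi> x) \<in> tangent_bundle A" using c unfolding tangent_bundle_def by force
  then have "smooth_fun A (U \<inter> W) (\<lambda>x. dfun A \<phi> x (X x))"
    using X unfolding smooth_section_def by blast
  from smooth_fun_chart_rep[OF c this]
  have s: "smooth_on (\<phi> ` (U \<inter> W)) ((\<lambda>x. dfun A \<phi> x (X x)) \<circ> inv_into U \<phi>)"
    by simp
  have "smooth_on (\<phi> ` (U \<inter> W)) (\<lambda>z. frechet_derivative (f \<circ> inv_into U \<phi>) (at z)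
      (((\<lambda>x. dfun A \<phi> x (X x)) \<circ> inv_into U \<phi>) z))"
    by (rule smooth_on_derivative_section[OF o smooth_fun_chart_rep[OF c f] s])
  moreover have "frechet_derivative (f \<circ> inv_into U \<phi>) (at z)
      (((\<lambda>x. dfun A \<phi> x (X x)) \<circ> inv_into U \<phi>) z) =
      ((\<lambda>x. dfun A f x (X x)) \<circ> inv_into U \<phi>) z" if "z \<in> \<phi> ` (U \<inter> W)" for z
    using that chart_inj[OF M c] dfun_in_chart[OF M W _ c _ f] by auto
  ultimately show "smooth_on (\<phi> ` (U \<inter> W)) ((\<lambda>x. dfun A f x (X x)) \<circ> inv_into U \<phi>)"
    by (rule smooth_on_transform[OF _ o])
qed

section \<open>Vector bundles\<close>

lemma vector_bundle_triv:
  assumes "vector_bundle A E" "(U, \<tau>) \<in> E"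
  shows triv_open: "open U"
    and triv_linear: "x \<in> U \<Longrightarrow> linear (\<tau> x)"
    and triv_bij: "x \<in> U \<Longrightarrow> bij (\<tau> x)"
proof -
  have "\<forall>(U, \<tau>)\<in>E. open U \<and> (\<forall>x\<in>U. linear (\<tau> x) \<and> bij (\<tau> x))"
    using assms(1) unfolding vector_bundle_def by (elim conjE)
  from bspec[OF this assms(2)]
  show "open U" "x \<in> U \<Longrightarrow> linear (\<tau> x)" "x \<in> U \<Longrightarrow> bij (\<tau> x)" by auto
qed

lemma vector_bundle_transition:
  assumes "vector_bundle A E" "(U, \<tau>) \<in> E" "(V, \<rho>) \<in> E"
  shows "smooth_fun A (U \<inter> V) (\<lambda>x. \<rho> x (inv (\<tau> x) w))"
proof -
  have "\<forall>(U, \<tau>)\<in>E. \<forall>(V, \<rho>)\<in>E. \<forall>w. smooth_fun A (U \<inter> V) (\<lambda>x. \<rho> x (inv (\<tau> x) w))"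
    using assms(1) unfolding vector_bundle_def by (elim conjE)
  from bspec[OF this assms(2)] assms(3) show ?thesis by auto
qed

lemma vector_bundle_triv_exists:
  assumes "vector_bundle A E"
  obtains U \<tau> where "(U, \<tau>) \<in> E" "x \<in> U"
proof -
  have "x \<in> (\<Union>(U, \<tau>)\<in>E. U)" using assms unfolding vector_bundle_def by simp
  then show ?thesis using that by auto
qed

lemma smooth_sectionI:
  "(\<And>U \<tau>. (U, \<tau>) \<in> E \<Longrightarrow> smooth_fun A (U \<inter> W) (\<lambda>x. \<tau> x (s x))) \<Longrightarrow> smooth_section A E W s"
  unfolding smooth_section_def by auto

lemma smooth_section_triv:
  assumes "smooth_section A E W s" "(U, \<tau>) \<in> E"
  shows "smooth_fun A (U \<inter> W) (\<lambda>x. \<tau> x (s x))"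
  using bspec[OF assms(1)[unfolded smooth_section_def] assms(2)] by simp

lemma smooth_section_subset:
  assumes "smooth_section A E W s" "W' \<subseteq> W"
  shows "smooth_section A E W' s"
proof (rule smooth_sectionI)
  fix U \<tau> assume "(U, \<tau>) \<in> E"
  from smooth_section_triv[OF assms(1) this]
  show "smooth_fun A (U \<inter> W') (\<lambda>x. \<tau> x (s x))"
    by (rule smooth_fun_subset) (use assms(2) in auto)
qed

lemma linear_inv_bij:
  assumes "linear f" "bij f"
  shows "linear (inv f)"
proof (rule linearI)
  show "inv f (x + y) = inv f x + inv f y" for x y
    using assms by (intro inv_f_eq) (simp_all add: bij_is_inj linear_add bij_is_surj surj_f_inv_f)
  show "inv f (c *\<^sub>R x) = c *\<^sub>R inv f x" for c x
    using assms by (intro inv_f_eq) (simp_all add: bij_is_inj linear_cmul bij_is_surj surj_f_inv_f)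
qed

text \<open>The vectors \<open>inv (\<tau> x) b\<close> form the local frame of the trivialization.
  This expansion is the entry to all local computations with sections below.\<close>

lemma frame_expansion:
  assumes "vector_bundle A E" "(U, \<tau>) \<in> E" "x \<in> U"
  shows "(\<Sum>b\<in>Basis. (\<tau> x u \<bullet> b) *\<^sub>R inv (\<tau> x) b) = u"
proof -
  note lin = triv_linear[OF assms] and bij = triv_bij[OF assms]
  then have il: "linear (inv (\<tau> x))" by (rule linear_inv_bij)
  have "u = inv (\<tau> x) (\<tau> x u)" using bij by (simp add: bij_is_inj)
  also have "\<dots> = inv (\<tau> x) (\<Sum>b\<in>Basis. (\<tau> x u \<bullet> b) *\<^sub>R b)"
    by (simp add: euclidean_representation)
  also have "\<dots> = (\<Sum>b\<in>Basis. (\<tau> x u \<bullet> b) *\<^sub>R inv (\<tau> x) b)"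
    by (simp add: linear_sum[OF il] linear_cmul[OF il])
  finally show ?thesis by (rule sym)
qed

context
  fixes A :: "('m::{t2_space,second_countable_topology}, 'e::euclidean_space) chart set"
    and E :: "('m, 'v::euclidean_space) triv set"
  assumes M: "smooth_manifold A" and E: "vector_bundle A E"
begin

lemma smooth_section_cong:
  assumes "open W" "smooth_section A E W s" "\<And>x. x \<in> W \<Longrightarrow> s x = t x"
  shows "smooth_section A E W t"
proof (rule smooth_sectionI)
  fix U \<tau> assume c: "(U, \<tau>) \<in> E"
  have "open (U \<inter> W)" using triv_open[OF E c] assms(1) by blast
  then show "smooth_fun A (U \<inter> W) (\<lambda>x. \<tau> x (t x))"
    by (rule smooth_fun_cong[OF M _ _ smooth_section_triv[OF assms(2) c]]) (use assms(3) in auto)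
qed

lemma smooth_section_local:
  assumes "\<And>x. x \<in> W \<Longrightarrow> \<exists>V. open V \<and> x \<in> V \<and> smooth_section A E (W \<inter> V) s"
  shows "smooth_section A E W s"
proof (rule smooth_sectionI)
  fix U \<tau> assume c: "(U, \<tau>) \<in> E"
  show "smooth_fun A (U \<inter> W) (\<lambda>x. \<tau> x (s x))"
  proof (rule smooth_fun_local[OF M])
    fix x assume "x \<in> U \<inter> W"
    then obtain V where V: "open V" "x \<in> V" "smooth_section A E (W \<inter> V) s" using assms by blast
    then show "\<exists>V. open V \<and> x \<in> V \<and> smooth_fun A (U \<inter> W \<inter> V) (\<lambda>x. \<tau> x (s x))"
      using smooth_section_triv[OF V(3) c] by (auto simp: Int_assoc)
  qed
qed

lemma smooth_section_add:
  assumes "open W" "smooth_section A E W s" "smooth_section A E W t"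
  shows "smooth_section A E W (\<lambda>x. s x + t x)"
proof (rule smooth_sectionI)
  fix U \<tau> assume c: "(U, \<tau>) \<in> E"
  have o: "open (U \<inter> W)" using triv_open[OF E c] assms(1) by blast
  show "smooth_fun A (U \<inter> W) (\<lambda>x. \<tau> x (s x + t x))"
    by (rule smooth_fun_cong[OF M o _ smooth_fun_add[OF M o smooth_section_triv[OF assms(2) c]
            smooth_section_triv[OF assms(3) c]]])
      (simp add: linear_add[OF triv_linear[OF E c]])
qed

lemma smooth_section_scaleR:
  assumes "open W" "smooth_fun A W f" "smooth_section A E W s"
  shows "smooth_section A E W (\<lambda>x. f x *\<^sub>R s x)"
proof (rule smooth_sectionI)
  fix U \<tau> assume c: "(U, \<tau>) \<in> E"
  have o: "open (U \<inter> W)" using triv_open[OF E c] assms(1) by blast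
  have f: "smooth_fun A (U \<inter> W) f" by (rule smooth_fun_subset[OF assms(2)]) simp
  show "smooth_fun A (U \<inter> W) (\<lambda>x. \<tau> x (f x *\<^sub>R s x))"
    by (rule smooth_fun_cong[OF M o _ smooth_fun_scaleR[OF M o f smooth_section_triv[OF assms(3) c]]])
      (simp add: linear_cmul[OF triv_linear[OF E c]])
qed

lemma smooth_section_zero:
  assumes "open W"
  shows "smooth_section A E W (\<lambda>x. 0)"
proof (rule smooth_sectionI)
  fix U \<tau> assume c: "(U, \<tau>) \<in> E"
  have o: "open (U \<inter> W)" using triv_open[OF E c] assms(1) by blast
  show "smooth_fun A (U \<inter> W) (\<lambda>x. \<tau> x 0)"
    by (rule smooth_fun_cong[OF M o _ smooth_fun_const[OF M o, of 0]])
      (simp add: linear_0[OF triv_linear[OF E c]])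
qed

lemma smooth_section_sum:
  assumes "open W" "\<And>i. i \<in> I \<Longrightarrow> smooth_section A E W (s i)"
  shows "smooth_section A E W (\<lambda>x. \<Sum>i\<in>I. s i x)"
  using assms(2)
  by (induction I rule: infinite_finite_induct)
    (simp_all add: smooth_section_zero[OF assms(1)] smooth_section_add[OF assms(1)])

lemma smooth_section_frame:
  assumes "(U, \<tau>) \<in> E"
  shows "smooth_section A E U (\<lambda>x. inv (\<tau> x) w)"
proof (rule smooth_sectionI)
  fix V \<rho> assume "(V, \<rho>) \<in> E"
  from vector_bundle_transition[OF E assms this]
  show "smooth_fun A (V \<inter> U) (\<lambda>x. \<rho> x (inv (\<tau> x) w))" by (simp add: Int_commute)
qed

text \<open>Smoothness of a section is tested in all trivializations, but one that covers
  \<open>W\<close> is enough: the section is a combination of its frame with smooth coefficients,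
  and the frame is smooth by the transition functions.\<close>

lemma smooth_section_if_triv:
  assumes "open W" "(U, \<tau>) \<in> E" "W \<subseteq> U" "smooth_fun A W (\<lambda>x. \<tau> x (s x))"
  shows "smooth_section A E W s"
proof (rule smooth_section_cong[OF assms(1)])
  show "smooth_section A E W (\<lambda>x. \<Sum>b\<in>Basis. (\<tau> x (s x) \<bullet> b) *\<^sub>R inv (\<tau> x) b)"
  proof (rule smooth_section_sum[OF assms(1)], rule smooth_section_scaleR[OF assms(1)])
    fix b
    show "smooth_fun A W (\<lambda>x. \<tau> x (s x) \<bullet> b)"
      by (rule smooth_fun_inner[OF M assms(1,4) smooth_fun_const[OF M assms(1)]])
    show "smooth_section A E W (\<lambda>x. inv (\<tau> x) b)"
      by (rule smooth_section_subset[OF smooth_section_frame[OF assms(2)] assms(3)])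
  qed
  show "(\<Sum>b\<in>Basis. (\<tau> x (s x) \<bullet> b) *\<^sub>R inv (\<tau> x) b) = s x" if "x \<in> W" for x
    by (rule frame_expansion[OF E assms(2)]) (use that assms(3) in blast)
qed

end

section \<open>Tangent bundles and pull-back bundles\<close>

lemma tangent_bundle_iff:
  "(U, \<tau>) \<in> tangent_bundle A \<longleftrightarrow> (\<exists>\<phi>. (U, \<phi>) \<in> A \<and> \<tau> = (\<lambda>x. dfun A \<phi> x))"
  unfolding tangent_bundle_def by force

lemma vector_bundle_tangent:
  assumes M: "smooth_manifold A"
  shows "vector_bundle A (tangent_bundle A)"
  unfolding vector_bundle_def
proof (intro conjI ballI allI; clarsimp simp: tangent_bundle_iff split: prod.splits)
  fix U \<phi> assume c: "(U, \<phi>) \<in> A"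
  show "open U \<and> (\<forall>x\<in>U. linear (dfun A \<phi> x) \<and> bij (dfun A \<phi> x))"
    using chart_open[OF M c] dfun_chart_linear[OF M c] dfun_chart_bij[OF M c] by blast
next
  show "(\<Union>(U, \<tau>)\<in>tangent_bundle A. U) = UNIV"
  proof -
    have "\<exists>U \<tau>. (U, \<tau>) \<in> tangent_bundle A \<and> x \<in> U" for x
      using smooth_manifold_chart_exists[OF M, of x] unfolding tangent_bundle_iff by metis
    then show ?thesis by fast
  qed
next
  fix U \<phi> V \<psi> w assume c: "(U, \<phi>) \<in> A" "(V, \<psi>) \<in> A"
  have o: "open (U \<inter> V)" using chart_open[OF M c(1)] chart_open[OF M c(2)] by blast
  have s: "smooth_fun A (U \<inter> V) \<phi>" by (rule smooth_fun_subset[OF smooth_fun_chart[OF M c(1)]]) simp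
  note tr = smooth_on_derivative[OF smooth_fun_chart_rep[OF c(1) smooth_fun_chart[OF M c(2)]], of w]
  show "smooth_fun A (U \<inter> V) (\<lambda>x. dfun A \<psi> x (inv (dfun A \<phi> x) w))"
  proof (rule smooth_fun_cong[OF M o])
    \<comment> \<open>The transition functions of the tangent bundle are the derivatives of the
      coordinate changes, evaluated at \<open>\<phi> x\<close>.\<close>
    show "smooth_fun A (U \<inter> V) (\<lambda>x. frechet_derivative (\<psi> \<circ> inv_into U \<phi>) (at (\<phi> x)) w)"
      by (rule smooth_fun_compose[OF M o s chart_image_open[OF M c(1) chart_open[OF M c(2)]] tr]) auto
    fix x assume "x \<in> U \<inter> V"
    then show "frechet_derivative (\<psi> \<circ> inv_into U \<phi>) (at (\<phi> x)) w = dfun A \<psi> x (inv (dfun A \<phi> x) w)"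
      using dfun_in_chart[OF M chart_open[OF M c(2)] _ c(1) _ smooth_fun_chart[OF M c(2)], of x
          "inv (dfun A \<phi> x) w"] dfun_chart_bij[OF M c(1), of x]
      by (simp add: bij_is_surj surj_f_inv_f)
  qed
qed

lemma pullback_bundle_iff:
  "(U, \<tau>) \<in> pullback_bundle \<Psi> E \<longleftrightarrow> (\<exists>V \<rho>. (V, \<rho>) \<in> E \<and> U = \<Psi> -` V \<and> \<tau> = (\<lambda>x. \<rho> (\<Psi> x)))"
  unfolding pullback_bundle_def by force

lemma smooth_map_open_vimage: "smooth_map A B \<Psi> \<Longrightarrow> open V \<Longrightarrow> open (\<Psi> -` V)"
  unfolding smooth_map_def using open_vimage by blast

lemma vector_bundle_pullback:
  assumes A: "smooth_manifold A" and B: "smooth_manifold B" and \<Psi>: "smooth_map A B \<Psi>"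
    and E: "vector_bundle B E"
  shows "vector_bundle A (pullback_bundle \<Psi> E)"
  unfolding vector_bundle_def
proof (intro conjI ballI allI; clarsimp simp: pullback_bundle_iff split: prod.splits)
  fix V \<rho> assume c: "(V, \<rho>) \<in> E"
  show "open (\<Psi> -` V) \<and> (\<forall>x\<in>\<Psi> -` V. linear (\<rho> (\<Psi> x)) \<and> bij (\<rho> (\<Psi> x)))"
    using smooth_map_open_vimage[OF \<Psi> triv_open[OF E c]] triv_linear[OF E c] triv_bij[OF E c] by auto
next
  show "(\<Union>(U, \<tau>)\<in>pullback_bundle \<Psi> E. U) = UNIV"
  proof -
    have "\<exists>U \<tau>. (U, \<tau>) \<in> pullback_bundle \<Psi> E \<and> x \<in> U" for x
      using vector_bundle_triv_exists[OF E, of "\<Psi> x"] unfolding pullback_bundle_iff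
      by (metis vimageI2)
    then show ?thesis by fast
  qed
next
  fix V \<rho> V' \<rho>' w assume c: "(V, \<rho>) \<in> E" "(V', \<rho>') \<in> E"
  have "open (V \<inter> V')" using triv_open[OF E c(1)] triv_open[OF E c(2)] by blast
  from smooth_fun_compose_map[OF A B \<Psi> this vector_bundle_transition[OF E c]]
  show "smooth_fun A (\<Psi> -` V \<inter> \<Psi> -` V') (\<lambda>x. \<rho>' (\<Psi> x) (inv (\<rho> (\<Psi> x)) w))"
    by (simp add: vimage_Int)
qed

section \<open>Bundle metrics and their pull-backs\<close>

lemma bundle_metric_form:
  assumes "bundle_metric A E h"
  shows form_bilinear: "bilinear (h x)" and form_sym: "h x u v = h x v u"
    and form_nondegenerate: "(\<And>v. h x u v = 0) \<Longrightarrow> u = 0"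
  using assms unfolding bundle_metric_def by blast+

lemma bundle_metric_smooth:
  assumes "bundle_metric A E h" "open W" "smooth_section A E W s" "smooth_section A E W t"
  shows "smooth_fun A W (\<lambda>x. h x (s x) (t x))"
  using assms unfolding bundle_metric_def by blast

text \<open>Smoothness of \<open>h\<close> on \<open>B\<close> yields smoothness only for products
  of sections that factor through \<Psi>. General sections are written in the pulled-back frame: the
  coefficients are smooth on \<open>A\<close>, and the Gram coefficients of the frame are
  compositions with \<Psi>.\<close>

lemma bundle_metric_pullback:
  assumes A: "smooth_manifold A" and B: "smooth_manifold B" and \<Psi>: "smooth_map A B \<Psi>"
    and E: "vector_bundle B E" and h: "bundle_metric B E h"
  shows "bundle_metric A (pullback_bundle \<Psi> E) (\<lambda>x. h (\<Psi> x))"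
  unfolding bundle_metric_def
proof (intro conjI allI impI)
  fix x
  show "bilinear (h (\<Psi> x))" by (rule form_bilinear[OF h])
  show "h (\<Psi> x) u v = h (\<Psi> x) v u" for u v by (rule form_sym[OF h])
  show "u = 0" if "\<forall>v. h (\<Psi> x) u v = 0" for u
    using form_nondegenerate[OF h] that by blast
next
  let ?E = "pullback_bundle \<Psi> E"
  note PE = vector_bundle_pullback[OF A B \<Psi> E]
  fix W s t assume "open W \<and> smooth_section A ?E W s \<and> smooth_section A ?E W t"
  then have W: "open W" and s: "smooth_section A ?E W s" and t: "smooth_section A ?E W t" by auto
  show "smooth_fun A W (\<lambda>x. h (\<Psi> x) (s x) (t x))"
  proof (rule smooth_fun_local[OF A])
    fix x assume "x \<in> W"
    obtain V \<rho> where c: "(V, \<rho>) \<in> E" "\<Psi> x \<in> V" using vector_bundle_triv_exists[OF E] .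
    have c': "(\<Psi> -` V, \<lambda>x. \<rho> (\<Psi> x)) \<in> ?E" using c(1) unfolding pullback_bundle_iff by blast
    have oV: "open (\<Psi> -` V)" by (rule triv_open[OF PE c'])
    then have o: "open (\<Psi> -` V \<inter> W)" using W by blast
    let ?e = "\<lambda>b y. inv (\<rho> y) b"
    have H: "smooth_fun A (\<Psi> -` V \<inter> W) (\<lambda>y. h (\<Psi> y) (?e b (\<Psi> y)) (?e c (\<Psi> y)))" for b c
      by (rule smooth_fun_subset[OF smooth_fun_compose_map[OF A B \<Psi> triv_open[OF E c(1)]
              bundle_metric_smooth[OF h triv_open[OF E c(1)] smooth_section_frame[OF B E c(1)]
                smooth_section_frame[OF B E c(1)]]]]) simp
    have S: "smooth_fun A (\<Psi> -` V \<inter> W) (\<lambda>y. \<rho> (\<Psi> y) (r y) \<bullet> b)"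
      if "smooth_section A ?E W r" for r b
      by (rule smooth_fun_inner[OF A o smooth_section_triv[OF that c'] smooth_fun_const[OF A o]])
    have "smooth_fun A (\<Psi> -` V \<inter> W) (\<lambda>y. \<Sum>b\<in>Basis. \<Sum>c\<in>Basis.
        (\<rho> (\<Psi> y) (s y) \<bullet> b) * ((\<rho> (\<Psi> y) (t y) \<bullet> c) * h (\<Psi> y) (?e b (\<Psi> y)) (?e c (\<Psi> y))))"
      by (rule smooth_fun_sum[OF A o], rule smooth_fun_sum[OF A o], rule smooth_fun_mult[OF A o S[OF s]],
          rule smooth_fun_mult[OF A o S[OF t] H])
    moreover have "(\<Sum>b\<in>Basis. \<Sum>c\<in>Basis.
        (\<rho> (\<Psi> y) (s y) \<bullet> b) * ((\<rho> (\<Psi> y) (t y) \<bullet> c) * h (\<Psi> y) (?e b (\<Psi> y)) (?e c (\<Psi> y)))) =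
        h (\<Psi> y) (s y) (t y)" if "y \<in> \<Psi> -` V \<inter> W" for y
    proof -
      have y: "\<Psi> y \<in> V" using that by simp
      note bl = form_bilinear[OF h, of "\<Psi> y"]
      have l: "linear (\<lambda>u. h (\<Psi> y) u v)" "linear (h (\<Psi> y) v)" for v
        using bl unfolding bilinear_def by auto
      have "h (\<Psi> y) (s y) (t y) = h (\<Psi> y) (\<Sum>b\<in>Basis. (\<rho> (\<Psi> y) (s y) \<bullet> b) *\<^sub>R ?e b (\<Psi> y))
          (\<Sum>c\<in>Basis. (\<rho> (\<Psi> y) (t y) \<bullet> c) *\<^sub>R ?e c (\<Psi> y))"
        by (simp only: frame_expansion[OF E c(1) y])
      also have "\<dots> = (\<Sum>b\<in>Basis. (\<rho> (\<Psi> y) (s y) \<bullet> b) * h (\<Psi> y) (?e b (\<Psi> y))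
          (\<Sum>c\<in>Basis. (\<rho> (\<Psi> y) (t y) \<bullet> c) *\<^sub>R ?e c (\<Psi> y)))"
        by (simp add: linear_sum[OF l(1)] linear_cmul[OF l(1)])
      also have "\<dots> = (\<Sum>b\<in>Basis. \<Sum>c\<in>Basis.
          (\<rho> (\<Psi> y) (s y) \<bullet> b) * ((\<rho> (\<Psi> y) (t y) \<bullet> c) * h (\<Psi> y) (?e b (\<Psi> y)) (?e c (\<Psi> y))))"
        by (simp add: linear_sum[OF l(2)] linear_cmul[OF l(2)] sum_distrib_left)
      finally show ?thesis by simp
    qed
    ultimately have "smooth_fun A (\<Psi> -` V \<inter> W) (\<lambda>y. h (\<Psi> y) (s y) (t y))"
      by (rule smooth_fun_cong[OF A o, rotated])
    then show "\<exists>V. open V \<and> x \<in> V \<and> smooth_fun A (W \<inter> V) (\<lambda>x. h (\<Psi> x) (s x) (t x))"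
      using oV c(2) by (intro exI[of _ "\<Psi> -` V"]) (simp add: Int_commute)
  qed
qed

text \<open>In the trivialization given by a target chart \<psi>, the image of \<open>X\<close>
  becomes the derivative of \<open>\<psi> (\<Psi> y)\<close> along \<open>X\<close>, to which
  \<open>smooth_fun_dfun\<close> applies.\<close>

lemma smooth_section_dmap:
  assumes A: "smooth_manifold A" and B: "smooth_manifold B" and \<Psi>: "smooth_map A B \<Psi>"
    and W: "open W" and X: "smooth_section A (tangent_bundle A) W X"
  shows "smooth_section A (pullback_bundle \<Psi> (tangent_bundle B)) W (\<lambda>x. dmap A B \<Psi> x (X x))"
proof (rule smooth_sectionI)
  fix U \<tau> assume "(U, \<tau>) \<in> pullback_bundle \<Psi> (tangent_bundle B)"
  then obtain V \<psi> where c: "(V, \<psi>) \<in> B" and U: "U = \<Psi> -` V" and \<tau>: "\<tau> = (\<lambda>x. dfun B \<psi> (\<Psi> x))"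
    unfolding pullback_bundle_iff tangent_bundle_iff by blast
  note oV = chart_open[OF B c]
  have o: "open (U \<inter> W)" unfolding U using smooth_map_open_vimage[OF \<Psi> oV] W by blast
  have "smooth_fun A (U \<inter> W) (\<lambda>x. dfun A (\<lambda>y. \<psi> (\<Psi> y)) x (X x))"
    by (rule smooth_fun_dfun[OF A o smooth_fun_subset[OF smooth_fun_compose_map[OF A B \<Psi> oV
              smooth_fun_chart[OF B c]]] smooth_section_subset[OF X]]) (auto simp: U)
  then show "smooth_fun A (U \<inter> W) (\<lambda>x. \<tau> x (dmap A B \<Psi> x (X x)))"
    by (rule smooth_fun_cong[OF A o, rotated])
      (simp add: U \<tau> dfun_compose_map[OF A B \<Psi> oV smooth_fun_chart[OF B c]])
qed

section \<open>Linear connections\<close>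

lemma linear_connectionD:
  assumes "linear_connection A E D" "open W" "smooth_section A E W s"
  shows "\<forall>x\<in>W. linear (\<lambda>v. D x v s)"
    and "\<forall>t. smooth_section A E W t \<longrightarrow>
      (\<forall>x\<in>W. \<forall>v. D x v (\<lambda>y. s y + t y) = D x v s + D x v t)"
    and "\<forall>f. smooth_fun A W f \<longrightarrow>
      (\<forall>x\<in>W. \<forall>v. D x v (\<lambda>y. f y *\<^sub>R s y) = dfun A f x v *\<^sub>R s x + f x *\<^sub>R D x v s)"
    and "\<forall>t. (\<forall>y\<in>W. t y = s y) \<longrightarrow> (\<forall>x\<in>W. \<forall>v. D x v t = D x v s)"
    and "\<forall>X. smooth_section A (tangent_bundle A) W X \<longrightarrow> smooth_section A E W (\<lambda>x. D x (X x) s)"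
proof -
  note * = mp[OF spec[OF spec[OF assms(1)[unfolded linear_connection_def], of W], of s]
      conjI[OF assms(2,3)]]
  show "\<forall>x\<in>W. linear (\<lambda>v. D x v s)" by (rule conjunct1[OF *])
  note * = conjunct2[OF *]
  show "\<forall>t. smooth_section A E W t \<longrightarrow>
      (\<forall>x\<in>W. \<forall>v. D x v (\<lambda>y. s y + t y) = D x v s + D x v t)" by (rule conjunct1[OF *])
  note * = conjunct2[OF *]
  show "\<forall>f. smooth_fun A W f \<longrightarrow>
      (\<forall>x\<in>W. \<forall>v. D x v (\<lambda>y. f y *\<^sub>R s y) = dfun A f x v *\<^sub>R s x + f x *\<^sub>R D x v s)"
    by (rule conjunct1[OF *])
  note * = conjunct2[OF *]
  show "\<forall>t. (\<forall>y\<in>W. t y = s y) \<longrightarrow> (\<forall>x\<in>W. \<forall>v. D x v t = D x v s)" by (rule conjunct1[OF *])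
  show "\<forall>X. smooth_section A (tangent_bundle A) W X \<longrightarrow> smooth_section A E W (\<lambda>x. D x (X x) s)"
    by (rule conjunct2[OF *])
qed

lemma pullback_connectionD:
  assumes "pullback_connection A B \<Psi> Dt D"
  shows "linear_connection A (pullback_bundle \<Psi> (tangent_bundle B)) D"
    and "open V \<Longrightarrow> smooth_section B (tangent_bundle B) V Y \<Longrightarrow> \<Psi> x \<in> V \<Longrightarrow>
      D x v (\<lambda>y. Y (\<Psi> y)) = Dt (\<Psi> x) (dmap A B \<Psi> x v) Y"
proof -
  note * = assms[unfolded pullback_connection_def]
  show "linear_connection A (pullback_bundle \<Psi> (tangent_bundle B)) D" by (rule conjunct1[OF *])
  assume "open V" "smooth_section B (tangent_bundle B) V Y" "\<Psi> x \<in> V"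
  with mp[OF spec[OF spec[OF conjunct2[OF *], of V], of Y]]
  show "D x v (\<lambda>y. Y (\<Psi> y)) = Dt (\<Psi> x) (dmap A B \<Psi> x v) Y" by (simp add: o_def)
qed

context
  fixes A :: "('m::{t2_space,second_countable_topology}, 'e::euclidean_space) chart set"
    and E :: "('m, 'v::euclidean_space) triv set" and D
  assumes M: "smooth_manifold A" and E: "vector_bundle A E" and D: "linear_connection A E D"
begin

context
  fixes W :: "'m set" and x :: 'm
  assumes W: "open W" and x: "x \<in> W"
begin

lemma connection_linear: "smooth_section A E W s \<Longrightarrow> linear (\<lambda>v. D x v s)"
  using linear_connectionD(1)[OF D W] x by simp

lemma connection_add:
  "smooth_section A E W s \<Longrightarrow> smooth_section A E W t \<Longrightarrow>
    D x v (\<lambda>y. s y + t y) = D x v s + D x v t"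
  using linear_connectionD(2)[OF D W] x by simp

lemma connection_scaleR:
  "smooth_fun A W f \<Longrightarrow> smooth_section A E W s \<Longrightarrow>
    D x v (\<lambda>y. f y *\<^sub>R s y) = dfun A f x v *\<^sub>R s x + f x *\<^sub>R D x v s"
  using linear_connectionD(3)[OF D W] x by simp

lemma connection_cong:
  assumes "smooth_section A E W s" "\<And>y. y \<in> W \<Longrightarrow> t y = s y"
  shows "D x v t = D x v s"
  using mp[OF spec[OF linear_connectionD(4)[OF D W assms(1)], of t]] assms(2) x by blast

lemma connection_zero: "D x v (\<lambda>y. 0) = 0"
  using connection_scaleR[OF smooth_fun_const[OF M W, of 0] smooth_section_zero[OF M E W], of v]
  by (simp add: dfun_const)

lemma connection_sum:
  assumes "\<And>i. i \<in> I \<Longrightarrow> smooth_section A E W (s i)"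
  shows "D x v (\<lambda>y. \<Sum>i\<in>I. s i y) = (\<Sum>i\<in>I. D x v (s i))"
  using assms
  by (induction I rule: infinite_finite_induct)
    (simp_all add: connection_zero connection_add smooth_section_sum[OF M E W])

end

lemma connection_smooth:
  "open W \<Longrightarrow> smooth_section A E W s \<Longrightarrow> smooth_section A (tangent_bundle A) W X \<Longrightarrow>
    smooth_section A E W (\<lambda>x. D x (X x) s)"
  using linear_connectionD(5)[OF D] by simp

text \<open>The classical local formula: derivatives of the components plus Christoffel terms, the
  latter being the derivatives of the frame \<open>inv (\<tau> y) b\<close>.\<close>

lemma connection_frame:
  assumes W: "open W" "x \<in> W" and s: "smooth_section A E W s" and c: "(U, \<tau>) \<in> E" "x \<in> U"
  shows "D x v s = (\<Sum>b\<in>Basis. (dfun A (\<lambda>y. \<tau> y (s y)) x v \<bullet> b) *\<^sub>R inv (\<tau> x) b +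
    (\<tau> x (s x) \<bullet> b) *\<^sub>R D x v (\<lambda>y. inv (\<tau> y) b))"
proof -
  have o: "open (U \<inter> W)" and xo: "x \<in> U \<inter> W" using triv_open[OF E c(1)] W c(2) by auto
  note \<tau>s = smooth_section_triv[OF s c(1)]
  have co: "smooth_fun A (U \<inter> W) (\<lambda>y. \<tau> y (s y) \<bullet> b)" for b
    by (rule smooth_fun_inner[OF M o \<tau>s smooth_fun_const[OF M o]])
  have fr: "smooth_section A E (U \<inter> W) (\<lambda>y. inv (\<tau> y) b)" for b
    by (rule smooth_section_subset[OF smooth_section_frame[OF M E c(1)]]) simp
  have sm: "smooth_section A E (U \<inter> W) (\<lambda>y. (\<tau> y (s y) \<bullet> b) *\<^sub>R inv (\<tau> y) b)" for b
    by (rule smooth_section_scaleR[OF M E o co fr])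
  have "D x v s = D x v (\<lambda>y. \<Sum>b\<in>Basis. (\<tau> y (s y) \<bullet> b) *\<^sub>R inv (\<tau> y) b)"
    by (rule sym, rule connection_cong[OF o xo smooth_section_subset[OF s]])
      (simp_all add: frame_expansion[OF E c(1)])
  also have "\<dots> = (\<Sum>b\<in>Basis. D x v (\<lambda>y. (\<tau> y (s y) \<bullet> b) *\<^sub>R inv (\<tau> y) b))"
    by (rule connection_sum[OF o xo sm])
  also have "\<dots> = (\<Sum>b\<in>Basis. (dfun A (\<lambda>y. \<tau> y (s y)) x v \<bullet> b) *\<^sub>R inv (\<tau> x) b +
      (\<tau> x (s x) \<bullet> b) *\<^sub>R D x v (\<lambda>y. inv (\<tau> y) b))"
    by (simp add: connection_scaleR[OF o xo co fr] dfun_inner_left[OF M o xo \<tau>s])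
  finally show ?thesis .
qed

end

section \<open>Metric compatibility and symmetry of the induced connection\<close>

lemma metric_connection_compat:
  assumes "metric_connection A E h D" "open W" "x \<in> W"
    and "smooth_section A E W s" "smooth_section A E W t"
  shows "dfun A (\<lambda>y. h y (s y) (t y)) x v = h x (D x v s) (t x) + h x (s x) (D x v t)"
  using assms unfolding metric_connection_def by blast

text \<open>The induced connection is known on pulled-back frame sections, where the claim is the
  chain rule applied to compatibility of \<open>Dt\<close>. Both sides obey the same Leibniz rule in
  each slot, which extends the identity to arbitrary sections.\<close>

lemma metric_connection_pullback:
  assumes A: "smooth_manifold A" and B: "smooth_manifold B" and \<Psi>: "smooth_map A B \<Psi>"
    and h: "bundle_metric B (tangent_bundle B) h"
    and Dt: "metric_connection B (tangent_bundle B) h Dt"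
    and D: "pullback_connection A B \<Psi> Dt D"
  shows "metric_connection A (pullback_bundle \<Psi> (tangent_bundle B)) (\<lambda>x. h (\<Psi> x)) D"
  unfolding metric_connection_def
proof (intro allI impI ballI)
  let ?TB = "tangent_bundle B"
  let ?E = "pullback_bundle \<Psi> ?TB"
  note TB = vector_bundle_tangent[OF B]
  note E = vector_bundle_pullback[OF A B \<Psi> TB]
  note hE = bundle_metric_pullback[OF A B \<Psi> TB h]
  have DE: "linear_connection A ?E D" by (rule pullback_connectionD(1)[OF D])
  fix W s t x v
  assume "open W \<and> smooth_section A ?E W s \<and> smooth_section A ?E W t" and x: "x \<in> W"
  then have W: "open W" and s: "smooth_section A ?E W s" and t: "smooth_section A ?E W t" by auto
  obtain V \<rho> where c: "(V, \<rho>) \<in> ?TB" "\<Psi> x \<in> V" using vector_bundle_triv_exists[OF TB] .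
  have c': "(\<Psi> -` V, \<lambda>x. \<rho> (\<Psi> x)) \<in> ?E" using c(1) unfolding pullback_bundle_iff by blast
  note oV = triv_open[OF TB c(1)]
  define O' where "O' = \<Psi> -` V \<inter> W"
  have o: "open O'" and xo: "x \<in> O'" and sub: "O' \<subseteq> W" "O' \<subseteq> \<Psi> -` V"
    using triv_open[OF E c'] W x c(2) by (auto simp: O'_def)
  let ?e = "\<lambda>b y. inv (\<rho> (\<Psi> y)) b"
  have e: "smooth_section A ?E O' (?e b)" for b
    by (rule smooth_section_subset[OF smooth_section_frame[OF A E c'] sub(2)])
  let ?P = "\<lambda>s t. dfun A (\<lambda>y. h (\<Psi> y) (s y) (t y)) x v =
    h (\<Psi> x) (D x v s) (t x) + h (\<Psi> x) (s x) (D x v t)"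
  have l: "linear (\<lambda>u. h y u w)" for y w
    using form_bilinear[OF h, of y] unfolding bilinear_def by blast
  have P_sym: "?P t s" if "?P s t" for s t
    using that by (simp add: form_sym[OF h, of "\<Psi> _" "t _"] form_sym[OF h, of _ "D x v t"] add.commute)
  have frame: "?P (?e b) (?e c)" for b c
  proof -
    have fr: "smooth_section B ?TB V (\<lambda>y. inv (\<rho> y) b)" for b by (rule smooth_section_frame[OF B TB c(1)])
    have De: "D x v (?e b) = Dt (\<Psi> x) (dmap A B \<Psi> x v) (\<lambda>y. inv (\<rho> y) b)" for b
      by (rule pullback_connectionD(2)[OF D oV fr c(2)])
    show ?thesis
      using dfun_compose_map[OF A B \<Psi> oV bundle_metric_smooth[OF h oV fr fr] c(2), of b c v]
        metric_connection_compat[OF Dt oV c(2) fr fr, of b c "dmap A B \<Psi> x v"]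
      by (simp add: De)
  qed
  \<comment> \<open>Passes from frame sections to any section in the first slot; the derivatives of
    the coefficients appear identically on both sides.\<close>
  have expand: "?P s t" if P: "\<And>b. ?P (?e b) t" and s: "smooth_section A ?E O' s"
    and t: "smooth_section A ?E O' t" for s t
  proof -
    let ?f = "\<lambda>b y. \<rho> (\<Psi> y) (s y) \<bullet> b"
    have f: "smooth_fun A O' (?f b)" for b
      using smooth_section_triv[OF s c'] sub(2)
      by (intro smooth_fun_inner[OF A o _ smooth_fun_const[OF A o]]) (simp add: Int_absorb1)
    have fe: "smooth_section A ?E O' (\<lambda>y. ?f b y *\<^sub>R ?e b y)" for b
      by (rule smooth_section_scaleR[OF A E o f e])
    have he: "smooth_fun A O' (\<lambda>y. h (\<Psi> y) (?e b y) (t y))" for b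
      by (rule bundle_metric_smooth[OF hE o e t])
    have ex: "(\<Sum>b\<in>Basis. ?f b y *\<^sub>R ?e b y) = s y" if "y \<in> O'" for y
      by (rule frame_expansion[OF E c']) (use sub(2) that in blast)
    have Ds: "D x v s = (\<Sum>b\<in>Basis. dfun A (?f b) x v *\<^sub>R ?e b x + ?f b x *\<^sub>R D x v (?e b))"
    proof -
      have "D x v s = D x v (\<lambda>y. \<Sum>b\<in>Basis. ?f b y *\<^sub>R ?e b y)"
        by (rule sym, rule connection_cong[OF A E DE o xo s]) (rule ex)
      then show ?thesis
        by (simp add: connection_sum[OF A E DE o xo fe] connection_scaleR[OF A E DE o xo f e])
    qed
    have "dfun A (\<lambda>y. h (\<Psi> y) (s y) (t y)) x = 
        dfun A (\<lambda>y. \<Sum>b\<in>Basis. ?f b y * h (\<Psi> y) (?e b y) (t y)) x"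
    proof (rule dfun_cong[OF A o xo bundle_metric_smooth[OF hE o s t]])
      fix y assume "y \<in> O'"
      from ex[OF this] show "h (\<Psi> y) (s y) (t y) = (\<Sum>b\<in>Basis. ?f b y * h (\<Psi> y) (?e b y) (t y))"
        using linear_sum[OF l[of "\<Psi> y" "t y"], of "\<lambda>b. ?f b y *\<^sub>R ?e b y" Basis]
        by (simp only: linear_cmul[OF l] real_scaleR_def)
    qed
    then have "dfun A (\<lambda>y. h (\<Psi> y) (s y) (t y)) x v =
        (\<Sum>b\<in>Basis. dfun A (?f b) x v * h (\<Psi> x) (?e b x) (t x) +
          ?f b x * (h (\<Psi> x) (D x v (?e b)) (t x) + h (\<Psi> x) (?e b x) (D x v t)))"
      by (simp add: dfun_sum[OF A o xo smooth_fun_mult[OF A o f he]]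
          dfun_bilinear[OF A o xo bounded_bilinear_mult f he] P)
    also have "\<dots> = h (\<Psi> x) (D x v s) (t x) + h (\<Psi> x) (s x) (D x v t)"
    proof -
      have "h (\<Psi> x) (s x) w = (\<Sum>b\<in>Basis. ?f b x * h (\<Psi> x) (?e b x) w)" for w
        using linear_sum[OF l[of "\<Psi> x" w], of "\<lambda>b. ?f b x *\<^sub>R ?e b x" Basis]
        by (simp only: ex[OF xo] linear_cmul[OF l] real_scaleR_def)
      moreover have "h (\<Psi> x) (D x v s) w = (\<Sum>b\<in>Basis. dfun A (?f b) x v * h (\<Psi> x) (?e b x) w +
          ?f b x * h (\<Psi> x) (D x v (?e b)) w)" for w
        unfolding Ds by (simp add: linear_sum[OF l] linear_cmul[OF l] linear_add[OF l])
      ultimately show ?thesis by (simp only: distrib_left sum.distrib add.assoc)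
    qed
    finally show ?thesis .
  qed
  have s': "smooth_section A ?E O' s" and t': "smooth_section A ?E O' t"
    using smooth_section_subset[OF s sub(1)] smooth_section_subset[OF t sub(1)] by auto
  \<comment> \<open>The first slot is expanded twice, once for \<open>t\<close> against the frame
    and once for \<open>s\<close> against \<open>t\<close>, with symmetry of \<open>h\<close>
    exchanging the slots in between.\<close>
  have "?P (?e b) t" for b
    by (rule P_sym, rule expand[OF _ t' e], rule frame)
  then show "?P s t" by (rule expand[OF _ s' t'])
qed

text \<open>Coordinate fields commute: along \<open>inv (dfun B \<psi> z) r\<close> the coordinate
  function \<open>\<psi> z \<bullet> a\<close> has the constant derivative
  \<open>r \<bullet> a\<close>, so both iterated derivatives in the torsion identity vanish. A
  tangent vector that kills all coordinate functions is zero.\<close>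

lemma torsion_free_coordinate_frame:
  assumes B: "smooth_manifold B" and D: "torsion_free B D"
    and c: "(V, \<psi>) \<in> B" "y \<in> V"
  shows "D y (inv (dfun B \<psi> y) p) (\<lambda>z. inv (dfun B \<psi> z) q) =
    D y (inv (dfun B \<psi> y) q) (\<lambda>z. inv (dfun B \<psi> z) p)" (is "?L = ?R")
proof -
  note TB = vector_bundle_tangent[OF B]
  have c': "(V, \<lambda>z. dfun B \<psi> z) \<in> tangent_bundle B" using c(1) unfolding tangent_bundle_iff by blast
  note V = chart_open[OF B c(1)]
  note \<psi> = smooth_fun_chart[OF B c(1)]
  have fr: "smooth_section B (tangent_bundle B) V (\<lambda>z. inv (dfun B \<psi> z) r)" for r
    by (rule smooth_section_frame[OF B TB c'])
  have "dfun B \<psi> y (?L - ?R) \<bullet> a = 0" for a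
  proof -
    let ?f = "\<lambda>z. \<psi> z \<bullet> a"
    have f: "smooth_fun B V ?f" by (rule smooth_fun_inner[OF B V \<psi> smooth_fun_const[OF B V]])
    have const: "dfun B (\<lambda>z. dfun B ?f z (inv (dfun B \<psi> z) r)) y = (\<lambda>v. 0)" for r
    proof -
      have "dfun B (\<lambda>z. dfun B ?f z (inv (dfun B \<psi> z) r)) y = dfun B (\<lambda>z. r \<bullet> a) y"
      proof (rule dfun_cong[OF B V c(2) smooth_fun_dfun[OF B V f fr]])
        fix z assume z: "z \<in> V"
        show "dfun B ?f z (inv (dfun B \<psi> z) r) = r \<bullet> a"
          using dfun_chart_bij[OF B c(1) z]
          by (simp add: dfun_inner_left[OF B V z \<psi>] bij_is_surj surj_f_inv_f)
      qed
      then show ?thesis by (simp add: dfun_const[OF B V c(2)])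
    qed
    have "dfun B ?f y (?L - ?R) = 0"
      using D V fr[of p] fr[of q] f c(2) const[of p] const[of q] unfolding torsion_free_def by fastforce
    then show ?thesis by (simp add: dfun_inner_left[OF B V c(2) \<psi>])
  qed
  then have "dfun B \<psi> y (?L - ?R) = 0" by (metis inner_eq_zero_iff)
  moreover have "dfun B \<psi> y 0 = 0" by (rule linear_0[OF dfun_chart_linear[OF B c]])
  ultimately have "?L - ?R = 0"
    using dfun_chart_bij[OF B c] by (metis bij_is_inj injD)
  then show ?thesis by simp
qed

text \<open>The second fundamental form is symmetric: in coordinates the two sides differ by a mixed
  second derivative of \<open>\<Psi>\<close> and by the torsion of \<open>Dt\<close>.\<close>

lemma pullback_connection_dmap_symmetric:
  assumes A: "smooth_manifold A" and B: "smooth_manifold B" and \<Psi>: "smooth_map A B \<Psi>"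
    and Dt: "linear_connection B (tangent_bundle B) Dt" "torsion_free B Dt"
    and D: "pullback_connection A B \<Psi> Dt D"
    and c: "(U, \<phi>) \<in> A" "x \<in> U"
  shows "D x (inv (dfun A \<phi> x) p) (\<lambda>y. dmap A B \<Psi> y (inv (dfun A \<phi> y) q)) =
    D x (inv (dfun A \<phi> x) q) (\<lambda>y. dmap A B \<Psi> y (inv (dfun A \<phi> y) p))"
proof -
  let ?TA = "tangent_bundle A" and ?TB = "tangent_bundle B"
  let ?E = "pullback_bundle \<Psi> ?TB"
  note TA = vector_bundle_tangent[OF A] and TB = vector_bundle_tangent[OF B]
  note E = vector_bundle_pullback[OF A B \<Psi> TB]
  have DE: "linear_connection A ?E D" by (rule pullback_connectionD(1)[OF D])
  obtain V \<psi> where d: "(V, \<psi>) \<in> B" "\<Psi> x \<in> V" using smooth_manifold_chart_exists[OF B] .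
  have cA: "(U, \<lambda>y. dfun A \<phi> y) \<in> ?TA" using c(1) unfolding tangent_bundle_iff by blast
  have dB: "(V, \<lambda>y. dfun B \<psi> y) \<in> ?TB" using d(1) unfolding tangent_bundle_iff by blast
  have dE: "(\<Psi> -` V, \<lambda>y. dfun B \<psi> (\<Psi> y)) \<in> ?E" using dB unfolding pullback_bundle_iff by blast
  note V = chart_open[OF B d(1)] and U = chart_open[OF A c(1)] and oV = triv_open[OF E dE]
  define O' where "O' = U \<inter> \<Psi> -` V"
  have o: "open O'" and xo: "x \<in> O'" using U oV c(2) d(2) by (auto simp: O'_def)
  let ?X = "\<lambda>q y. inv (dfun A \<phi> y) q" and ?e = "\<lambda>b y. inv (dfun B \<psi> y) b"
  let ?F = "\<lambda>y. \<psi> (\<Psi> y)"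
  have F: "smooth_fun A (\<Psi> -` V) ?F" by (rule smooth_fun_compose_map[OF A B \<Psi> V smooth_fun_chart[OF B d(1)]])
  have X: "smooth_section A ?TA U (?X q)" for q by (rule smooth_section_frame[OF A TA cA])
  have s: "smooth_section A ?E U (\<lambda>y. dmap A B \<Psi> y (?X q y))" for q
    by (rule smooth_section_dmap[OF A B \<Psi> U X])
  have e: "smooth_section B ?TB V (?e b)" for b by (rule smooth_section_frame[OF B TB dB])
  have dF: "dfun B \<psi> (\<Psi> y) (dmap A B \<Psi> y w) = dfun A ?F y w" if "y \<in> \<Psi> -` V" for y w
    using dfun_compose_map[OF A B \<Psi> V smooth_fun_chart[OF B d(1)], of y w] that by simp
  \<comment> \<open>The derivative of \<Psi>, written in the charts \<phi> and \<psi>, in the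
    coordinate direction \<open>q\<close>.\<close>
  define G where "G q z = frechet_derivative (?F \<circ> inv_into U \<phi>) (at z) q" for q z
  have Fs: "smooth_on (\<phi> ` O') (?F \<circ> inv_into U \<phi>)"
    unfolding O'_def by (rule smooth_fun_chart_rep[OF c(1) F])
  have o\<phi>: "open (\<phi> ` O')" unfolding O'_def by (rule chart_image_open[OF A c(1) oV])
  have Gs: "smooth_on (\<phi> ` O') (G q)" for q unfolding G_def by (rule smooth_on_derivative[OF Fs])
  have FG: "dfun A ?F y (?X q y) = G q (\<phi> y)" if "y \<in> O'" for y q
    using dfun_in_chart[OF A oV _ c(1) _ F, of y "?X q y"] dfun_chart_bij[OF A c(1), of y] that
    by (simp add: O'_def G_def bij_is_surj surj_f_inv_f)
  have second: "dfun A (\<lambda>y. dfun B \<psi> (\<Psi> y) (dmap A B \<Psi> y (?X q y))) x (?X p x) =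
      frechet_derivative (G q) (at (\<phi> x)) p" for p q
  proof -
    have \<phi>: "smooth_fun A O' \<phi>"
      by (rule smooth_fun_subset[OF smooth_fun_chart[OF A c(1)]]) (simp add: O'_def)
    have Gq: "smooth_fun A O' (\<lambda>y. G q (\<phi> y))"
      by (rule smooth_fun_compose[OF A o \<phi> o\<phi> Gs]) simp
    have "dfun A (\<lambda>y. G q (\<phi> y)) x = dfun A (\<lambda>y. dfun B \<psi> (\<Psi> y) (dmap A B \<Psi> y (?X q y))) x"
      by (rule dfun_cong[OF A o xo Gq]) (simp add: FG dF[unfolded vimage_eq] O'_def)
    moreover have "dfun A (\<lambda>y. G q (\<phi> y)) x (?X p x) =
        frechet_derivative (G q) (at (\<phi> x)) (dfun A \<phi> x (?X p x))"
      by (rule dfun_compose[OF A o xo \<phi> o\<phi> Gs]) (use xo in simp)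
    ultimately show ?thesis
      using dfun_chart_bij[OF A c] by (simp add: bij_is_surj surj_f_inv_f)
  qed
  have De: "D x v (\<lambda>y. ?e b (\<Psi> y)) = Dt (\<Psi> x) (dmap A B \<Psi> x v) (?e b)" for b v
    by (rule pullback_connectionD(2)[OF D V e d(2)])
  have dm: "dmap A B \<Psi> x v = (\<Sum>b\<in>Basis. (dfun A ?F x v \<bullet> b) *\<^sub>R ?e b (\<Psi> x))" for v
    using frame_expansion[OF TB dB d(2), of "dmap A B \<Psi> x v"] dF[of x v] d(2) by simp
  have Dsum: "Dt (\<Psi> x) (dmap A B \<Psi> x v) (?e b) =
      (\<Sum>a\<in>Basis. (dfun A ?F x v \<bullet> a) *\<^sub>R Dt (\<Psi> x) (?e a (\<Psi> x)) (?e b))" for v b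
  proof -
    have l: "linear (\<lambda>v. Dt (\<Psi> x) v (?e b))"
      by (rule connection_linear[OF B TB Dt(1) V d(2) e])
    show ?thesis unfolding dm by (simp only: linear_sum[OF l] linear_cmul[OF l])
  qed
  \<comment> \<open>The first sum holds the mixed second derivative of \<Psi> in coordinates, the
    double sum the Christoffel terms of \<open>Dt\<close>; each is symmetric in \<open>p\<close> and
    \<open>q\<close> separately.\<close>
  have formula: "D x (?X p x) (\<lambda>y. dmap A B \<Psi> y (?X q y)) =
      (\<Sum>b\<in>Basis. (frechet_derivative (G q) (at (\<phi> x)) p \<bullet> b) *\<^sub>R ?e b (\<Psi> x)) +
      (\<Sum>b\<in>Basis. \<Sum>a\<in>Basis. ((G q (\<phi> x) \<bullet> b) * (G p (\<phi> x) \<bullet> a)) *\<^sub>R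
        Dt (\<Psi> x) (?e a (\<Psi> x)) (?e b))" for p q
    using connection_frame[OF A E DE U c(2) s[of q] dE, of "?X p x"] d(2)
    by (simp add: second De Dsum sum.distrib dF FG[OF xo] scaleR_sum_right)
  have "frechet_derivative (G q) (at (\<phi> x)) p = frechet_derivative (G p) (at (\<phi> x)) q"
    unfolding G_def using smooth_on_second_derivative_symmetric[OF o\<phi> _ Fs] xo by blast
  moreover have "(\<Sum>b\<in>Basis. \<Sum>a\<in>Basis. ((G q (\<phi> x) \<bullet> b) * (G p (\<phi> x) \<bullet> a)) *\<^sub>R
        Dt (\<Psi> x) (?e a (\<Psi> x)) (?e b)) =
      (\<Sum>b\<in>Basis. \<Sum>a\<in>Basis. ((G p (\<phi> x) \<bullet> b) * (G q (\<phi> x) \<bullet> a)) *\<^sub>R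
        Dt (\<Psi> x) (?e a (\<Psi> x)) (?e b))"
    \<comment> \<open>Exchanging the indices \<open>a\<close> and \<open>b\<close> exchanges the
      roles of \<open>p\<close> and \<open>q\<close> in the coefficients; the frame derivatives stay
      the same because \<open>Dt\<close> is torsion free.\<close>
    by (subst sum.swap) (simp add: mult.commute torsion_free_coordinate_frame[OF B Dt(2) d, symmetric])
  ultimately show ?thesis unfolding formula by simp
qed

section \<open>Quotient spaces\<close>

lemma qclass_self: "subspace L \<Longrightarrow> a \<in> qclass L a"
  unfolding qclass_def using subspace_0 by force

lemma qclass_eq_iff:
  assumes "subspace L"
  shows "qclass L a = qclass L b \<longleftrightarrow> a - b \<in> L"
proof
  assume "qclass L a = qclass L b"
  then have "a \<in> qclass L b" using qclass_self[OF assms, of a] by simp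
  then show "a - b \<in> L" unfolding qclass_def by auto
next
  have sub: "qclass L a \<subseteq> qclass L b" if "a - b \<in> L" for a b
  proof
    fix x assume "x \<in> qclass L a"
    then obtain w where "w \<in> L" "x = a + w" unfolding qclass_def by auto
    then have "x = b + ((a - b) + w)" "(a - b) + w \<in> L"
      using that assms by (auto intro: subspace_add)
    then show "x \<in> qclass L b" unfolding qclass_def by blast
  qed
  assume "a - b \<in> L"
  moreover have "b - a \<in> L" using subspace_neg[OF assms \<open>a - b \<in> L\<close>] by simp
  ultimately show "qclass L a = qclass L b" using sub by blast
qed

lemma qadd_qclass:
  assumes "subspace L"
  shows "qadd (qclass L a) (qclass L b) = qclass L (a + b)"
proof (intro set_eqI iffI)
  fix x assume "x \<in> qadd (qclass L a) (qclass L b)"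
  then obtain u w where "u \<in> L" "w \<in> L" "x = (a + u) + (b + w)"
    unfolding qadd_def qclass_def by auto
  then have "u + w \<in> L" "x = (a + b) + (u + w)" using subspace_add[OF assms] by auto
  then show "x \<in> qclass L (a + b)" unfolding qclass_def by blast
next
  fix x assume "x \<in> qclass L (a + b)"
  then obtain w where w: "w \<in> L" "x = a + b + w" unfolding qclass_def by auto
  then have "b + w \<in> qclass L b" "x = a + (b + w)" unfolding qclass_def by auto
  then show "x \<in> qadd (qclass L a) (qclass L b)"
    unfolding qadd_def using qclass_self[OF assms, of a] by blast
qed

lemma qscale_qclass:
  assumes "subspace L"
  shows "qscale L c (qclass L a) = qclass L (c *\<^sub>R a)"
proof (intro set_eqI iffI)
  fix x assume "x \<in> qscale L c (qclass L a)"
  then obtain u w where "u \<in> L" "w \<in> L" "x = c *\<^sub>R (a + u) + w"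
    unfolding qscale_def qclass_def by auto
  then have "c *\<^sub>R u + w \<in> L" "x = c *\<^sub>R a + (c *\<^sub>R u + w)"
    using subspace_add[OF assms] subspace_scale[OF assms] by (auto simp: scaleR_add_right)
  then show "x \<in> qclass L (c *\<^sub>R a)" unfolding qclass_def by blast
next
  fix x assume "x \<in> qclass L (c *\<^sub>R a)"
  then obtain w where "w \<in> L" "x = c *\<^sub>R a + w" unfolding qclass_def by auto
  then show "x \<in> qscale L c (qclass L a)"
    unfolding qscale_def using qclass_self[OF assms, of a] by blast
qed

text \<open>The representatives picked by \<open>SOME\<close> differ from \<open>u\<close> and
  \<open>v\<close> by elements of \<open>L\<close>. All resulting cross terms vanish, as
  \<open>L\<close> is null and orthogonal to both vectors.\<close>

lemma quotient_form_qclass: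
  assumes b: "bilinear b" and L: "subspace L" and null: "\<And>u w. u \<in> L \<Longrightarrow> w \<in> L \<Longrightarrow> b u w = 0"
    and u: "\<And>w. w \<in> L \<Longrightarrow> b u w = 0 \<and> b w u = 0" and v: "\<And>w. w \<in> L \<Longrightarrow> b v w = 0 \<and> b w v = 0"
  shows "quotient_form b (qclass L u) (qclass L v) = b u v"
proof -
  have "\<exists>w\<in>L. (SOME a. a \<in> qclass L u) = u + w" for u
    using someI[of "\<lambda>a. a \<in> qclass L u" u] qclass_self[OF L, of u] unfolding qclass_def by auto
  then obtain p q where pq: "p \<in> L" "(SOME a. a \<in> qclass L u) = u + p"
    "q \<in> L" "(SOME a. a \<in> qclass L v) = v + q" by metis
  then show ?thesis
    unfolding quotient_form_def pq(2,4)
    using bilinear_ladd[OF b] bilinear_radd[OF b] null[OF pq(1,3)] u[OF pq(3)] v[OF pq(1)] by simp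
qed

section \<open>Lightlike normal fields along a spacelike immersion\<close>

locale lightlike_normal =
  fixes A :: "('m::{t2_space,second_countable_topology}, real ^ 'n) chart set"
    and B :: "('p::{t2_space,second_countable_topology}, real ^ 'k) chart set"
    and gt :: "('p, real ^ 'k) form_field"
    and \<Psi> :: "'m \<Rightarrow> 'p"
    and \<xi> :: "'m \<Rightarrow> real ^ 'k"
    and Dt :: "('p, real ^ 'k, real ^ 'k) connection"
    and D :: "('m, real ^ 'n, real ^ 'k) connection"
  assumes dim2: "CARD('n) \<ge> 2" and codim: "CARD('k) = CARD('n) + 2"
    and A: "smooth_manifold A" and B: "smooth_manifold B" and lorentz: "lorentzian_metric B gt"
    and spacelike: "spacelike_immersion A B gt \<Psi>"
    and normal: "normal_field A B \<Psi> gt \<xi>" and lightlike: "lightlike_field \<Psi> gt \<xi>"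
    and LC: "levi_civita B gt Dt" and PC: "pullback_connection A B \<Psi> Dt D"
begin

abbreviation T where "T \<equiv> pullback_bundle \<Psi> (tangent_bundle B)"
abbreviation h where "h \<equiv> \<lambda>x. gt (\<Psi> x)"
abbreviation L where "L \<equiv> \<lambda>x. span {\<xi> x}"
abbreviation g where "g \<equiv> induced_metric A B \<Psi> gt"
abbreviation d where "d \<equiv> dmap A B \<Psi>"
abbreviation N where "N \<equiv> normal_space A B \<Psi> gt"
abbreviation S where "S \<equiv> weingarten A B \<Psi> gt D \<xi>"
abbreviation \<beta> where "\<beta> \<equiv> tractor_beta A T L D"

lemma smooth_Psi: "smooth_map A B \<Psi>" and d_inj: "inj (d x)"
  and g_pos: "v \<noteq> 0 \<Longrightarrow> g x v v > 0"
  using spacelike unfolding spacelike_immersion_def immersion_def riemannian_metric_def by blast+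

lemma gt_metric: "bundle_metric B (tangent_bundle B) gt"
  using lorentz unfolding lorentzian_metric_def by blast

lemmas TA = vector_bundle_tangent[OF A] and TB = vector_bundle_tangent[OF B]
lemmas T_bundle = vector_bundle_pullback[OF A B smooth_Psi TB]
lemmas h_metric = bundle_metric_pullback[OF A B smooth_Psi TB gt_metric]
lemmas D_linear = pullback_connectionD(1)[OF PC]

lemma Dt_linear: "linear_connection B (tangent_bundle B) Dt"
  and Dt_metric: "metric_connection B (tangent_bundle B) gt Dt" and Dt_torsion: "torsion_free B Dt"
  using LC unfolding levi_civita_def by blast+

lemmas D_metric = metric_connection_pullback[OF A B smooth_Psi gt_metric Dt_metric PC]

lemma h_linear: "linear (\<lambda>u. h x u w)" "linear (h x w)"
  using form_bilinear[OF h_metric, of x] unfolding bilinear_def by auto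

lemmas h_simps = linear_add[OF h_linear(1)] linear_add[OF h_linear(2)]
  linear_diff[OF h_linear(1)] linear_diff[OF h_linear(2)]
  linear_cmul[OF h_linear(1)] linear_cmul[OF h_linear(2)]
  linear_0[OF h_linear(1)] linear_0[OF h_linear(2)]

lemma h_sym: "h x u v = h x v u"
  by (rule form_sym[OF h_metric])

lemma g_eq: "g x v w = h x (d x v) (d x w)"
  unfolding induced_metric_def ..

lemma d_linear: "linear (d x)"
proof -
  obtain V \<psi> where c: "chart_at B (\<Psi> x) = (V, \<psi>)" by fastforce
  have V: "(V, \<psi>) \<in> B" "\<Psi> x \<in> V" using chart_at_works[OF B, of "\<Psi> x"] c by auto
  have o: "open (\<Psi> -` V)" by (rule smooth_map_open_vimage[OF smooth_Psi chart_open[OF B V(1)]])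
  have "linear (dfun A (\<lambda>y. \<psi> (\<Psi> y)) x)"
    by (rule dfun_linear[OF A o _ smooth_fun_compose_map[OF A B smooth_Psi chart_open[OF B V(1)]
            smooth_fun_chart[OF B V(1)]]]) (use V(2) in simp)
  then show ?thesis by (simp add: dmap_def c o_def)
qed

lemmas d_simps = linear_add[OF d_linear] linear_diff[OF d_linear] linear_cmul[OF d_linear]
  linear_0[OF d_linear]

lemma g_linear: "linear (\<lambda>v. g x v w)" "linear (g x v)"
  unfolding g_eq using linear_compose[OF d_linear h_linear(1)] linear_compose[OF d_linear h_linear(2)]
  by (simp_all add: o_def)

lemma g_sym: "g x v w = g x w v"
  unfolding g_eq by (rule h_sym)

lemma g_nondegenerate: "(\<And>w. g x v w = 0) \<Longrightarrow> v = 0"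
  using g_pos[of v x] by force

lemma xi_smooth: "smooth_section A T W \<xi>"
  using normal smooth_section_subset[of A T UNIV \<xi> W] unfolding normal_field_def by simp

lemma xi_nonzero: "\<xi> x \<noteq> 0" and xi_null: "h x (\<xi> x) (\<xi> x) = 0"
  using lightlike unfolding lightlike_field_def by auto

lemma xi_normal: "h x (\<xi> x) (d x v) = 0" "h x (d x v) (\<xi> x) = 0"
proof -
  have "\<xi> x \<in> N x" using normal unfolding normal_field_def by blast
  then show "h x (\<xi> x) (d x v) = 0" unfolding normal_space_def by blast
  then show "h x (d x v) (\<xi> x) = 0" by (simp add: h_sym[of x "d x v"])
qed

lemma N_iff: "u \<in> N x \<longleftrightarrow> (\<forall>v. h x u (d x v) = 0)"
  unfolding normal_space_def by simp

lemma N_D: "u \<in> N x \<Longrightarrow> h x u (d x v) = 0"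
  by (simp add: N_iff)

lemma normal_component_unique:
  assumes "u + d x v \<in> N x" "u + d x w \<in> N x"
  shows "v = w"
proof -
  have "g x (v - w) z = 0" for z
    using N_D[OF assms(1), of z] N_D[OF assms(2), of z] by (simp add: g_eq h_simps d_simps)
  then show ?thesis using g_nondegenerate[of x "v - w"] by simp
qed

text \<open>This is the orthogonal projection onto the tangent space. Nondegeneracy of the induced
  metric makes its Gram operator invertible; together with uniqueness it gives the
  \<open>THE\<close> in \<open>weingarten\<close> a value.\<close>

lemma normal_component_exists: "\<exists>w. u + d x w \<in> N x"
proof -
  \<comment> \<open>The Gram operator: it represents \<open>g x\<close> by the Euclidean inner
    product of the model space.\<close>
  define F where "F w = (\<Sum>b\<in>Basis. g x w b *\<^sub>R b)" for w
  have F_inner: "F w \<bullet> v = g x w v" for w v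
  proof -
    have "g x w v = g x w (\<Sum>b\<in>Basis. (v \<bullet> b) *\<^sub>R b)" by (simp add: euclidean_representation)
    also have "\<dots> = (\<Sum>b\<in>Basis. (v \<bullet> b) * g x w b)"
      by (simp only: linear_sum[OF g_linear(2)] linear_cmul[OF g_linear(2)] real_scaleR_def)
    also have "\<dots> = F w \<bullet> v"
      by (simp add: F_def inner_sum_left inner_sum_right inner_commute mult.commute)
    finally show ?thesis by simp
  qed
  have lin: "linear F"
    unfolding F_def
    by (rule linearI)
      (simp_all add: linear_add[OF g_linear(1)] linear_cmul[OF g_linear(1)] scaleR_add_left
        sum.distrib scaleR_sum_right)
  have "inj F"
    unfolding linear_injective_0[OF lin]
  proof (intro allI impI)
    fix v assume v: "F v = 0"
    have "g x v w = 0" for w using F_inner[of v w] by (simp add: v)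
    then show "v = 0" by (rule g_nondegenerate)
  qed
  then have "surj F" by (simp add: linear_injective_imp_surjective[OF lin])
  \<comment> \<open>The right-hand side represents the functional that sends \<open>v\<close> to
    \<open>- h x u (d x v)\<close>, so \<open>d x w\<close> cancels the tangential part of
    \<open>u\<close>.\<close>
  from surjD[OF this, of "- (\<Sum>b\<in>Basis. h x u (d x b) *\<^sub>R b)"]
  obtain w where w: "F w = - (\<Sum>b\<in>Basis. h x u (d x b) *\<^sub>R b)" by metis
  have "h x (u + d x w) (d x v) = 0" for v
  proof -
    have l: "linear (\<lambda>v. h x u (d x v))"
      using linear_compose[OF d_linear h_linear(2)] by (simp add: o_def)
    have "h x u (d x v) = h x u (d x (\<Sum>b\<in>Basis. (v \<bullet> b) *\<^sub>R b))"
      by (simp add: euclidean_representation)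
    also have "\<dots> = (\<Sum>b\<in>Basis. (v \<bullet> b) * h x u (d x b))"
      by (simp only: linear_sum[OF l] linear_cmul[OF l] real_scaleR_def)
    also have "\<dots> = - (F w \<bullet> v)"
      by (simp add: w inner_sum_left inner_sum_right inner_commute mult.commute)
    finally show ?thesis by (simp add: F_inner g_eq h_simps)
  qed
  then show ?thesis unfolding N_iff by blast
qed

section \<open>The Weingarten endomorphism\<close>

lemma weingarten_eqI: "D x v \<xi> + d x w \<in> N x \<Longrightarrow> S x v = w"
  unfolding weingarten_def using normal_component_unique by blast

lemma weingarten_normal: "D x v \<xi> + d x (S x v) \<in> N x"
  using normal_component_exists[of "D x v \<xi>" x] weingarten_eqI by metis

lemma Dxi_linear: "linear (\<lambda>v. D x v \<xi>)"
  by (rule connection_linear[OF A T_bundle D_linear open_UNIV UNIV_I xi_smooth])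

lemma weingarten_linear: "linear (S x)"
proof (rule linearI)
  show "S x (v + w) = S x v + S x w" for v w
  proof (rule weingarten_eqI)
    have "h x (D x (v + w) \<xi> + d x (S x v + S x w)) (d x z) = 0" for z
      using N_D[OF weingarten_normal[of x v], of z] N_D[OF weingarten_normal[of x w], of z]
      by (simp add: linear_add[OF Dxi_linear] h_simps d_simps)
    then show "D x (v + w) \<xi> + d x (S x v + S x w) \<in> N x" by (simp add: N_iff)
  qed
  show "S x (c *\<^sub>R v) = c *\<^sub>R S x v" for c v
  proof (rule weingarten_eqI)
    have "h x (D x v \<xi>) (d x w) + h x (d x (S x v)) (d x w) = 0" for w
      using weingarten_normal[of x v] by (simp add: N_iff h_simps)
    then have "c * h x (D x v \<xi>) (d x w) + c * h x (d x (S x v)) (d x w) = 0" for w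
      by (metis distrib_left mult_zero_right)
    then show "D x (c *\<^sub>R v) \<xi> + d x (c *\<^sub>R S x v) \<in> N x"
      by (simp add: N_iff linear_cmul[OF Dxi_linear] h_simps d_simps)
  qed
qed

lemma Dxi_perp: "h x (D x v \<xi>) (\<xi> x) = 0" "h x (\<xi> x) (D x v \<xi>) = 0"
proof -
  have "0 = dfun A (\<lambda>y. h y (\<xi> y) (\<xi> y)) x v"
    by (simp add: xi_null dfun_const[OF A open_UNIV UNIV_I])
  also have "\<dots> = h x (D x v \<xi>) (\<xi> x) + h x (\<xi> x) (D x v \<xi>)"
    by (rule metric_connection_compat[OF D_metric open_UNIV UNIV_I xi_smooth xi_smooth])
  finally show "h x (D x v \<xi>) (\<xi> x) = 0" "h x (\<xi> x) (D x v \<xi>) = 0"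
    using h_sym[of x "\<xi> x" "D x v \<xi>"] by auto
qed

text \<open>Otherwise \<open>\<xi> x\<close> would be orthogonal to tangent space, \<open>\<xi> x\<close> and \<open>u\<close>, which together
  span the whole space.\<close>

lemma normal_orthogonal_xi:
  assumes u: "u \<in> N x" "h x (\<xi> x) u = 0"
  shows "u \<in> L x"
proof (rule ccontr)
  assume nu: "u \<notin> L x"
  \<comment> \<open>Tangent and normal space meet only in 0, since \<open>g\<close> is definite.
    Both independence claims below rest on this.\<close>
  have R: "v = 0" if "d x v \<in> N x" for v
    using normal_component_unique[of 0 x v 0] that by (simp add: d_simps N_iff h_simps)
  let ?R = "range (d x)"
  have sub: "subspace ?R" using linear_subspace_image[OF d_linear subspace_UNIV] .
  have spR: "span ?R = ?R" using sub by (simp add: span_eq_iff)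
  have xiN: "\<xi> x \<in> N x" using xi_normal by (simp add: N_iff)
  have 1: "\<xi> x \<notin> span ?R"
  proof
    assume "\<xi> x \<in> span ?R"
    then obtain v where "\<xi> x = d x v" unfolding spR by blast
    then show False using R[of v] xiN xi_nonzero[of x] by (simp add: d_simps)
  qed
  have 2: "u \<notin> span (insert (\<xi> x) ?R)"
  proof
    assume "u \<in> span (insert (\<xi> x) ?R)"
    then obtain c where "u - c *\<^sub>R \<xi> x \<in> ?R" by (auto simp: span_insert spR)
    then obtain v where v: "u - c *\<^sub>R \<xi> x = d x v" by auto
    have "d x v \<in> N x" using u(1) xiN unfolding v[symmetric] by (simp add: N_iff h_simps)
    then have "u = c *\<^sub>R \<xi> x" using R[of v] v by (simp add: d_simps)
    then show False using nu span_mul[OF span_base, of "\<xi> x" "{\<xi> x}" c] by simp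
  qed
  have "dim ?R = CARD('n)"
    using dim_image_eq[OF d_linear, of x UNIV] d_inj[of x] by (simp add: dim_UNIV)
  \<comment> \<open>Adjoining two independent vectors to a space of dimension n reaches n + 2, the
    full dimension by \<open>codim\<close>.\<close>
  then have "dim (insert u (insert (\<xi> x) ?R)) = DIM(real ^ 'k)"
    using 1 2 by (simp add: dim_insert codim)
  then have sp: "span (insert u (insert (\<xi> x) ?R)) = UNIV" by (rule iffD1[OF dim_eq_full])
  have "h x (\<xi> x) v = 0" for v
    by (rule linear_eq_0_on_span[OF h_linear(2)[of x "\<xi> x"], of "insert u (insert (\<xi> x) ?R)"])
      (use u(2) xi_null xi_normal sp in auto)
  then have "\<xi> x = 0" by (rule form_nondegenerate[OF h_metric])
  then show False using xi_nonzero by blast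
qed

lemma Dxi_decomposition:
  obtains c where "D x v \<xi> = c *\<^sub>R \<xi> x - d x (S x v)"
proof -
  have "D x v \<xi> + d x (S x v) \<in> L x"
    by (rule normal_orthogonal_xi[OF weingarten_normal]) (simp add: h_simps Dxi_perp xi_normal)
  then obtain c where "D x v \<xi> + d x (S x v) = c *\<^sub>R \<xi> x" by (auto simp: span_singleton)
  then have "D x v \<xi> = c *\<^sub>R \<xi> x - d x (S x v)" by (simp add: algebra_simps)
  then show ?thesis by (rule that)
qed

lemma Dxi_tangential: "h x (D x v \<xi>) (d x w) = - g x (S x v) w"
  using N_D[OF weingarten_normal[of x v], of w] by (simp add: h_simps g_eq)

text \<open>Differentiating the vanishing product of \<xi> with a tangent field expresses
  \<open>g x (S x v) w\<close> as the \<xi>-component of the second fundamental form, whose symmetry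
  is \<open>pullback_connection_dmap_symmetric\<close>.\<close>

lemma weingarten_selfadjoint: "g x (S x v) w = g x v (S x w)"
proof -
  obtain U \<phi> where c: "(U, \<phi>) \<in> A" "x \<in> U" using smooth_manifold_chart_exists[OF A] .
  note U = chart_open[OF A c(1)]
  have cA: "(U, \<lambda>y. dfun A \<phi> y) \<in> tangent_bundle A" using c(1) unfolding tangent_bundle_iff by blast
  have inv: "inv (dfun A \<phi> x) (dfun A \<phi> x v) = v" for v
    using dfun_chart_bij[OF A c] by (simp add: bij_is_inj)
  \<comment> \<open>The image under d\<Psi> of the field with constant coordinates in \<phi> that
    extends \<open>v\<close>; constancy is what the symmetry lemma requires.\<close>
  let ?X = "\<lambda>v y. d y (inv (dfun A \<phi> y) (dfun A \<phi> x v))"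
  have s: "smooth_section A T U (?X v)" for v
    by (rule smooth_section_dmap[OF A B smooth_Psi U smooth_section_frame[OF A TA cA]])
  have *: "h x (D x v \<xi>) (d x w) = - h x (\<xi> x) (D x v (?X w))" for v w
  proof -
    have "0 = dfun A (\<lambda>y. h y (\<xi> y) (?X w y)) x v"
      by (simp add: xi_normal dfun_const[OF A open_UNIV UNIV_I])
    also have "\<dots> = h x (D x v \<xi>) (?X w x) + h x (\<xi> x) (D x v (?X w))"
      by (rule metric_connection_compat[OF D_metric U c(2) xi_smooth s])
    finally show ?thesis by (simp add: inv)
  qed
  have "D x v (?X w) = D x w (?X v)"
    using pullback_connection_dmap_symmetric[OF A B smooth_Psi Dt_linear Dt_torsion PC c,
        of "dfun A \<phi> x v" "dfun A \<phi> x w"] by (simp add: inv)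
  then have "h x (D x v \<xi>) (d x w) = h x (D x w \<xi>) (d x v)" by (simp only: *)
  then show ?thesis by (simp add: Dxi_tangential g_sym[of x v])
qed

section \<open>The map \<open>\<beta>\<close>\<close>

lemma L_subspace: "subspace (L x)"
  by (rule subspace_span)

lemma L_E:
  assumes "v \<in> L x"
  obtains c where "v = c *\<^sub>R \<xi> x"
  using assms by (auto simp: span_singleton)

lemma xi_L: "c *\<^sub>R \<xi> x \<in> L x"
  by (simp add: span_base span_mul)

text \<open>The definitions of \<beta> and of the conformal structure range over arbitrary sections
  of \<open>L\<close>. Writing them as smooth multiples of \<xi> makes the Leibniz rule
  available.\<close>

lemma L_section:
  assumes W: "open W" and s: "sub_section A T L W \<sigma>"
  obtains f where "smooth_fun A W f" "\<And>y. y \<in> W \<Longrightarrow> \<sigma> y = f y *\<^sub>R \<xi> y"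
proof -
  have \<sigma>: "smooth_section A T W \<sigma>" and \<sigma>L: "\<And>y. y \<in> W \<Longrightarrow> \<sigma> y \<in> L y"
    using s unfolding sub_section_def by auto
  \<comment> \<open>The Euclidean inner product only reads off the coefficient; it has no geometric meaning and
    need not vary smoothly with the fibre.\<close>
  define f where "f y = (\<sigma> y \<bullet> \<xi> y) / (\<xi> y \<bullet> \<xi> y)" for y
  have f: "\<sigma> y = f y *\<^sub>R \<xi> y" if "y \<in> W" for y
    using \<sigma>L[OF that] xi_nonzero[of y] by (elim L_E) (simp add: f_def)
  have "smooth_fun A W f"
  proof (rule smooth_fun_local[OF A])
    fix x assume "x \<in> W"
    obtain U \<tau> where c: "(U, \<tau>) \<in> T" "x \<in> U" using vector_bundle_triv_exists[OF T_bundle] .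
    have U: "open U" by (rule triv_open[OF T_bundle c(1)])
    then have o: "open (U \<inter> W)" using W by blast
    have nz: "\<tau> y (\<xi> y) \<bullet> \<tau> y (\<xi> y) \<noteq> 0" if "y \<in> U" for y
      using triv_linear[OF T_bundle c(1) that] triv_bij[OF T_bundle c(1) that] xi_nonzero[of y]
      by (simp add: linear_injective_0 bij_def) blast
    have tx: "smooth_fun A (U \<inter> W) (\<lambda>y. \<tau> y (\<xi> y))" and ts: "smooth_fun A (U \<inter> W) (\<lambda>y. \<tau> y (\<sigma> y))"
      by (rule smooth_section_triv[OF xi_smooth c(1)], rule smooth_section_triv[OF \<sigma> c(1)])
    \<comment> \<open>By linearity of \<open>\<tau> y\<close>, the coefficient can also be computed
      from the trivialized sections, and these products are smooth.\<close>
    have "smooth_fun A (U \<inter> W) (\<lambda>y. (\<tau> y (\<sigma> y) \<bullet> \<tau> y (\<xi> y)) * inverse (\<tau> y (\<xi> y) \<bullet> \<tau> y (\<xi> y)))"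
      by (rule smooth_fun_mult[OF A o smooth_fun_inner[OF A o ts tx]
            smooth_fun_inverse[OF A o smooth_fun_inner[OF A o tx tx]]]) (use nz in blast)
    then have "smooth_fun A (U \<inter> W) f"
    proof (rule smooth_fun_cong[OF A o, rotated])
      fix y assume y: "y \<in> U \<inter> W"
      then show "(\<tau> y (\<sigma> y) \<bullet> \<tau> y (\<xi> y)) * inverse (\<tau> y (\<xi> y) \<bullet> \<tau> y (\<xi> y)) = f y"
        using f[of y] nz[of y] linear_cmul[OF triv_linear[OF T_bundle c(1)], of y "f y" "\<xi> y"]
        by simp
    qed
    then show "\<exists>V. open V \<and> x \<in> V \<and> smooth_fun A (W \<inter> V) f"
      using U c(2) by (intro exI[of _ U]) (simp add: Int_commute)
  qed
  with f show ?thesis by (rule that[rotated])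
qed

lemma D_section:
  assumes W: "open W" "x \<in> W" and f: "smooth_fun A W f" and \<sigma>: "\<And>y. y \<in> W \<Longrightarrow> \<sigma> y = f y *\<^sub>R \<xi> y"
  shows "D x v \<sigma> = dfun A f x v *\<^sub>R \<xi> x + f x *\<^sub>R D x v \<xi>"
  using connection_cong[OF A T_bundle D_linear W smooth_section_scaleR[OF A T_bundle W(1) f xi_smooth] \<sigma>]
    connection_scaleR[OF A T_bundle D_linear W f xi_smooth] by simp

lemma xi_section: "smooth_fun A W f \<Longrightarrow> open W \<Longrightarrow> sub_section A T L W (\<lambda>y. f y *\<^sub>R \<xi> y)"
  unfolding sub_section_def using smooth_section_scaleR[OF A T_bundle _ _ xi_smooth] xi_L by blast

text \<open>Whatever section \<open>SOME\<close> picks is \<open>f y *\<^sub>R \<xi> y\<close> with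
  \<open>f x = c\<close>. Its derivative differs from that of the constant multiple by a multiple of
  \<open>\<xi> x\<close>, which the quotient forgets.\<close>

lemma beta_xi: "\<beta> x X (c *\<^sub>R \<xi> x) = qclass (L x) (c *\<^sub>R D x X \<xi>)"
proof -
  let ?P = "\<lambda>\<sigma>. sub_section A T L UNIV \<sigma> \<and> \<sigma> x = c *\<^sub>R \<xi> x"
  \<comment> \<open>A witness, so that the section chosen by \<open>SOME\<close> really has the
    required property.\<close>
  have "?P (\<lambda>y. c *\<^sub>R \<xi> y)"
    using xi_section[OF smooth_fun_const[OF A open_UNIV] open_UNIV] by simp
  then have \<sigma>: "?P (SOME \<sigma>. ?P \<sigma>)" by (rule someI[of ?P])
  define \<sigma> where "\<sigma> = (SOME \<sigma>. ?P \<sigma>)"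
  have P: "sub_section A T L UNIV \<sigma>" "\<sigma> x = c *\<^sub>R \<xi> x" using \<sigma> unfolding \<sigma>_def by auto
  obtain f where f: "smooth_fun A UNIV f" "\<And>y. y \<in> UNIV \<Longrightarrow> \<sigma> y = f y *\<^sub>R \<xi> y"
    using L_section[OF open_UNIV P(1)] by blast
  have "f x = c" using f(2)[of x] P(2) xi_nonzero[of x] by simp
  then have "D x X \<sigma> - c *\<^sub>R D x X \<xi> \<in> L x"
    using D_section[OF open_UNIV UNIV_I f] by (simp add: xi_L)
  then have "qclass (L x) (D x X \<sigma>) = qclass (L x) (c *\<^sub>R D x X \<xi>)"
    by (simp only: qclass_eq_iff[OF L_subspace])
  moreover have "\<beta> x X (c *\<^sub>R \<xi> x) = qclass (L x) (D x X \<sigma>)"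
    unfolding tractor_beta_def \<sigma>_def using xi_L by simp
  ultimately show ?thesis by simp
qed

lemma perp_iff: "v \<in> perp h L x \<longleftrightarrow> h x v (\<xi> x) = 0"
proof
  assume "v \<in> perp h L x"
  then show "h x v (\<xi> x) = 0" unfolding perp_def using span_base[of "\<xi> x" "{\<xi> x}"] by blast
next
  assume *: "h x v (\<xi> x) = 0"
  show "v \<in> perp h L x"
    unfolding perp_def using * by (auto elim!: L_E simp: h_simps)
qed

section \<open>Fibrewise bijectivity of \<beta>\<close>

lemma beta_in_hom: "\<beta> x X \<in> hom_quotient (perp h L x) (L x)"
  unfolding hom_quotient_def
proof (intro CollectI conjI ballI allI)
  show "\<beta> x X \<in> L x \<rightarrow>\<^sub>E quotient_space (perp h L x) (L x)"
  proof (rule PiE_I)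
    fix v assume "v \<in> L x"
    then show "\<beta> x X v \<in> quotient_space (perp h L x) (L x)"
      by (elim L_E) (simp add: beta_xi quotient_space_def perp_iff h_simps Dxi_perp)
  qed (simp add: tractor_beta_def)
next
  fix v w assume "v \<in> L x" "w \<in> L x"
  then obtain a b where "v = a *\<^sub>R \<xi> x" "w = b *\<^sub>R \<xi> x" by (metis L_E)
  then show "\<beta> x X (v + w) = qadd (\<beta> x X v) (\<beta> x X w)"
    by (simp add: scaleR_add_left[symmetric] beta_xi qadd_qclass[OF L_subspace])
next
  fix c v assume "v \<in> L x"
  then obtain a where "v = a *\<^sub>R \<xi> x" by (metis L_E)
  then show "\<beta> x X (c *\<^sub>R v) = qscale (L x) c (\<beta> x X v)"
    by (simp add: beta_xi qscale_qclass[OF L_subspace])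
qed

text \<open>\<open>L x\<close> is spanned by \<open>\<xi> x\<close>, so homogeneity fixes the map on
  \<open>L x\<close>; outside it, extensionality does.\<close>

lemma hom_quotient_eqI:
  assumes "F \<in> hom_quotient V (L x)" "G \<in> hom_quotient V (L x)" "F (\<xi> x) = G (\<xi> x)"
  shows "F = G"
proof
  fix v
  show "F v = G v"
  proof (cases "v \<in> L x")
    case True
    then obtain c where c: "v = c *\<^sub>R \<xi> x" by (metis L_E)
    have "\<xi> x \<in> L x" by (simp add: span_base)
    then have "F v = qscale (L x) c (F (\<xi> x))" "G v = qscale (L x) c (G (\<xi> x))"
      using assms(1,2) unfolding c hom_quotient_def by blast+
    then show ?thesis using assms(3) by simp
  next
    case False
    have "F \<in> L x \<rightarrow>\<^sub>E quotient_space V (L x)" "G \<in> L x \<rightarrow>\<^sub>E quotient_space V (L x)"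
      using assms(1,2) unfolding hom_quotient_def by blast+
    then show ?thesis using False by (metis PiE_arb)
  qed
qed

lemma beta_at_xi: "\<beta> x X (\<xi> x) = qclass (L x) (D x X \<xi>)"
  using beta_xi[of x X 1] by simp

lemma beta_eq_iff: "\<beta> x X = \<beta> x Y \<longleftrightarrow> S x X = S x Y"
proof -
  have "\<beta> x X = \<beta> x Y \<longleftrightarrow> D x X \<xi> - D x Y \<xi> \<in> L x"
    using hom_quotient_eqI[OF beta_in_hom beta_in_hom, of x X Y] qclass_eq_iff[OF L_subspace]
    by (metis beta_at_xi)
  also have "\<dots> \<longleftrightarrow> S x X = S x Y"
  proof -
    obtain a where a: "D x X \<xi> = a *\<^sub>R \<xi> x - d x (S x X)" using Dxi_decomposition .
    obtain b where b: "D x Y \<xi> = b *\<^sub>R \<xi> x - d x (S x Y)" using Dxi_decomposition .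
    have eq: "D x X \<xi> - D x Y \<xi> = (a - b) *\<^sub>R \<xi> x + d x (S x Y - S x X)"
      unfolding a b by (simp add: d_simps algebra_simps)
    show ?thesis
    proof
      assume "D x X \<xi> - D x Y \<xi> \<in> L x"
      then obtain c where "D x X \<xi> - D x Y \<xi> = c *\<^sub>R \<xi> x" by (metis L_E)
      then have c: "d x (S x Y - S x X) = (c - (a - b)) *\<^sub>R \<xi> x"
        using eq by (simp add: algebra_simps)
      \<comment> \<open>A tangent vector proportional to \<xi> is orthogonal to every tangent
        vector, hence zero by nondegeneracy of \<open>g\<close>.\<close>
      have "g x (S x Y - S x X) w = 0" for w
        unfolding g_eq c by (simp add: h_simps xi_normal)
      then show "S x X = S x Y" using g_nondegenerate[of x "S x Y - S x X"] by simp
    next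
      assume "S x X = S x Y"
      then show "D x X \<xi> - D x Y \<xi> \<in> L x" unfolding eq by (simp add: d_simps xi_L)
    qed
  qed
  finally show ?thesis .
qed

text \<open>Elements of the Hom fibre are set-valued functions, so surjectivity is shown by an
  explicit preimage rather than by counting dimensions.\<close>

lemma beta_bij_iff: "bij_betw (\<beta> x) UNIV (hom_quotient (perp h L x) (L x)) \<longleftrightarrow> bij (S x)"
proof
  assume "bij_betw (\<beta> x) UNIV (hom_quotient (perp h L x) (L x))"
  then have "inj (\<beta> x)" by (simp add: bij_betw_def)
  then have "inj (S x)" using beta_eq_iff by (simp add: inj_def)
  then show "bij (S x)"
    using linear_injective_imp_surjective[OF weingarten_linear] by (simp add: bij_def)
next
  assume S: "bij (S x)"
  have "inj (\<beta> x)" using bij_is_inj[OF S] beta_eq_iff by (simp add: inj_def)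
  moreover have "F \<in> range (\<beta> x)" if F: "F \<in> hom_quotient (perp h L x) (L x)" for F
  proof -
    have "F \<in> L x \<rightarrow>\<^sub>E quotient_space (perp h L x) (L x)" using F unfolding hom_quotient_def by blast
    moreover have "\<xi> x \<in> L x" by (simp add: span_base)
    ultimately have "F (\<xi> x) \<in> quotient_space (perp h L x) (L x)" by (rule PiE_mem)
    then obtain a where a: "a \<in> perp h L x" "F (\<xi> x) = qclass (L x) a"
      unfolding quotient_space_def by blast
    \<comment> \<open>Modulo \<xi> the representative \<open>a\<close> equals
      \<open>- d x w\<close>, and so does the derivative of \<xi> along the solution
      \<open>X\<close> of \<open>S x X = w\<close>.\<close>
    obtain w where w: "a + d x w \<in> N x" using normal_component_exists by blast
    have "a + d x w \<in> L x"
      by (rule normal_orthogonal_xi[OF w])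
        (use a(1) in \<open>simp add: perp_iff h_simps xi_normal h_sym[of x "\<xi> x" a]\<close>)
    then obtain c where c: "a + d x w = c *\<^sub>R \<xi> x" by (metis L_E)
    obtain X where X: "S x X = w" using bij_is_surj[OF S] by (metis surjD)
    obtain b where b: "D x X \<xi> = b *\<^sub>R \<xi> x - d x (S x X)" using Dxi_decomposition .
    have "D x X \<xi> - a = (b - c) *\<^sub>R \<xi> x"
      using c unfolding b X by (simp add: algebra_simps)
    then have "\<beta> x X (\<xi> x) = F (\<xi> x)"
      using xi_L unfolding beta_at_xi a(2) qclass_eq_iff[OF L_subspace] by simp
    from hom_quotient_eqI[OF beta_in_hom F this] show ?thesis by blast
  qed
  ultimately show "bij_betw (\<beta> x) UNIV (hom_quotient (perp h L x) (L x))"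
    using beta_in_hom unfolding bij_betw_def by blast
qed

lemma beta_linear:
  assumes "v \<in> L x"
  shows "\<beta> x (X + Y) v = qadd (\<beta> x X v) (\<beta> x Y v)" "\<beta> x (c *\<^sub>R X) v = qscale (L x) c (\<beta> x X v)"
proof -
  obtain a where "v = a *\<^sub>R \<xi> x" using assms by (rule L_E)
  then show "\<beta> x (X + Y) v = qadd (\<beta> x X v) (\<beta> x Y v)" "\<beta> x (c *\<^sub>R X) v = qscale (L x) c (\<beta> x X v)"
    by (simp_all add: beta_xi qadd_qclass[OF L_subspace] qscale_qclass[OF L_subspace]
        linear_add[OF Dxi_linear] linear_cmul[OF Dxi_linear] scaleR_add_right mult.commute)
qed

text \<open>For a section \<open>f\<close> times \<xi> of \<open>L\<close>, the field
  \<open>f y *\<^sub>R D y (X y) \<xi>\<close> is a smooth lift that stays orthogonal to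
  \<xi>.\<close>

lemma beta_smooth:
  assumes W: "open W" and X: "smooth_section A (tangent_bundle A) W X"
  shows "smooth_hom_section A T (perp h L) L W (\<lambda>x. \<beta> x (X x))"
  unfolding smooth_hom_section_def
proof (intro allI impI)
  fix W' \<sigma> assume "open W' \<and> W' \<subseteq> W \<and> sub_section A T L W' \<sigma>"
  then have W': "open W'" "W' \<subseteq> W" and \<sigma>: "sub_section A T L W' \<sigma>" by auto
  obtain f where f: "smooth_fun A W' f" "\<And>y. y \<in> W' \<Longrightarrow> \<sigma> y = f y *\<^sub>R \<xi> y"
    using L_section[OF W'(1) \<sigma>] by blast
  let ?s = "\<lambda>y. f y *\<^sub>R D y (X y) \<xi>"
  have "smooth_section A T W' ?s"
    by (rule smooth_section_scaleR[OF A T_bundle W'(1) f(1)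
          connection_smooth[OF A T_bundle D_linear W'(1) xi_smooth smooth_section_subset[OF X W'(2)]]])
  then have s: "sub_section A T (perp h L) W' ?s"
    unfolding sub_section_def by (simp add: perp_iff h_simps Dxi_perp)
  have "\<beta> y (X y) (\<sigma> y) = qclass (L y) (?s y)" if "y \<in> W'" for y
    by (simp add: f(2)[OF that] beta_xi)
  then show "smooth_quotient_section A T (perp h L) L W' (\<lambda>x. \<beta> x (X x) (\<sigma> x))"
    unfolding smooth_quotient_section_def using W'(1) s by blast
qed

text \<open>In a coordinate frame, \<open>X\<close> solves the linear system with matrix
  \<open>h (D_i \<xi>) (d e_j) = - g (S e_i) e_j\<close>; Cramer's rule shows that the solution is smooth.\<close>

lemma beta_inverse_smooth:
  assumes S: "\<And>x. bij (S x)" and W: "open W"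
    and X: "smooth_hom_section A T (perp h L) L W (\<lambda>x. \<beta> x (X x))"
  shows "smooth_section A (tangent_bundle A) W X"
proof (rule smooth_section_local[OF A TA])
  fix x assume x: "x \<in> W"
  have "sub_section A T L W \<xi>"
    unfolding sub_section_def using xi_smooth by (simp add: span_base)
  then have "smooth_quotient_section A T (perp h L) L W (\<lambda>x. \<beta> x (X x) (\<xi> x))"
    using X W unfolding smooth_hom_section_def by blast
  from bspec[OF this[unfolded smooth_quotient_section_def] x]
  obtain W' s where "open W' \<and> x \<in> W' \<and> W' \<subseteq> W \<and> sub_section A T (perp h L) W' s \<and>
      (\<forall>y\<in>W'. \<beta> y (X y) (\<xi> y) = qclass (L y) (s y))" by blast
  then have W': "open W'" "x \<in> W'" "W' \<subseteq> W" and s: "sub_section A T (perp h L) W' s"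
    and q: "\<And>y. y \<in> W' \<Longrightarrow> \<beta> y (X y) (\<xi> y) = qclass (L y) (s y)"
    by auto
  obtain U \<phi> where c: "(U, \<phi>) \<in> A" "x \<in> U" using smooth_manifold_chart_exists[OF A] .
  note U = chart_open[OF A c(1)]
  have cA: "(U, \<lambda>y. dfun A \<phi> y) \<in> tangent_bundle A" using c(1) unfolding tangent_bundle_iff by blast
  define O' where "O' = W' \<inter> U"
  have o: "open O'" and sub: "O' \<subseteq> W'" "O' \<subseteq> U" using W'(1) U by (auto simp: O'_def)
  define e where "e i y = inv (dfun A \<phi> y) (axis i 1)" for i :: 'n and y
  define G where "G y = (\<chi> j i. h y (D y (e i y) \<xi>) (d y (e j y)))" for y
  define b where "b y = (\<chi> j. h y (s y) (d y (e j y)))" for y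
  let ?c = "\<lambda>y. dfun A \<phi> y (X y)"
  have e: "smooth_section A (tangent_bundle A) O' (e i)" for i
    unfolding e_def by (rule smooth_section_subset[OF smooth_section_frame[OF A TA cA] sub(2)])
  have de: "smooth_section A T O' (\<lambda>y. d y (e i y))" for i
    by (rule smooth_section_dmap[OF A B smooth_Psi o e])
  have Gs: "smooth_fun A O' (\<lambda>y. G y $ j $ i)" for i j
    using bundle_metric_smooth[OF h_metric o connection_smooth[OF A T_bundle D_linear o xi_smooth e] de]
    by (simp add: G_def)
  have bs: "smooth_fun A O' (\<lambda>y. b y $ j)" for j
    using bundle_metric_smooth[OF h_metric o smooth_section_subset[OF _ sub(1)] de] s
    by (simp add: b_def sub_section_def)
  have expand: "(\<Sum>i\<in>UNIV. (dfun A \<phi> y v $ i) *\<^sub>R e i y) = v" if "y \<in> O'" for y v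
  proof -
    have y: "y \<in> U" using that sub by blast
    have l: "linear (inv (dfun A \<phi> y))"
      by (rule linear_inv_bij[OF dfun_chart_linear[OF A c(1) y] dfun_chart_bij[OF A c(1) y]])
    have "(\<Sum>i\<in>UNIV. (dfun A \<phi> y v $ i) *\<^sub>R e i y) =
        inv (dfun A \<phi> y) (\<Sum>i\<in>UNIV. (dfun A \<phi> y v $ i) *\<^sub>R axis i 1)"
      by (simp add: e_def linear_sum[OF l] linear_cmul[OF l])
    also have "\<dots> = inv (dfun A \<phi> y) (dfun A \<phi> y v)"
      using basis_expansion[of "dfun A \<phi> y v"] by (simp add: scalar_mult_eq_scaleR)
    also have "\<dots> = v" using dfun_chart_bij[OF A c(1) y] by (simp add: bij_is_inj)
    finally show ?thesis .
  qed
  have GE: "(G y *v dfun A \<phi> y v) $ j = h y (D y v \<xi>) (d y (e j y))" if "y \<in> O'" for y v j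
  proof -
    have "h y (D y v \<xi>) (d y (e j y)) =
        h y (D y (\<Sum>i\<in>UNIV. (dfun A \<phi> y v $ i) *\<^sub>R e i y) \<xi>) (d y (e j y))"
      by (simp only: expand[OF that])
    also have "\<dots> = (\<Sum>i\<in>UNIV. (dfun A \<phi> y v $ i) * h y (D y (e i y) \<xi>) (d y (e j y)))"
      by (simp only: linear_sum[OF Dxi_linear] linear_cmul[OF Dxi_linear] linear_sum[OF h_linear(1)]
          linear_cmul[OF h_linear(1)] real_scaleR_def)
    also have "\<dots> = (G y *v dfun A \<phi> y v) $ j"
      by (simp add: G_def matrix_vector_mult_def mult.commute)
    finally show ?thesis by simp
  qed
  \<comment> \<open>A kernel vector of \<open>G y\<close> consists of the coordinates of some
    \<open>v\<close> with \<open>S y v\<close> orthogonal to the whole frame; then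
    \<open>S y v = 0\<close>, and \<open>v = 0\<close> because \<open>S y\<close> is
    injective.\<close>
  have det: "det (G y) \<noteq> 0" if y: "y \<in> O'" for y
  proof -
    have yU: "y \<in> U" using y sub by blast
    note bij = dfun_chart_bij[OF A c(1) yU]
    have "w = 0" if w: "G y *v w = 0" for w
    proof -
      obtain v where v: "w = dfun A \<phi> y v" using bij_is_surj[OF bij] by (metis surjD)
      have ge: "g y (S y v) (e j y) = 0" for j
        using GE[OF y, of v j] w unfolding v by (simp add: Dxi_tangential)
      have "g y (S y v) u = 0" for u
      proof -
        have "g y (S y v) u = g y (S y v) (\<Sum>i\<in>UNIV. (dfun A \<phi> y u $ i) *\<^sub>R e i y)"
          by (simp only: expand[OF y])
        also have "\<dots> = 0"
          by (simp only: linear_sum[OF g_linear(2)] linear_cmul[OF g_linear(2)] ge) simp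
        finally show ?thesis .
      qed
      then have "S y v = 0" by (rule g_nondegenerate)
      then have "v = 0"
        using bij_is_inj[OF S[of y]] linear_0[OF weingarten_linear[of y]] by (metis injD)
      then show "w = 0" unfolding v using linear_0[OF dfun_chart_linear[OF A c(1) yU]] by simp
    qed
    then have "invertible (G y)"
      using matrix_left_invertible_ker[of "G y"] invertible_left_inverse[of "G y"] by blast
    then show ?thesis by (simp add: invertible_det_nz)
  qed
  \<comment> \<open>The lift \<open>s\<close> is known only modulo \<xi>, which is invisible when
    paired with tangent vectors.\<close>
  have sys: "G y *v ?c y = b y" if y: "y \<in> O'" for y
  proof -
    have "D y (X y) \<xi> - s y \<in> L y"
      using q[of y] y sub(1) unfolding beta_at_xi qclass_eq_iff[OF L_subspace] by blast
    then obtain a where a: "D y (X y) \<xi> - s y = a *\<^sub>R \<xi> y" by (rule L_E)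
    have "h y (D y (X y) \<xi>) (d y w) - h y (s y) (d y w) = 0" for w
      using arg_cong[OF a, of "\<lambda>u. h y u (d y w)"] by (simp add: h_simps xi_normal)
    then show ?thesis by (simp add: vec_eq_iff GE[OF y] b_def)
  qed
  \<comment> \<open>\<open>G y\<close> with column \<open>k\<close> replaced by the right-hand side,
    the numerator matrix of Cramer's rule.\<close>
  define C where "C k y = (\<chi> i j. if j = k then b y $ i else G y $ i $ j)" for k y
  have Cs: "smooth_fun A O' (\<lambda>y. C k y $ i $ j)" for k i j
    using bs Gs by (cases "j = k") (simp_all add: C_def)
  have comp: "smooth_fun A O' (\<lambda>y. ?c y $ k)" for k
  proof (rule smooth_fun_cong[OF A o])
    show "smooth_fun A O' (\<lambda>y. det (C k y) * inverse (det (G y)))"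
      by (rule smooth_fun_mult[OF A o smooth_fun_det[OF A o Cs]
            smooth_fun_inverse[OF A o smooth_fun_det[OF A o Gs] det]])
    fix y assume y: "y \<in> O'"
    show "det (C k y) * inverse (det (G y)) = ?c y $ k"
      using cramer[OF det[OF y], of "?c y" "b y"] sys[OF y] by (simp add: C_def divide_inverse)
  qed
  have "smooth_fun A O' ?c"
  proof (rule smooth_fun_cong[OF A o])
    show "smooth_fun A O' (\<lambda>y. \<Sum>k\<in>UNIV. (?c y $ k) *\<^sub>R axis k 1)"
      by (rule smooth_fun_sum[OF A o smooth_fun_scaleR[OF A o comp smooth_fun_const[OF A o]]])
    show "(\<Sum>k\<in>UNIV. (?c y $ k) *\<^sub>R axis k 1) = ?c y" for y
      using basis_expansion[of "?c y"] by (simp add: scalar_mult_eq_scaleR)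
  qed
  then have "smooth_section A (tangent_bundle A) O' X"
    by (rule smooth_section_if_triv[OF A TA o cA sub(2)])
  then have "smooth_section A (tangent_bundle A) (W \<inter> O') X"
    by (rule smooth_section_subset) simp
  then show "\<exists>V. open V \<and> x \<in> V \<and> smooth_section A (tangent_bundle A) (W \<inter> V) X"
    using o W'(2) c(2) unfolding O'_def by blast
qed

text \<open>Linearity and metric compatibility of \<open>D\<close> always hold here, and \<beta> is
  always linear and smooth. What remains is fibrewise bijectivity, from which the smooth inverse
  follows.\<close>

lemma tractor_connection_iff: "tractor_connection A T L h D \<longleftrightarrow> (\<forall>x. bij (S x))"
proof
  assume "tractor_connection A T L h D"
  then have "\<forall>x. bij_betw (\<beta> x) UNIV (hom_quotient (perp h L x) (L x))"
    unfolding tractor_connection_def bundle_iso_to_hom_def by blast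
  then show "\<forall>x. bij (S x)" by (simp add: beta_bij_iff)
next
  assume S: "\<forall>x. bij (S x)"
  have "bundle_iso_to_hom A T (perp h L) L \<beta>"
    unfolding bundle_iso_to_hom_def beta_bij_iff
  proof (intro conjI allI impI ballI)
    show "bij (S x)" for x using S by blast
    fix W :: "'m set" and X assume "open W"
    then show "smooth_section A (tangent_bundle A) W X \<longleftrightarrow>
        smooth_hom_section A T (perp h L) L W (\<lambda>x. \<beta> x (X x))"
      using beta_smooth beta_inverse_smooth S by blast
  qed (simp_all only: beta_linear)
  then show "tractor_connection A T L h D"
    unfolding tractor_connection_def using D_linear D_metric by blast
qed

lemma tractor_conformal_bundle: "tractor_conformal_bundle A T L h"
  unfolding tractor_conformal_bundle_def
proof (intro conjI allI ballI)
  \<comment> \<open>The ambient signature (n + 2 - 1, 1) is the required (n + 1, 1).\<close>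
  show "has_signature (DIM(real ^ 'n) + 1) 1 (h x)" for x
    using lorentz codim unfolding lorentzian_metric_def by simp
  show "line_subbundle A T L"
    unfolding line_subbundle_def
  proof (intro conjI allI)
    show "dim (L x) = 1" for x using xi_nonzero[of x] by (simp add: dim_insert)
    show "\<exists>W s. open W \<and> x \<in> W \<and> smooth_section A T W s \<and> (\<forall>y\<in>W. L y = span {s y})" for x
      using xi_smooth[of UNIV] by (intro exI[of _ UNIV] exI[of _ \<xi>]) simp
  qed (rule L_subspace)
  show "h x v v = 0" if "v \<in> L x" for x v
    using that by (elim L_E) (simp add: h_simps xi_null)
qed (use A T_bundle h_metric dim2 codim in simp_all)

section \<open>The conformal structure\<close>

lemma tractor_metric_section:
  assumes f: "smooth_fun A UNIV f" and \<sigma>: "\<And>y. \<sigma> y = f y *\<^sub>R \<xi> y"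
  shows "tractor_metric L h D \<sigma> x X Y = (f x)\<^sup>2 * g x (S x (S x X)) Y"
proof -
  \<comment> \<open>The derivative of \<open>f\<close> and the \<xi>-component of
    \<open>D x X \<xi>\<close> only contribute multiples of \<xi>, so each class has a tangential
    representative.\<close>
  have rep: "qclass (L x) (D x X \<sigma>) = qclass (L x) (- (f x *\<^sub>R d x (S x X)))" for X
  proof -
    obtain c where c: "D x X \<xi> = c *\<^sub>R \<xi> x - d x (S x X)" using Dxi_decomposition .
    have "D x X \<sigma> - - (f x *\<^sub>R d x (S x X)) = (dfun A f x X + f x * c) *\<^sub>R \<xi> x"
      unfolding D_section[OF open_UNIV UNIV_I f \<sigma>] c by (simp add: algebra_simps)
    then show ?thesis unfolding qclass_eq_iff[OF L_subspace] by (simp add: xi_L)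
  qed
  have "tractor_metric L h D \<sigma> x X Y = h x (- (f x *\<^sub>R d x (S x X))) (- (f x *\<^sub>R d x (S x Y)))"
    unfolding tractor_metric_def rep
  proof (rule quotient_form_qclass[OF form_bilinear[OF h_metric] L_subspace])
    show "h x u w = 0" if "u \<in> L x" "w \<in> L x" for u w
      using that by (elim L_E) (simp add: h_simps xi_null)
    have "h x (- (f x *\<^sub>R d x v)) w = 0 \<and> h x w (- (f x *\<^sub>R d x v)) = 0" if "w \<in> L x" for v w
      using that by (elim L_E) (simp add: h_simps xi_normal linear_neg[OF h_linear(1)] linear_neg[OF h_linear(2)])
    then show "h x (- (f x *\<^sub>R d x (S x X))) w = 0 \<and> h x w (- (f x *\<^sub>R d x (S x X))) = 0"
      "h x (- (f x *\<^sub>R d x (S x Y))) w = 0 \<and> h x w (- (f x *\<^sub>R d x (S x Y))) = 0"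
      if "w \<in> L x" for w using that by blast+
  qed
  also have "\<dots> = (f x)\<^sup>2 * g x (S x X) (S x Y)"
    by (simp add: h_simps linear_neg[OF h_linear(1)] linear_neg[OF h_linear(2)] g_eq power2_eq_square)
  finally show ?thesis by (simp add: weingarten_selfadjoint)
qed

text \<open>A zero of \<open>l\<close> would make the square of \<open>S x\<close> vanish, against
  injectivity on a nonzero space.\<close>

lemma weingarten_square_nonzero:
  assumes "\<forall>x. bij (S x)" "\<And>x v. S x (S x v) = (l x)\<^sup>2 *\<^sub>R v"
  shows "l x \<noteq> 0"
proof
  assume "l x = 0"
  then have "S x (S x v) = S x (S x 0)" for v using assms(2) by simp
  moreover have "inj (S x)" using assms(1) by (simp add: bij_is_inj)
  ultimately have "v = 0" for v :: "real ^ 'n" by (meson injD)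
  \<comment> \<open>Any nonzero vector serves; the index type is inhabited, so an arbitrary axis is
    available.\<close>
  from this[of "axis undefined 1"] show False by simp
qed

lemma conformal_class_iff:
  assumes S: "\<forall>x. bij (S x)"
  shows "g \<in> tractor_conformal_structure A T L h D \<longleftrightarrow>
    (\<exists>l. smooth_fun A UNIV (l :: 'm \<Rightarrow> real) \<and> (\<forall>x v. S x (S x v) = (l x)\<^sup>2 *\<^sub>R v))"
proof
  assume "g \<in> tractor_conformal_structure A T L h D"
  then obtain \<sigma> u where \<sigma>: "sub_section A T L UNIV \<sigma>" "\<And>x. \<sigma> x \<noteq> 0" and u: "smooth_fun A UNIV u"
    and gu: "g = (\<lambda>x v w. exp (2 * u x) * tractor_metric L h D \<sigma> x v w)"
    unfolding tractor_conformal_structure_def conformally_equivalent_def by auto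
  obtain f where f: "smooth_fun A UNIV f" "\<And>y. y \<in> UNIV \<Longrightarrow> \<sigma> y = f y *\<^sub>R \<xi> y"
    using L_section[OF open_UNIV \<sigma>(1)] by blast
  \<comment> \<open>Both this factor and the exponential are nonzero, so \<open>l\<close> is smooth
    as the inverse of their product.\<close>
  have f0: "f x \<noteq> 0" for x using f(2)[of x] \<sigma>(2)[of x] by auto
  define l where "l x = inverse (exp (u x) * f x)" for x
  have "smooth_fun A UNIV l"
    unfolding l_def
    by (rule smooth_fun_inverse[OF A open_UNIV smooth_fun_mult[OF A open_UNIV
            smooth_fun_exp[OF A open_UNIV u] f(1)]]) (simp add: f0)
  moreover have "S x (S x v) = (l x)\<^sup>2 *\<^sub>R v" for x v
  proof -
    let ?m = "exp (u x) * f x"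
    have m: "?m\<^sup>2 = exp (2 * u x) * (f x)\<^sup>2" by (simp add: power_mult_distrib exp_double)
    have m0: "?m \<noteq> 0" using f0 by simp
    have "g x v w = exp (2 * u x) * tractor_metric L h D \<sigma> x v w" for w
      by (rule fun_cong[OF fun_cong[OF fun_cong[OF gu]]])
    then have gS: "g x v w = ?m\<^sup>2 * g x (S x (S x v)) w" for w
      using tractor_metric_section[OF f(1) f(2)[OF UNIV_I], of x v w] m by (simp add: mult.assoc)
    \<comment> \<open>Equality of forms becomes equality of endomorphisms because \<open>g\<close>
      is nondegenerate.\<close>
    have "g x (v - ?m\<^sup>2 *\<^sub>R S x (S x v)) w = 0" for w
      using gS[of w] by (simp add: linear_diff[OF g_linear(1)] linear_cmul[OF g_linear(1)])
    then have "v - ?m\<^sup>2 *\<^sub>R S x (S x v) = 0" by (rule g_nondegenerate)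
    then have "(inverse ?m)\<^sup>2 *\<^sub>R v = ((inverse ?m)\<^sup>2 * ?m\<^sup>2) *\<^sub>R S x (S x v)"
      by (simp add: scaleR_scaleR[symmetric] del: scaleR_scaleR)
    also have "(inverse ?m)\<^sup>2 * ?m\<^sup>2 = 1"
      using m0 by (simp add: power_mult_distrib[symmetric] del: inverse_mult_distrib)
    finally show ?thesis by (simp add: l_def)
  qed
  ultimately show "\<exists>l. smooth_fun A UNIV (l :: 'm \<Rightarrow> real) \<and> (\<forall>x v. S x (S x v) = (l x)\<^sup>2 *\<^sub>R v)"
    by blast
next
  assume "\<exists>l. smooth_fun A UNIV (l :: 'm \<Rightarrow> real) \<and> (\<forall>x v. S x (S x v) = (l x)\<^sup>2 *\<^sub>R v)"
  then obtain l :: "'m \<Rightarrow> real" where l: "smooth_fun A UNIV l" "\<And>x v. S x (S x v) = (l x)\<^sup>2 *\<^sub>R v"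
    by blast
  have l0: "l x \<noteq> 0" for x by (rule weingarten_square_nonzero[OF S l(2)])
  \<comment> \<open>With this scaling the tractor metric of \<open>f\<close> times \<xi> equals
    \<open>g\<close> itself, so the conformal exponent is 0 and the sign of \<open>l\<close> does
    not matter.\<close>
  define f where "f x = inverse (l x)" for x
  have f: "smooth_fun A UNIV f"
    unfolding f_def by (rule smooth_fun_inverse[OF A open_UNIV l(1) l0])
  let ?\<sigma> = "\<lambda>y. f y *\<^sub>R \<xi> y"
  have "(f x)\<^sup>2 * (l x)\<^sup>2 = 1" for x
    using l0[of x] by (simp add: f_def power_mult_distrib[symmetric])
  then have "tractor_metric L h D ?\<sigma> x v w = g x v w" for x v w
    by (simp add: tractor_metric_section[OF f refl] l(2) linear_cmul[OF g_linear(1)]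
        mult.assoc[symmetric])
  then have "g = (\<lambda>x v w. exp (2 * 0) * tractor_metric L h D ?\<sigma> x v w)" by simp
  then have "conformally_equivalent A (tractor_metric L h D ?\<sigma>) g"
    unfolding conformally_equivalent_def using smooth_fun_const[OF A open_UNIV, of "0::real"] by blast
  moreover have "sub_section A T L UNIV ?\<sigma>" by (rule xi_section[OF f open_UNIV])
  moreover have "?\<sigma> x \<noteq> 0" for x using l0[of x] xi_nonzero[of x] by (simp add: f_def)
  ultimately show "g \<in> tractor_conformal_structure A T L h D"
    unfolding tractor_conformal_structure_def by blast
qed

end

theorem proposition3p1:
  fixes A :: "('m::{t2_space,second_countable_topology}, real ^ 'n) chart set"
    and B :: "('p::{t2_space,second_countable_topology}, real ^ 'k) chart set"
    and gt :: "('p, real ^ 'k) form_field"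
    and \<Psi> :: "'m \<Rightarrow> 'p"
    and \<xi> :: "'m \<Rightarrow> real ^ 'k"
    and Dt :: "('p, real ^ 'k, real ^ 'k) connection"
    and D :: "('m, real ^ 'n, real ^ 'k) connection"
    and g :: "('m, real ^ 'n) form_field"
    and T :: "('m, real ^ 'k) triv set"
    and h :: "('m, real ^ 'k) form_field"
    and T1 :: "'m \<Rightarrow> (real ^ 'k) set"
  assumes "CARD('n) \<ge> 2" and "CARD('k) = CARD('n) + 2"
    and "smooth_manifold A" and "connected (UNIV :: 'm set)"
    and "smooth_manifold B" and "lorentzian_metric B gt"
    and "spacelike_immersion A B gt \<Psi>"
    and "normal_field A B \<Psi> gt \<xi>" and "lightlike_field \<Psi> gt \<xi>"
    and "levi_civita B gt Dt" and "pullback_connection A B \<Psi> Dt D"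
    and "g = induced_metric A B \<Psi> gt"
    and "T = pullback_bundle \<Psi> (tangent_bundle B)"
    and "h = (\<lambda>x. gt (\<Psi> x))"
    and "T1 = (\<lambda>x. span {\<xi> x})"
  shows "tractor_conformal_bundle A T T1 h \<and>
    (tractor_connection A T T1 h D \<longleftrightarrow> (\<forall>x. bij (weingarten A B \<Psi> gt D \<xi> x))) \<and>
    (tractor_connection A T T1 h D \<longrightarrow>
       (g \<in> tractor_conformal_structure A T T1 h D \<longleftrightarrow>
          (\<exists>l. smooth_fun A UNIV (l :: 'm \<Rightarrow> real) \<and>
             (\<forall>x v. weingarten A B \<Psi> gt D \<xi> x (weingarten A B \<Psi> gt D \<xi> x v) = (l x)\<^sup>2 *\<^sub>R v))) \<and>
       (\<forall>l. smooth_fun A UNIV (l :: 'm \<Rightarrow> real) \<and>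
             (\<forall>x v. weingarten A B \<Psi> gt D \<xi> x (weingarten A B \<Psi> gt D \<xi> x v) = (l x)\<^sup>2 *\<^sub>R v) \<longrightarrow>
             (\<forall>x. l x \<noteq> 0)))"
proof -
  interpret lightlike_normal A B gt \<Psi> \<xi> Dt D
    by unfold_locales (use assms in simp_all)
  let ?T = "pullback_bundle \<Psi> (tangent_bundle B)" and ?T1 = "\<lambda>x. span {\<xi> x}"
    and ?h = "\<lambda>x. gt (\<Psi> x)" and ?g = "induced_metric A B \<Psi> gt"
    and ?S = "weingarten A B \<Psi> gt D \<xi>"
  show ?thesis
    unfolding assms(12-15)
  proof (intro conjI impI allI)
    show "tractor_conformal_bundle A ?T ?T1 ?h" by (rule tractor_conformal_bundle)
    show "tractor_connection A ?T ?T1 ?h D \<longleftrightarrow> (\<forall>x. bij (?S x))" by (rule tractor_connection_iff)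
    assume "tractor_connection A ?T ?T1 ?h D"
    then have bij: "\<forall>x. bij (?S x)" by (simp add: tractor_connection_iff)
    show "?g \<in> tractor_conformal_structure A ?T ?T1 ?h D \<longleftrightarrow>
        (\<exists>l. smooth_fun A UNIV (l :: 'm \<Rightarrow> real) \<and> (\<forall>x v. ?S x (?S x v) = (l x)\<^sup>2 *\<^sub>R v))"
      by (rule conformal_class_iff[OF bij])
    fix l :: "'m \<Rightarrow> real" and x
    assume "smooth_fun A UNIV l \<and> (\<forall>x v. ?S x (?S x v) = (l x)\<^sup>2 *\<^sub>R v)"
    then show "l x \<noteq> 0" by (intro weingarten_square_nonzero[OF bij]) blast
  qed
qed

end
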